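(* Let $M$ be a von Neumann algebra with separable predual, endowed with a faithful normal state $\varphi$. Then each of the following is a closed subset of $\mathcal{E}_\varphi$: (i) the set of all $N\in\mathcal{E}_\varphi$ which are amenable; (ii) the set of all $N\in\mathcal{E}_\varphi$ satisfying the Haagerup property; (iii) for every real $C\geq 0$, the set of all $N\in\mathcal{E}_\varphi$ whose Cowling–Haagerup constant satisfies $\Lambda_{cb}(N)\leq C$.
   Context: $\mathcal{E}_\varphi$ is the set of (unital) von Neumann subalgebras $N\subseteq M$ admitting a conditional expectation $\mathbb{E}_N^\varphi:M\to N$ with $\varphi\circ\mathbb{E}_N^\varphi=\varphi$ (such an expectation is unique and automatically normal). It carries the topology of pointwise strong convergence of the maps $\mathbb{E}_N^\varphi$ (equivalently, pointwise convergence for $\|x\|_{2,\varphi}=\varphi(x^*x)^{1/2}$). For a von Neumann algebra $A$, $A_1$ is its operator-norm unit ball; ucp means unital completely positive. Amenable (semidiscrete): $A$ is amenable if for every $\eta\in A_*$, $\varepsilon>0$ and $x_1,\dots,x_k\in A_1$ there are $n\ge 1$ and normal ucp maps $\Phi:A\to M_n(\mathbb{C})$, $\Psi:M_n(\mathbb{C})\to A$ with $|\eta(\Psi\circ\Phi(x_j)-x_j)|<\varepsilon$ for all $j$. Haagerup property: $N\in\mathcal{E}_\varphi$ (equipped with $\varphi|_N$) has the Haagerup property if for all $\varepsilon>0$ and $x_1,\dots,x_k\in N_1$ there is a normal ucp map $\Phi:N\to N$ such that $\varphi\circ\Phi\le\varphi$, the bounded operator $\widehat\Phi$ on $\mathrm{L}^2(N,\varphi)$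 defined by $\widehat\Phi(x\Omega_\varphi)=\Phi(x)\Omega_\varphi$ ($\Omega_\varphi$ the GNS cyclic vector) is compact, and $\|\Phi(x_j)-x_j\|_{2,\varphi}<\varepsilon$ for all $j$. Cowling–Haagerup constant: for a linear map $\Phi:A\to A$ let $\|\Phi\|_{cb}=\sup_n\|\mathrm{id}_{M_n(\mathbb{C})}\otimes\Phi\|$. Given a faithful normal state $\varphi$ on $A$, $\Lambda_{cb}(A)\in[0,+\infty]$ is the infimum of all $C>0$ such that for all $k\ge1$, $x_1,\dots,x_k\in A_1$ and $\varepsilon>0$ there is a $\sigma$-weakly continuous finite rank linear map $\Phi:A\to A$ with $\|\Phi(x_j)-x_j\|_{2,\varphi}<\varepsilon$ for all $j$ and $\|\Phi\|_{cb}\le C$ (with $\inf\emptyset=+\infty$); it does not depend on the choice of $\varphi$. *)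

theory Defs
  imports "HOL-Analysis.Analysis" "HOL-Library.Nonpos_Ints" "Jordan_Normal_Form.Matrix"
begin

section \<open>Complex Hilbert spaces and their bounded operators\<close>

text \<open>The inner product is conjugate-linear in the first and linear in the second argument.\<close>

class complex_hilbert = banach +
  fixes scaleC :: "complex \<Rightarrow> 'a \<Rightarrow> 'a"  (infixr "*\<^sub>C" 75)
    and cinner :: "'a \<Rightarrow> 'a \<Rightarrow> complex"
  assumes scaleC_add_right: "c *\<^sub>C (x + y) = c *\<^sub>C x + c *\<^sub>C y"
    and scaleC_add_left: "(b + c) *\<^sub>C x = b *\<^sub>C x + c *\<^sub>C x"
    and scaleC_scaleC: "b *\<^sub>C (c *\<^sub>C x) = (b * c) *\<^sub>C x"
    and scaleR_scaleC: "r *\<^sub>R x = of_real r *\<^sub>C x"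
    and cinner_commute: "cinner x y = cnj (cinner y x)"
    and cinner_add_right: "cinner x (y + z) = cinner x y + cinner x z"
    and cinner_scaleC_right: "cinner x (c *\<^sub>C y) = c * cinner x y"
    and cinner_self: "cinner x x = of_real ((norm x)\<^sup>2)"

text \<open>
  The type \<open>'h \<Rightarrow>\<^sub>L 'h\<close> consists of the bounded \<^emph>\<open>real\<close>-linear operators, with the operator norm;
  \<open>bops\<close> is the algebra of bounded complex-linear operators.
\<close>

type_synonym 'h op = "'h \<Rightarrow>\<^sub>L 'h"

definition bops :: "'h::complex_hilbert op set" where
  "bops = {x. \<forall>c \<xi>. blinfun_apply x (c *\<^sub>C \<xi>) = c *\<^sub>C blinfun_apply x \<xi>}"

definition op_scale :: "complex \<Rightarrow> 'h::complex_hilbert op \<Rightarrow> 'h op" where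
  "op_scale c x = Blinfun (\<lambda>\<xi>. c *\<^sub>C blinfun_apply x \<xi>)"

definition adj :: "'h::complex_hilbert op \<Rightarrow> 'h op" where
  "adj x = (THE y. \<forall>\<xi> \<eta>. cinner (blinfun_apply y \<xi>) \<eta> = cinner \<xi> (blinfun_apply x \<eta>))"

definition positive_op :: "'h::complex_hilbert op \<Rightarrow> bool" where
  "positive_op x \<longleftrightarrow> (\<forall>\<xi>. cinner \<xi> (blinfun_apply x \<xi>) \<in> \<real>\<^sub>\<ge>\<^sub>0)"

definition commutant :: "'h::complex_hilbert op set \<Rightarrow> 'h op set" where
  "commutant S = {x \<in> bops. \<forall>y\<in>S. x o\<^sub>L y = y o\<^sub>L x}"

text \<open>Being a bicommutant makes \<open>M\<close> a unital complex algebra, with the unit of \<open>bops\<close>.\<close>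

definition von_neumann_algebra :: "'h::complex_hilbert op set \<Rightarrow> bool" where
  "von_neumann_algebra M \<longleftrightarrow>
     M \<subseteq> bops \<and> (\<forall>x\<in>M. adj x \<in> M) \<and> commutant (commutant M) = M"

text \<open>
  The elements of the predual are the functionals \<open>x \<mapsto> \<Sum>n. \<langle>\<xi>\<^sub>n, x \<eta>\<^sub>n\<rangle>\<close> with square-summable
  \<open>(\<xi>\<^sub>n)\<close> and \<open>(\<eta>\<^sub>n)\<close>. They are represented by functions on the whole type, of which only the values
  on \<open>A\<close> matter.
\<close>

definition op_predual :: "'h::complex_hilbert op set \<Rightarrow> ('h op \<Rightarrow> complex) set" where
  "op_predual A = {f. \<exists>\<xi> \<eta> :: nat \<Rightarrow> 'h.
     summable (\<lambda>n. (norm (\<xi> n))\<^sup>2) \<and> summable (\<lambda>n. (norm (\<eta> n))\<^sup>2) \<and>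
     (\<forall>x\<in>A. f x = (\<Sum>n. cinner (\<xi> n) (blinfun_apply x (\<eta> n))))}"

definition separable_predual :: "'h::complex_hilbert op set \<Rightarrow> bool" where
  "separable_predual M \<longleftrightarrow>
     (\<exists>D. countable D \<and> D \<subseteq> op_predual M \<and>
        (\<forall>f\<in>op_predual M. \<forall>e>0. \<exists>g\<in>D. \<forall>x\<in>M. norm x \<le> 1 \<longrightarrow> cmod (f x - g x) \<le> e))"

definition faithful_normal_state :: "'h::complex_hilbert op set \<Rightarrow> ('h op \<Rightarrow> complex) \<Rightarrow> bool" where
  "faithful_normal_state M \<phi> \<longleftrightarrow>
     \<phi> \<in> op_predual M \<and> \<phi> id_blinfun = 1 \<and>
     (\<forall>x\<in>M. \<phi> (adj x o\<^sub>L x) \<in> \<real>\<^sub>\<ge>\<^sub>0) \<and>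
     (\<forall>x\<in>M. \<phi> (adj x o\<^sub>L x) = 0 \<longrightarrow> x = 0)"

definition norm2 :: "('h::complex_hilbert op \<Rightarrow> complex) \<Rightarrow> 'h op \<Rightarrow> real" where
  "norm2 \<phi> x = sqrt (Re (\<phi> (adj x o\<^sub>L x)))"


section \<open>Completely positive and \<open>\<sigma>\<close>-weakly continuous maps\<close>

text \<open>
  The data needed to speak of unital completely positive and \<open>\<sigma>\<close>-weakly continuous maps, common to
  von Neumann algebras on a Hilbert space and to \<open>M\<^sub>n(\<complex>)\<close>. The set \<open>oa_pos k\<close> consists of the positive
  \<open>k \<times> k\<close> matrices with entries in the algebra; an entry \<open>a i j\<close> is relevant only for \<open>i, j < k\<close>.
\<close>

record 'a op_alg =
  oa_carrier :: "'a set"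
  oa_scale :: "complex \<Rightarrow> 'a \<Rightarrow> 'a"
  oa_one :: 'a
  oa_pos :: "nat \<Rightarrow> (nat \<Rightarrow> nat \<Rightarrow> 'a) set"
  oa_predual :: "('a \<Rightarrow> complex) set"

definition vn :: "'h::complex_hilbert op set \<Rightarrow> 'h op op_alg" where
  "vn A = \<lparr> oa_carrier = A, oa_scale = op_scale, oa_one = id_blinfun,
     oa_pos = (\<lambda>k. {a. (\<forall>i<k. \<forall>j<k. a i j \<in> A) \<and>
       (\<forall>\<xi>. (\<Sum>i<k. \<Sum>j<k. cinner (\<xi> i) (blinfun_apply (a i j) (\<xi> j))) \<in> \<real>\<^sub>\<ge>\<^sub>0)}),
     oa_predual = op_predual A \<rparr>"

definition matrix_alg :: "nat \<Rightarrow> complex mat op_alg" where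
  "matrix_alg n = \<lparr> oa_carrier = carrier_mat n n, oa_scale = smult_mat, oa_one = 1\<^sub>m n,
     oa_pos = (\<lambda>k. {a. (\<forall>i<k. \<forall>j<k. a i j \<in> carrier_mat n n) \<and>
       (\<forall>\<xi>. (\<forall>i<k. \<xi> i \<in> carrier_vec n) \<longrightarrow>
          (\<Sum>i<k. \<Sum>j<k. (a i j *\<^sub>v \<xi> j) \<bullet>c \<xi> i) \<in> \<real>\<^sub>\<ge>\<^sub>0)}),
     oa_predual = {f. \<forall>x\<in>carrier_mat n n. \<forall>y\<in>carrier_mat n n. \<forall>c.
       f (x + y) = f x + f y \<and> f (c \<cdot>\<^sub>m x) = c * f x} \<rparr>"

definition linear_map :: "'a::plus op_alg \<Rightarrow> 'b::plus op_alg \<Rightarrow> ('a \<Rightarrow> 'b) \<Rightarrow> bool" where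
  "linear_map A B \<Phi> \<longleftrightarrow>
     \<Phi> \<in> oa_carrier A \<rightarrow> oa_carrier B \<and>
     (\<forall>x\<in>oa_carrier A. \<forall>y\<in>oa_carrier A. \<Phi> (x + y) = \<Phi> x + \<Phi> y) \<and>
     (\<forall>x\<in>oa_carrier A. \<forall>c. \<Phi> (oa_scale A c x) = oa_scale B c (\<Phi> x))"

definition ucp :: "'a::plus op_alg \<Rightarrow> 'b::plus op_alg \<Rightarrow> ('a \<Rightarrow> 'b) \<Rightarrow> bool" where
  "ucp A B \<Phi> \<longleftrightarrow>
     linear_map A B \<Phi> \<and> \<Phi> (oa_one A) = oa_one B \<and>
     (\<forall>k. \<forall>a\<in>oa_pos A k. (\<lambda>i j. \<Phi> (a i j)) \<in> oa_pos B k)"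

definition sigma_weak_topology :: "'a op_alg \<Rightarrow> 'a topology" where
  "sigma_weak_topology A =
     pullback_topology (oa_carrier A) (\<lambda>x. \<lambda>f\<in>oa_predual A. f x)
       (product_topology (\<lambda>_. euclidean) (oa_predual A))"

text \<open>A linear map is normal iff it is \<open>\<sigma>\<close>-weakly continuous.\<close>

definition sigma_weakly_continuous :: "'a op_alg \<Rightarrow> 'b op_alg \<Rightarrow> ('a \<Rightarrow> 'b) \<Rightarrow> bool" where
  "sigma_weakly_continuous A B \<Phi> \<longleftrightarrow>
     continuous_map (sigma_weak_topology A) (sigma_weak_topology B) \<Phi>"

definition normal_ucp :: "'a::plus op_alg \<Rightarrow> 'b::plus op_alg \<Rightarrow> ('a \<Rightarrow> 'b) \<Rightarrow> bool" where
  "normal_ucp A B \<Phi> \<longleftrightarrow> ucp A B \<Phi> \<and> sigma_weakly_continuous A B \<Phi>"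


section \<open>Subalgebras with state-preserving expectation\<close>

text \<open>Normality is not required: it follows from preservation of a faithful normal state.\<close>

definition conditional_expectation ::
    "'h::complex_hilbert op set \<Rightarrow> 'h op set \<Rightarrow> ('h op \<Rightarrow> 'h op) \<Rightarrow> bool" where
  "conditional_expectation M N E \<longleftrightarrow>
     ucp (vn M) (vn N) E \<and> (\<forall>x\<in>N. E x = x) \<and>
     (\<forall>a\<in>N. \<forall>b\<in>N. \<forall>x\<in>M. E (a o\<^sub>L x o\<^sub>L b) = a o\<^sub>L E x o\<^sub>L b)"

definition preserving_expectation ::
    "'h::complex_hilbert op set \<Rightarrow> ('h op \<Rightarrow> complex) \<Rightarrow> 'h op set \<Rightarrow> ('h op \<Rightarrow> 'h op) \<Rightarrow> bool" where
  "preserving_expectation M \<phi> N E \<longleftrightarrow>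
     conditional_expectation M N E \<and> (\<forall>x\<in>M. \<phi> (E x) = \<phi> x)"

definition expected_subalgebras ::
    "'h::complex_hilbert op set \<Rightarrow> ('h op \<Rightarrow> complex) \<Rightarrow> 'h op set set" where
  "expected_subalgebras M \<phi> =
     {N. von_neumann_algebra N \<and> N \<subseteq> M \<and> (\<exists>E. preserving_expectation M \<phi> N E)}"

definition cond_exp ::
    "'h::complex_hilbert op set \<Rightarrow> ('h op \<Rightarrow> complex) \<Rightarrow> 'h op set \<Rightarrow> 'h op \<Rightarrow> 'h op" where
  "cond_exp M \<phi> N = (THE E. E \<in> extensional M \<and> preserving_expectation M \<phi> N E)"

text \<open>The coarsest topology making \<open>N \<mapsto> cond_exp M \<phi> N x\<close> strongly continuous for every \<open>x \<in> M\<close>.\<close>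

definition expectation_topology ::
    "'h::complex_hilbert op set \<Rightarrow> ('h op \<Rightarrow> complex) \<Rightarrow> 'h op set topology" where
  "expectation_topology M \<phi> =
     pullback_topology (expected_subalgebras M \<phi>) (\<lambda>N. \<lambda>x\<in>M. cond_exp M \<phi> N x)
       (product_topology (\<lambda>_. strong_operator_topology) M)"


section \<open>Amenability\<close>

definition amenable :: "'h::complex_hilbert op set \<Rightarrow> bool" where
  "amenable A \<longleftrightarrow>
     (\<forall>\<eta>\<in>op_predual A. \<forall>e>0. \<forall>X. finite X \<and> X \<subseteq> A \<inter> cball 0 1 \<longrightarrow>
        (\<exists>n\<ge>1. \<exists>\<Phi> \<Psi>. normal_ucp (vn A) (matrix_alg n) \<Phi> \<and>
           normal_ucp (matrix_alg n) (vn A) \<Psi> \<and>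
           (\<forall>x\<in>X. cmod (\<eta> (\<Psi> (\<Phi> x) - x)) < e)))"


section \<open>The GNS space and the Haagerup property\<close>

text \<open>
  \<open>L2 N \<phi>\<close> is the completion of \<open>N\<close> with respect to \<open>norm2 \<phi>\<close>, constructed by Cauchy sequences;
  \<open>gns_vec N \<phi> x\<close> is the vector \<open>x\<Omega>\<^sub>\<phi>\<close>.
\<close>

definition gns_cauchy ::
    "'h::complex_hilbert op set \<Rightarrow> ('h op \<Rightarrow> complex) \<Rightarrow> (nat \<Rightarrow> 'h op) set" where
  "gns_cauchy N \<phi> = {s. range s \<subseteq> N \<and>
     (\<forall>e>0. \<exists>K. \<forall>m\<ge>K. \<forall>n\<ge>K. norm2 \<phi> (s m - s n) < e)}"

definition gns_rel ::
    "'h::complex_hilbert op set \<Rightarrow> ('h op \<Rightarrow> complex) \<Rightarrow> ((nat \<Rightarrow> 'h op) \<times> (nat \<Rightarrow> 'h op)) set" where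
  "gns_rel N \<phi> = {(s, t). s \<in> gns_cauchy N \<phi> \<and> t \<in> gns_cauchy N \<phi> \<and>
     (\<lambda>n. norm2 \<phi> (s n - t n)) \<longlonglongrightarrow> 0}"

definition L2 ::
    "'h::complex_hilbert op set \<Rightarrow> ('h op \<Rightarrow> complex) \<Rightarrow> (nat \<Rightarrow> 'h op) set set" where
  "L2 N \<phi> = gns_cauchy N \<phi> // gns_rel N \<phi>"

definition gns_vec ::
    "'h::complex_hilbert op set \<Rightarrow> ('h op \<Rightarrow> complex) \<Rightarrow> 'h op \<Rightarrow> (nat \<Rightarrow> 'h op) set" where
  "gns_vec N \<phi> x = gns_rel N \<phi> `` {\<lambda>_. x}"

text \<open>The value outside \<open>L2 N \<phi>\<close> is set to \<open>0\<close> because \<open>Metric_space\<close> constrains it.\<close>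

definition L2_dist ::
    "'h::complex_hilbert op set \<Rightarrow> ('h op \<Rightarrow> complex) \<Rightarrow>
     (nat \<Rightarrow> 'h op) set \<Rightarrow> (nat \<Rightarrow> 'h op) set \<Rightarrow> real" where
  "L2_dist N \<phi> a b =
     (if a \<in> L2 N \<phi> \<and> b \<in> L2 N \<phi>
      then THE d. \<exists>s\<in>a. \<exists>t\<in>b. (\<lambda>n. norm2 \<phi> (s n - t n)) \<longlonglongrightarrow> d else 0)"

definition L2_topology ::
    "'h::complex_hilbert op set \<Rightarrow> ('h op \<Rightarrow> complex) \<Rightarrow> (nat \<Rightarrow> 'h op) set topology" where
  "L2_topology N \<phi> = Metric_space.mtopology (L2 N \<phi>) (L2_dist N \<phi>)"

text \<open>
  Since the vectors \<open>x\<Omega>\<^sub>\<phi>\<close> are dense, \<open>T\<close> is the unique bounded operator with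
  \<open>T (x\<Omega>\<^sub>\<phi>) = \<Phi>(x)\<Omega>\<^sub>\<phi>\<close>, its linearity being inherited from \<open>\<Phi>\<close>.
\<close>

definition gns_extension ::
    "'h::complex_hilbert op set \<Rightarrow> ('h op \<Rightarrow> complex) \<Rightarrow> ('h op \<Rightarrow> 'h op) \<Rightarrow>
     ((nat \<Rightarrow> 'h op) set \<Rightarrow> (nat \<Rightarrow> 'h op) set) \<Rightarrow> bool" where
  "gns_extension N \<phi> \<Phi> T \<longleftrightarrow>
     continuous_map (L2_topology N \<phi>) (L2_topology N \<phi>) T \<and>
     (\<forall>x\<in>N. T (gns_vec N \<phi> x) = gns_vec N \<phi> (\<Phi> x))"

definition L2_compact ::
    "'h::complex_hilbert op set \<Rightarrow> ('h op \<Rightarrow> complex) \<Rightarrow>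
     ((nat \<Rightarrow> 'h op) set \<Rightarrow> (nat \<Rightarrow> 'h op) set) \<Rightarrow> bool" where
  "L2_compact N \<phi> T \<longleftrightarrow>
     compactin (L2_topology N \<phi>)
       (L2_topology N \<phi> closure_of (T ` {a \<in> L2 N \<phi>. L2_dist N \<phi> a (gns_vec N \<phi> 0) \<le> 1}))"

definition haagerup_property ::
    "'h::complex_hilbert op set \<Rightarrow> ('h op \<Rightarrow> complex) \<Rightarrow> bool" where
  "haagerup_property N \<phi> \<longleftrightarrow>
     (\<forall>e>0. \<forall>X. finite X \<and> X \<subseteq> N \<inter> cball 0 1 \<longrightarrow>
        (\<exists>\<Phi>. normal_ucp (vn N) (vn N) \<Phi> \<and>
           (\<forall>x\<in>N. positive_op x \<longrightarrow> \<phi> x - \<phi> (\<Phi> x) \<in> \<real>\<^sub>\<ge>\<^sub>0) \<and>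
           (\<exists>T. gns_extension N \<phi> \<Phi> T \<and> L2_compact N \<phi> T) \<and>
           (\<forall>x\<in>X. norm2 \<phi> (\<Phi> x - x) < e)))"


section \<open>The Cowling--Haagerup constant\<close>

text \<open>The operator norm of the \<open>n \<times> n\<close> matrix \<open>a\<close> acting on the \<open>n\<close>-fold Hilbert sum of \<open>'h\<close>.\<close>

definition op_matrix_norm :: "nat \<Rightarrow> (nat \<Rightarrow> nat \<Rightarrow> 'h::complex_hilbert op) \<Rightarrow> real" where
  "op_matrix_norm n a =
     Sup {sqrt (\<Sum>i<n. (norm (\<Sum>j<n. blinfun_apply (a i j) (\<xi> j)))\<^sup>2) | \<xi>.
            (\<Sum>j<n. (norm (\<xi> j))\<^sup>2) \<le> 1}"

definition cb_norm :: "'h::complex_hilbert op set \<Rightarrow> ('h op \<Rightarrow> 'h op) \<Rightarrow> ennreal" where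
  "cb_norm A \<Phi> =
     (SUP n\<in>{1..}. SUP a\<in>{a. (\<forall>i<n. \<forall>j<n. a i j \<in> A) \<and> op_matrix_norm n a \<le> 1}.
        ennreal (op_matrix_norm n (\<lambda>i j. \<Phi> (a i j))))"

definition finite_rank :: "'h::complex_hilbert op set \<Rightarrow> ('h op \<Rightarrow> 'h op) \<Rightarrow> bool" where
  "finite_rank A \<Phi> \<longleftrightarrow> (\<exists>B. finite B \<and> (\<forall>x\<in>A. \<exists>c. \<Phi> x = (\<Sum>b\<in>B. op_scale (c b) b)))"

text \<open>
  The value does not depend on the faithful normal state \<open>\<phi>\<close>. The infimum of the empty set is
  \<open>\<infinity>\<close> in \<open>ennreal\<close>.
\<close>

definition Lambda_cb ::
    "'h::complex_hilbert op set \<Rightarrow> ('h op \<Rightarrow> complex) \<Rightarrow> ennreal" where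
  "Lambda_cb A \<phi> = Inf {ennreal C | C. C > 0 \<and>
     (\<forall>e>0. \<forall>X. finite X \<and> X \<noteq> {} \<and> X \<subseteq> A \<inter> cball 0 1 \<longrightarrow>
        (\<exists>\<Phi>. linear_map (vn A) (vn A) \<Phi> \<and> sigma_weakly_continuous (vn A) (vn A) \<Phi> \<and>
           finite_rank A \<Phi> \<and> (\<forall>x\<in>X. norm2 \<phi> (\<Phi> x - x) < e) \<and>
           cb_norm A \<Phi> \<le> ennreal C))}"

end

theory Submission
  imports Defs
begin

text \<open>
  Let \<open>N\<close> be a limit of subalgebras \<open>N'\<close> that have one of the three properties, and let \<open>E\<close> and \<open>F\<close>
  be the state-preserving expectations of \<open>M\<close> onto \<open>N\<close> and \<open>N'\<close>. If \<open>\<Phi>\<close> is an approximation of the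
  identity on \<open>N'\<close>, then \<open>E \<circ> \<Phi> \<circ> F\<close>, restricted to \<open>N\<close>, is one on \<open>N\<close>: for \<open>N'\<close> close to \<open>N\<close> the
  finitely many given \<open>x \<in> N\<close> are hardly moved by \<open>F\<close>, so that \<open>\<Phi> (F x)\<close> is close to \<open>F x\<close>, which is close
  to \<open>x\<close>; and \<open>E\<close> fixes \<open>x\<close> and contracts the two-norm. Amenability is treated in the same way with
  \<open>\<Psi> \<circ> \<Phi>\<close> in place of \<open>\<Phi>\<close> and the functional \<open>\<eta> \<circ> E\<close> on \<open>N'\<close>. The property is inherited because \<open>E\<close> and
  \<open>F\<close> are normal, unital completely positive, completely contractive, preserve \<open>\<phi>\<close> and induce
  contractions of the GNS spaces, so that composing with them preserves normality, compactness and
  finite rank and does not increase the completely bounded norm.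

  The substance is therefore in the properties of the expectations, above all in their normality
  (\<open>expectation_normal\<close>). It is proved on the sum \<open>K\<close> of countably many copies of the Hilbert space,
  where \<open>M\<close> acts diagonally and where the predual consists of the functionals \<open>\<langle>\<xi>, x \<eta>\<rangle>\<close> with
  \<open>\<xi>, \<eta> \<in> K\<close>. There \<open>\<phi>\<close> is dominated by a vector functional \<open>\<langle>\<zeta>, x \<zeta>\<rangle>\<close>, and the
  Radon-Nikodym theorem yields a vector \<open>\<Omega>\<close> that is separating for \<open>M\<close>, with \<open>\<langle>\<Omega>, x \<Omega>\<rangle>\<close> dominated
  by \<open>\<phi>\<close>. By the bicommutant property, the vectors \<open>a \<Omega>\<close> with \<open>a\<close> in the commutant are dense. For such a
  vector \<open>u\<close> the functional \<open>\<langle>u, E x u\<rangle>\<close> is at most a multiple of \<open>\<phi> (E x) = \<phi> x\<close>, hence of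
  \<open>\<langle>\<zeta>, x \<zeta>\<rangle>\<close>, so by Radon-Nikodym again it is \<open>\<langle>\<psi>, x \<psi>\<rangle>\<close> for a vector \<open>\<psi>\<close> with the norm of \<open>u\<close>.
  This control of the norm allows the passage to arbitrary vectors \<open>u\<close>.

  Complete contractivity follows from positivity of the block matrix with diagonal entries \<open>c\<close> and
  off-diagonal entries \<open>a\<close> and its adjoint, for a matrix \<open>a\<close> of norm at most \<open>c\<close>
  (\<open>ucp_matrix_bounded\<close>). Contractivity in the two-norm follows from the Cauchy-Schwarz inequality
  and the module property of \<open>E\<close>.

  Positive operators are expanded into sums of squares of elements of the algebra at hand
  (\<open>positive_op_limit_of_squares\<close>). This serves to compare functionals on positive elements when the
  comparison is known on squares, and to write \<open>\<langle>\<zeta>, h (x \<zeta>)\<rangle>\<close>, with \<open>h \<ge> 0\<close> in the commutant of \<open>M\<close>, as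
  a sum of functionals \<open>\<langle>\<psi>, x \<psi>\<rangle>\<close>.
\<close>

notation blinfun_apply (infixr "\<cdot>" 75)

section \<open>Inner products\<close>

text \<open>
  The common source of the Cauchy-Schwarz inequalities below: the value of a positive form at
  \<open>x + c y\<close> is such a quadratic expression in \<open>c\<close>. Being real at \<open>c = 1\<close> and at \<open>c = \<i>\<close> forces the mixed
  coefficients to be conjugate, and the minimum over \<open>c\<close> gives the bound.
\<close>

lemma complex_quadratic_nonneg:
  fixes a b b' d :: complex
  assumes "\<And>c. a + c * b + cnj c * b' + cnj c * c * d \<in> \<real>\<^sub>\<ge>\<^sub>0" and d: "d \<in> \<real>\<^sub>\<ge>\<^sub>0"
  shows "b' = cnj b" and "(cmod b)\<^sup>2 \<le> Re a * Re d"
proof -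
  have *: "0 \<le> Re (a + c * b + cnj c * b' + cnj c * c * d)"
    "Im (a + c * b + cnj c * b' + cnj c * c * d) = 0" for c
    using assms(1)[of c] by (auto simp: complex_nonneg_Reals_iff)
  have d': "Im d = 0" "Re d \<ge> 0" using d by (auto simp: complex_nonneg_Reals_iff)
  have a: "Im a = 0" "Re a \<ge> 0" using *[of 0] by auto
  show b': "b' = cnj b"
    using *(2)[of 1] *(2)[of \<i>] a d' by (auto simp: complex_eq_iff)
  have q: "0 \<le> Re a - 2 * t * (cmod b)\<^sup>2 + t\<^sup>2 * (cmod b)\<^sup>2 * Re d" for t :: real
  proof -
    have "Re (a + (- of_real t * cnj b) * b + cnj (- of_real t * cnj b) * b'
        + cnj (- of_real t * cnj b) * (- of_real t * cnj b) * d)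
      = Re a - 2 * t * (cmod b)\<^sup>2 + t\<^sup>2 * (cmod b)\<^sup>2 * Re d"
      unfolding b' cmod_power2 using d' by (simp add: power2_eq_square algebra_simps)
    with *(1)[of "- of_real t * cnj b"] show ?thesis by simp
  qed
  show "(cmod b)\<^sup>2 \<le> Re a * Re d"
  proof (cases "Re d = 0")
    case True
    have "(cmod b)\<^sup>2 = 0"
    proof (rule ccontr)
      assume "(cmod b)\<^sup>2 \<noteq> 0"
      then show False using q[of "(Re a + 1) / (2 * (cmod b)\<^sup>2)"] True a by (simp add: field_simps)
    qed
    then show ?thesis using True by simp
  next
    case False
    then have "Re d > 0" using d' by simp
    then show ?thesis using q[of "1 / Re d"] by (simp add: field_simps power2_eq_square)
  qed
qed

context
  fixes x y z :: "'a::complex_hilbert"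
begin

lemma cinner_add_left: "cinner (x + y) z = cinner x z + cinner y z"
  by (metis cinner_add_right cinner_commute complex_cnj_add)

lemma cinner_scaleC_left: "cinner (c *\<^sub>C x) z = cnj c * cinner x z"
  by (metis cinner_scaleC_right cinner_commute complex_cnj_mult)

lemma cinner_zero_right [simp]: "cinner x 0 = 0"
  using cinner_add_right[of x 0 0] by simp

lemma cinner_zero_left [simp]: "cinner 0 x = 0"
  using cinner_add_left by (metis cinner_commute cinner_zero_right complex_cnj_zero)

lemma cinner_scaleR_right: "cinner x (r *\<^sub>R z) = of_real r * cinner x z"
  by (simp add: scaleR_scaleC cinner_scaleC_right)

lemma cinner_scaleR_left: "cinner (r *\<^sub>R x) z = of_real r * cinner x z"
  by (simp add: scaleR_scaleC cinner_scaleC_left)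

end

lemma cinner_minus_right [simp]: "cinner x (- y) = - cinner x (y::'a::complex_hilbert)"
  using cinner_scaleR_right[of x "-1" y] by simp

lemma cinner_minus_left [simp]: "cinner (- x) y = - cinner x (y::'a::complex_hilbert)"
  using cinner_scaleR_left[of "-1" x y] by simp

lemma cinner_diff_right: "cinner x (y - z) = cinner x y - cinner x (z::'a::complex_hilbert)"
  using cinner_add_right[of x y "-z"] by simp

lemma cinner_diff_left: "cinner (x - y) z = cinner x z - cinner y (z::'a::complex_hilbert)"
  using cinner_add_left[of x "-y" z] by simp

lemmas cinner_linear = cinner_add_left cinner_add_right cinner_diff_left cinner_diff_right
  cinner_scaleC_left cinner_scaleC_right

lemma scaleC_one [simp]: "1 *\<^sub>C x = (x::'a::complex_hilbert)"
  using scaleR_scaleC[of 1 x] by simp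

lemma scaleC_minus_one: "(-1) *\<^sub>C x = - (x::'a::complex_hilbert)"
  using scaleR_scaleC[of "-1" x] by simp

lemma scaleC_zero_right [simp]: "c *\<^sub>C 0 = (0::'a::complex_hilbert)"
  using scaleC_add_right[of c 0 0] by simp

lemma scaleC_minus_right: "c *\<^sub>C (- x) = - (c *\<^sub>C (x::'a::complex_hilbert))"
  using scaleC_add_right[of c x "- x"] by (simp add: add_eq_0_iff)

lemma scaleC_diff_right: "c *\<^sub>C (x - y) = c *\<^sub>C x - c *\<^sub>C (y::'a::complex_hilbert)"
  using scaleC_add_right[of c x "- y"] by (simp add: scaleC_minus_right)

lemma norm_sq_cinner: "(norm (x::'a::complex_hilbert))\<^sup>2 = Re (cinner x x)"
  by (simp add: cinner_self)

lemma cinner_self_nonneg [simp]: "cinner x x \<in> \<real>\<^sub>\<ge>\<^sub>0"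
  by (simp add: cinner_self complex_nonneg_Reals_iff)

lemma norm_scaleC: "norm (c *\<^sub>C x) = cmod c * norm (x::'a::complex_hilbert)"
proof -
  have "complex_of_real ((norm (c *\<^sub>C x))\<^sup>2) = (cnj c * c) * of_real ((norm x)\<^sup>2)"
    by (simp only: cinner_self[symmetric] cinner_scaleC_left cinner_scaleC_right mult.assoc
        mult.left_commute)
  also have "\<dots> = of_real ((cmod c * norm x)\<^sup>2)"
    by (simp only: power_mult_distrib complex_norm_square mult.commute of_real_mult)
  finally have "(norm (c *\<^sub>C x))\<^sup>2 = (cmod c * norm x)\<^sup>2"
    by (simp only: of_real_eq_iff)
  then show ?thesis by (simp add: power2_eq_iff_nonneg)
qed

lemma Cauchy_Schwarz_cinner: "cmod (cinner x y) \<le> norm x * norm (y::'a::complex_hilbert)"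
proof -
  have "(cmod (cinner x y))\<^sup>2 \<le> Re (cinner x x) * Re (cinner y y)"
  proof (rule complex_quadratic_nonneg)
    fix c
    have "cinner x x + c * cinner x y + cnj c * cinner y x + cnj c * c * cinner y y
        = cinner (x + c *\<^sub>C y) (x + c *\<^sub>C y)"
      by (simp add: cinner_linear algebra_simps)
    then show "cinner x x + c * cinner x y + cnj c * cinner y x + cnj c * c * cinner y y \<in> \<real>\<^sub>\<ge>\<^sub>0"
      by simp
  qed simp
  then have "(cmod (cinner x y))\<^sup>2 \<le> (norm x * norm y)\<^sup>2"
    by (simp add: norm_sq_cinner[symmetric] power_mult_distrib)
  then show ?thesis by (rule power2_le_imp_le) simp
qed

lemma Cauchy_Schwarz_blinfun:
  "cmod (cinner u (x \<cdot> v)) \<le> norm x * norm u * norm (v::'a::complex_hilbert)"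
proof -
  have "cmod (cinner u (x \<cdot> v)) \<le> norm u * norm (x \<cdot> v)"
    by (rule Cauchy_Schwarz_cinner)
  also have "\<dots> \<le> norm u * (norm x * norm v)"
    by (intro mult_left_mono norm_blinfun) auto
  finally show ?thesis by (simp add: mult_ac)
qed

lemma bounded_bilinear_cinner:
  "bounded_bilinear (cinner :: 'a::complex_hilbert \<Rightarrow> 'a \<Rightarrow> complex)"
  by (rule bounded_bilinear.intro)
    (auto simp: cinner_linear cinner_scaleR_left cinner_scaleR_right scaleR_conv_of_real
      intro!: exI[of _ 1] Cauchy_Schwarz_cinner)

lemmas tendsto_cinner = bounded_bilinear.tendsto[OF bounded_bilinear_cinner]
lemmas cinner_sum_right = bounded_bilinear.sum_right[OF bounded_bilinear_cinner]

lemma cinner_eqI: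
  assumes "\<And>z. cinner x z = cinner y (z::'a::complex_hilbert)" shows "x = y"
proof -
  have "cinner (x - y) (x - y) = 0" using assms by (simp add: cinner_diff_left)
  then show ?thesis by (simp add: cinner_self)
qed

lemma parallelogram_law:
  "(norm (x + y))\<^sup>2 + (norm (x - y))\<^sup>2 = 2 * (norm x)\<^sup>2 + 2 * (norm (y::'a::complex_hilbert))\<^sup>2"
  by (simp add: norm_sq_cinner cinner_linear)

lemma norm_add_sq:
  "(norm (x + y))\<^sup>2 = (norm x)\<^sup>2 + 2 * Re (cinner x y) + (norm (y::'a::complex_hilbert))\<^sup>2"
  using cinner_commute[of y x] by (simp add: norm_sq_cinner cinner_linear)

section \<open>Riesz representation and bounded forms\<close>

definition csubspace :: "'a::complex_hilbert set \<Rightarrow> bool" where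
  "csubspace W \<longleftrightarrow> 0 \<in> W \<and> (\<forall>x\<in>W. \<forall>y\<in>W. x + y \<in> W) \<and> (\<forall>c. \<forall>x\<in>W. c *\<^sub>C x \<in> W)"

lemma csubspaceD:
  assumes "csubspace W"
  shows "0 \<in> W" "x \<in> W \<Longrightarrow> y \<in> W \<Longrightarrow> x + y \<in> W" "x \<in> W \<Longrightarrow> c *\<^sub>C x \<in> W"
    "x \<in> W \<Longrightarrow> r *\<^sub>R x \<in> W" "x \<in> W \<Longrightarrow> y \<in> W \<Longrightarrow> x - y \<in> W"
proof -
  show *: "0 \<in> W" "x \<in> W \<Longrightarrow> y \<in> W \<Longrightarrow> x + y \<in> W" "x \<in> W \<Longrightarrow> c *\<^sub>C x \<in> W" for x y c
    using assms by (auto simp: csubspace_def)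
  show "x \<in> W \<Longrightarrow> r *\<^sub>R x \<in> W" by (simp add: * scaleR_scaleC)
  show "x - y \<in> W" if "x \<in> W" "y \<in> W"
    using *(2)[OF that(1) *(3)[OF that(2), of "-1"]] by (simp add: scaleC_minus_one)
qed

lemma bounded_linear_scaleC: "bounded_linear (\<lambda>x::'a::complex_hilbert. c *\<^sub>C x)"
  by (rule bounded_linear_intro[of _ "cmod c"])
    (auto simp: scaleC_add_right scaleR_scaleC scaleC_scaleC norm_scaleC mult.commute)

lemmas tendsto_scaleC = bounded_linear.tendsto[OF bounded_linear_scaleC]

lemma csubspace_closure:
  assumes "csubspace W" shows "csubspace (closure W)"
  unfolding csubspace_def
proof (intro conjI ballI allI)
  show "0 \<in> closure W" using csubspaceD(1)[OF assms] closure_subset by blast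
  fix x assume "x \<in> closure W"
  then obtain f where f: "\<And>n. f n \<in> W" "f \<longlonglongrightarrow> x" unfolding closure_sequential by blast
  show "c *\<^sub>C x \<in> closure W" for c
    unfolding closure_sequential
    using f csubspaceD(3)[OF assms] tendsto_scaleC[OF f(2)] by (intro exI[of _ "\<lambda>n. c *\<^sub>C f n"]) auto
  fix y assume "y \<in> closure W"
  then obtain g where g: "\<And>n. g n \<in> W" "g \<longlonglongrightarrow> y" unfolding closure_sequential by blast
  show "x + y \<in> closure W"
    unfolding closure_sequential
    using f g csubspaceD(2)[OF assms] tendsto_add[OF f(2) g(2)]
    by (intro exI[of _ "\<lambda>n. f n + g n"]) auto
qed

lemma cinner_zero_closure:
  assumes "\<And>w. w \<in> W \<Longrightarrow> cinner u w = 0" "v \<in> closure W" shows "cinner u v = 0"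
proof -
  obtain f where f: "\<And>n. f n \<in> W" "f \<longlonglongrightarrow> v" using assms(2) unfolding closure_sequential by blast
  have "(\<lambda>n. cinner u (f n)) \<longlonglongrightarrow> cinner u v" by (rule tendsto_cinner[OF tendsto_const f(2)])
  moreover have "(\<lambda>n. cinner u (f n)) = (\<lambda>n. 0)" using assms(1) f(1) by simp
  ultimately show ?thesis using LIMSEQ_unique by (metis tendsto_const)
qed

lemma closure_cinner_eqI:
  assumes "csubspace W" "v \<in> closure W" "v' \<in> closure W"
    and "\<And>w. w \<in> W \<Longrightarrow> cinner v w = cinner v' w"
  shows "v = v'"
proof -
  have "v - v' \<in> closure W" using csubspaceD(5)[OF csubspace_closure[OF assms(1)]] assms by blast
  then have "cinner (v - v') (v - v') = 0"
    by (rule cinner_zero_closure[rotated]) (simp add: cinner_diff_left assms)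
  then show ?thesis by (simp add: cinner_self)
qed

lemma closure_norm_leI:
  assumes "v \<in> closure W" "K \<ge> 0" "\<And>w. w \<in> W \<Longrightarrow> cmod (cinner v w) \<le> K * norm w"
  shows "norm v \<le> K"
proof -
  obtain f where f: "\<And>n. f n \<in> W" "f \<longlonglongrightarrow> v" using assms(1) unfolding closure_sequential by blast
  have "cmod (cinner v v) \<le> K * norm v"
    by (rule LIMSEQ_le[OF tendsto_norm[OF tendsto_cinner[OF tendsto_const f(2)]]
          tendsto_mult[OF tendsto_const tendsto_norm[OF f(2)]]])
      (use f assms in auto)
  then have "norm v * norm v \<le> K * norm v"
    unfolding cinner_self norm_of_real by (simp add: power2_eq_square)
  then show ?thesis
    using assms(2) by (cases "norm v = 0") auto
qed

text \<open>
  The representing vector is the limit of a minimising sequence of \<open>\<parallel>w\<parallel>\<^sup>2 - 2 Re (l w)\<close>, which is Cauchy by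
  the parallelogram law. The subspace \<open>W\<close> may fail to be closed; the limit then only lies in its closure.
  This saves all extensions by continuity in the constructions of operators below.
\<close>

lemma Riesz_subspace:
  assumes W: "csubspace W"
    and add: "\<And>x y. x \<in> W \<Longrightarrow> y \<in> W \<Longrightarrow> l (x + y) = l x + l y"
    and scale: "\<And>c x. x \<in> W \<Longrightarrow> l (c *\<^sub>C x) = c * l x"
    and bound: "\<And>x. x \<in> W \<Longrightarrow> cmod (l x) \<le> C * norm x"
  obtains v where "v \<in> closure W" "\<And>w. w \<in> W \<Longrightarrow> l w = cinner v w"
proof -
  define J where "J w = (norm w)\<^sup>2 - 2 * Re (l w)" for w
  have lower: "- C\<^sup>2 \<le> J w" if "w \<in> W" for w
  proof -
    have "Re (l w) \<le> C * norm w" using bound[OF that] complex_Re_le_cmod order_trans by blast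
    moreover have "0 \<le> (norm w - C)\<^sup>2" by simp
    ultimately show ?thesis unfolding J_def by (simp add: power2_eq_square algebra_simps)
  qed
  define m where "m = Inf (J ` W)"
  have bdd: "bdd_below (J ` W)" using lower by (auto intro!: bdd_belowI)
  have m: "m \<le> J w" if "w \<in> W" for w unfolding m_def using that bdd by (auto intro: cInf_lower)
  have "\<exists>w\<in>W. J w < m + 1 / real (Suc n)" for n
  proof -
    have "J ` W \<noteq> {}" using csubspaceD(1)[OF W] by auto
    moreover have "Inf (J ` W) < m + 1 / real (Suc n)" unfolding m_def by simp
    ultimately obtain z where "z \<in> J ` W" "z < m + 1 / real (Suc n)"
      by (rule cInf_lessD[THEN bexE])
    then show ?thesis by blast
  qed
  then obtain w where w: "\<And>n. w n \<in> W" "\<And>n. J (w n) < m + 1 / real (Suc n)" by metis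
  have dist: "(norm (w n - w k))\<^sup>2 \<le> 2 / real (Suc n) + 2 / real (Suc k)" for n k
  proof -
    have "m \<le> J ((1/2) *\<^sub>R (w n + w k))" by (intro m csubspaceD[OF W] w)
    also have "\<dots> = (norm (w n + w k))\<^sup>2 / 4 - Re (l (w n)) - Re (l (w k))"
    proof -
      have "l ((1/2) *\<^sub>R (w n + w k)) = (l (w n) + l (w k)) / 2"
        unfolding scaleR_scaleC by (subst scale) (auto simp: add w csubspaceD[OF W])
      then show ?thesis unfolding J_def by (simp add: power_divide add_divide_distrib)
    qed
    finally show ?thesis
      using parallelogram_law[of "w n" "w k"] w(2)[of n] w(2)[of k] by (simp add: J_def)
  qed
  have "Cauchy w"
  proof (rule metric_CauchyI)
    fix e :: real assume e: "e > 0"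
    obtain N where N: "4 / real (Suc N) < e\<^sup>2"
      using reals_Archimedean[of "e\<^sup>2 / 4"] e by (auto simp: field_simps)
    show "\<exists>M. \<forall>m\<ge>M. \<forall>n\<ge>M. dist (w m) (w n) < e"
    proof (intro exI allI impI)
      fix n k assume "N \<le> n" "N \<le> k"
      then have "2 / real (Suc n) \<le> 2 / real (Suc N)" "2 / real (Suc k) \<le> 2 / real (Suc N)"
        by (auto simp: field_simps)
      then have "(norm (w n - w k))\<^sup>2 < e\<^sup>2" using dist[of n k] N by auto
      then show "dist (w n) (w k) < e"
        using e by (auto simp: dist_norm intro: power2_less_imp_less)
    qed
  qed
  then obtain v where v: "w \<longlonglongrightarrow> v" using Cauchy_convergent_iff convergent_def by blast
  show thesis
  proof
    show "v \<in> closure W" unfolding closure_sequential using w v by blast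
    fix u assume u: "u \<in> W"
    define z where "z = cinner v u - l u"
    have "(cmod z)\<^sup>2 \<le> Re 0 * Re (of_real ((norm u)\<^sup>2))"
    proof (rule complex_quadratic_nonneg(2)[where b' = "cnj z"])
      fix c
      have ineq: "0 \<le> 2 * Re (cinner (w n) (c *\<^sub>C u) - l (c *\<^sub>C u)) + (norm (c *\<^sub>C u))\<^sup>2
          + 1 / real (Suc n)" for n
      proof -
        have "m \<le> J (w n + c *\<^sub>C u)" by (intro m csubspaceD[OF W] w u)
        also have "\<dots> = J (w n) + 2 * Re (cinner (w n) (c *\<^sub>C u) - l (c *\<^sub>C u)) + (norm (c *\<^sub>C u))\<^sup>2"
          unfolding J_def by (simp add: norm_add_sq add w csubspaceD[OF W] u)
        finally show ?thesis using w(2)[of n] by simp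
      qed
      have "0 \<le> 2 * Re (cinner v (c *\<^sub>C u) - l (c *\<^sub>C u)) + (norm (c *\<^sub>C u))\<^sup>2 + 0"
      proof (rule LIMSEQ_le_const)
        show "(\<lambda>n. 2 * Re (cinner (w n) (c *\<^sub>C u) - l (c *\<^sub>C u)) + (norm (c *\<^sub>C u))\<^sup>2
            + 1 / real (Suc n)) \<longlonglongrightarrow> 2 * Re (cinner v (c *\<^sub>C u) - l (c *\<^sub>C u)) + (norm (c *\<^sub>C u))\<^sup>2 + 0"
          by (intro tendsto_intros tendsto_cinner v LIMSEQ_Suc[OF lim_1_over_n])
      qed (use ineq in auto)
      also have "\<dots> = Re (0 + c * z + cnj c * cnj z + cnj c * c * of_real ((norm u)\<^sup>2))"
        unfolding z_def by (simp add: cinner_scaleC_right scale u norm_scaleC power_mult_distrib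
            cmod_power2 algebra_simps) (simp add: power2_eq_square algebra_simps)
      finally show "0 + c * z + cnj c * cnj z + cnj c * c * of_real ((norm u)\<^sup>2) \<in> \<real>\<^sub>\<ge>\<^sub>0"
        by (simp add: complex_nonneg_Reals_iff)
    qed (simp add: complex_nonneg_Reals_iff)
    then show "l u = cinner v u" unfolding z_def by simp
  qed
qed

lemma ex_bop:
  fixes f :: "'a::complex_hilbert \<Rightarrow> 'a"
  assumes "\<And>x y. f (x + y) = f x + f y" "\<And>c x. f (c *\<^sub>C x) = c *\<^sub>C f x"
    and "\<And>x. norm (f x) \<le> C * norm x"
  obtains h where "h \<in> bops" "blinfun_apply h = f"
proof -
  have "bounded_linear f"
    using assms by (intro bounded_linear_intro[of _ C]) (auto simp: scaleR_scaleC mult.commute)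
  then have "blinfun_apply (Blinfun f) = f" by (rule bounded_linear_Blinfun_apply)
  then show thesis using that[of "Blinfun f"] assms(2) by (simp add: bops_def)
qed

text \<open>
  The last conjunct makes \<open>h\<close> vanish on the orthogonal complement of \<open>W\<close>, so that a bounded hermitian form has
  exactly one such operator. For \<open>B = cinner\<close> it is the orthogonal projection onto the closure of \<open>W\<close>.
\<close>

definition represents_form ::
    "'a::complex_hilbert set \<Rightarrow> ('a \<Rightarrow> 'a \<Rightarrow> complex) \<Rightarrow> 'a op \<Rightarrow> bool" where
  "represents_form W B h \<longleftrightarrow> h \<in> bops \<and> (\<forall>u. h \<cdot> u \<in> closure W) \<and>
     (\<forall>u\<in>W. \<forall>v\<in>W. cinner (h \<cdot> u) v = B u v) \<and>
     (\<forall>u. \<forall>w\<in>W. cinner (h \<cdot> u) w = cinner u (h \<cdot> w))"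

text \<open>
  The Riesz theorem is applied twice: first to represent the functionals \<open>B x\<close> on \<open>W\<close> by vectors \<open>t x\<close>,
  then to solve \<open>\<langle>h u, x\<rangle> = \<langle>u, t x\<rangle>\<close>, which makes sense for every vector \<open>u\<close> and so defines \<open>h\<close> on the
  whole space at once.
\<close>

lemma represents_form_exists:
  fixes B :: "'a::complex_hilbert \<Rightarrow> 'a \<Rightarrow> complex"
  assumes W: "csubspace W"
    and add: "\<And>x y z. x \<in> W \<Longrightarrow> y \<in> W \<Longrightarrow> z \<in> W \<Longrightarrow> B x (y + z) = B x y + B x z"
    and scale: "\<And>c x y. x \<in> W \<Longrightarrow> y \<in> W \<Longrightarrow> B x (c *\<^sub>C y) = c * B x y"
    and herm: "\<And>x y. x \<in> W \<Longrightarrow> y \<in> W \<Longrightarrow> B y x = cnj (B x y)"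
    and bound: "\<And>x y. x \<in> W \<Longrightarrow> y \<in> W \<Longrightarrow> cmod (B x y) \<le> C * norm x * norm y" and C: "C \<ge> 0"
  obtains h where "represents_form W B h"
proof -
  note WD = csubspaceD[OF W] and cWD = csubspaceD[OF csubspace_closure[OF W]]
  have "\<exists>t\<in>closure W. \<forall>w\<in>W. cinner t w = B x w" if x: "x \<in> W" for x
    by (rule Riesz_subspace[OF W, of "B x" "C * norm x"]) (auto simp: add scale bound x)
  then obtain t where t: "\<And>x. x \<in> W \<Longrightarrow> t x \<in> closure W"
    "\<And>x w. x \<in> W \<Longrightarrow> w \<in> W \<Longrightarrow> cinner (t x) w = B x w" by metis
  have t_add: "t (x + y) = t x + t y" if "x \<in> W" "y \<in> W" for x y
    by (rule closure_cinner_eqI[OF W])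
      (use that in \<open>auto simp: t WD cWD cinner_linear herm[of _ "x + y"] herm[of _ x] herm[of _ y] add\<close>)
  have t_scale: "t (c *\<^sub>C x) = c *\<^sub>C t x" if "x \<in> W" for x c
    by (rule closure_cinner_eqI[OF W])
      (use that in \<open>auto simp: t WD cWD cinner_linear herm[of _ "c *\<^sub>C x"] herm[of _ x] scale\<close>)
  have t_norm: "norm (t x) \<le> C * norm x" if "x \<in> W" for x
    by (rule closure_norm_leI[of _ W]) (use that in \<open>auto simp: t C bound\<close>)
  have "\<exists>v\<in>closure W. \<forall>w\<in>W. cinner v w = cinner u (t w)" for u
  proof (rule Riesz_subspace[OF W, of "\<lambda>w. cinner u (t w)" "norm u * C"])
    fix w assume "w \<in> W"
    then show "cmod (cinner u (t w)) \<le> norm u * C * norm w"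
      using order_trans[OF Cauchy_Schwarz_cinner mult_left_mono[OF t_norm]] by (simp add: mult.assoc)
  qed (auto simp: t_add t_scale cinner_linear)
  then obtain f where f: "\<And>u. f u \<in> closure W" "\<And>u w. w \<in> W \<Longrightarrow> cinner (f u) w = cinner u (t w)"
    by metis
  obtain h where h: "h \<in> bops" "blinfun_apply h = f"
  proof (rule ex_bop[of f C])
    show "f (x + y) = f x + f y" for x y
      by (rule closure_cinner_eqI[OF W]) (auto simp: f cWD cinner_linear)
    show "f (c *\<^sub>C x) = c *\<^sub>C f x" for c x
      by (rule closure_cinner_eqI[OF W]) (auto simp: f cWD cinner_linear)
    show "norm (f x) \<le> C * norm x" for x
    proof (rule closure_norm_leI[of _ W])
      fix w assume "w \<in> W"
      then show "cmod (cinner (f x) w) \<le> C * norm x * norm w"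
        using order_trans[OF Cauchy_Schwarz_cinner mult_left_mono[OF t_norm]]
        by (simp add: f mult.assoc mult.left_commute)
    qed (auto simp: f C)
  qed
  show thesis
  proof
    have eq: "cinner (f u) v = B u v" if "u \<in> W" "v \<in> W" for u v
      using that f t herm[of v u] cinner_commute[of u "t v"] by simp
    have "f v = t v" if "v \<in> W" for v
      by (rule closure_cinner_eqI[OF W]) (use that f t eq in auto)
    then show "represents_form W B h" unfolding represents_form_def using h f eq by simp
  qed
qed

section \<open>Adjoints\<close>

lemma bops_scaleC: "x \<in> bops \<Longrightarrow> x \<cdot> (c *\<^sub>C u) = c *\<^sub>C x \<cdot> u"
  by (simp add: bops_def)

lemma adj_unique:
  assumes "\<And>u v. cinner (y \<cdot> u) v = cinner u (x \<cdot> v)"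
  shows "adj x = y"
  unfolding adj_def
proof (rule the_equality)
  fix z assume "\<forall>\<xi> \<eta>. cinner (z \<cdot> \<xi>) \<eta> = cinner \<xi> (x \<cdot> \<eta>)"
  then show "z = y" by (intro blinfun_eqI cinner_eqI) (simp add: assms)
qed (use assms in auto)

lemma adj_exists:
  assumes x: "x \<in> bops"
  obtains y where "y \<in> bops" "\<And>u v. cinner (y \<cdot> u) v = cinner u (x \<cdot> v)"
proof -
  have W: "csubspace (UNIV :: 'a set)" by (simp add: csubspace_def)
  note b = Cauchy_Schwarz_blinfun[of _ x]
  have "\<exists>y. \<forall>v. cinner y v = cinner u (x \<cdot> v)" for u
    by (rule Riesz_subspace[OF W, of "\<lambda>v. cinner u (x \<cdot> v)" "norm x * norm u"])
      (auto simp: b blinfun.add_right cinner_linear bops_scaleC[OF x])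
  then obtain f where f: "\<And>u v. cinner (f u) v = cinner u (x \<cdot> v)" by metis
  obtain h where "h \<in> bops" "blinfun_apply h = f"
  proof (rule ex_bop[of f "norm x"])
    show "f (u + v) = f u + f v" for u v by (rule cinner_eqI) (simp add: f cinner_linear)
    show "f (c *\<^sub>C v) = c *\<^sub>C f v" for c v by (rule cinner_eqI) (simp add: f cinner_linear)
    show "norm (f v) \<le> norm x * norm v" for v
      by (rule closure_norm_leI[of _ UNIV]) (auto simp: f b)
  qed
  then show thesis using that[of h] f by simp
qed

lemma
  assumes "x \<in> bops"
  shows adj_bops [simp]: "adj x \<in> bops"
    and cinner_adj_left: "cinner (adj x \<cdot> u) v = cinner u (x \<cdot> v)"
proof -
  obtain y where "y \<in> bops" "\<And>u v. cinner (y \<cdot> u) v = cinner u (x \<cdot> v)"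
    using adj_exists[OF assms] by blast
  moreover from this(2) have "adj x = y" by (rule adj_unique)
  ultimately show "adj x \<in> bops" "cinner (adj x \<cdot> u) v = cinner u (x \<cdot> v)"
    by auto
qed

lemma cinner_adj_right:
  "x \<in> bops \<Longrightarrow> cinner u (adj x \<cdot> v) = cinner (x \<cdot> u) v"
  using cinner_adj_left[of x v u] by (metis cinner_commute)

lemma bops_closed [simp]:
  "id_blinfun \<in> bops" "0 \<in> bops" "x \<in> bops \<Longrightarrow> y \<in> bops \<Longrightarrow> x + y \<in> bops"
  "x \<in> bops \<Longrightarrow> y \<in> bops \<Longrightarrow> x - y \<in> bops" "x \<in> bops \<Longrightarrow> - x \<in> bops"
  "x \<in> bops \<Longrightarrow> r *\<^sub>R x \<in> bops"
  "x \<in> bops \<Longrightarrow> y \<in> bops \<Longrightarrow> x o\<^sub>L y \<in> bops"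
  by (simp_all add: bops_def blinfun.bilinear_simps scaleC_add_right scaleC_diff_right
      scaleC_minus_right scaleR_scaleC scaleC_scaleC mult.commute)

lemma op_scale_apply [simp]: "op_scale c x \<cdot> u = c *\<^sub>C x \<cdot> u"
proof -
  have "bounded_linear (\<lambda>u. c *\<^sub>C x \<cdot> u)"
    by (rule bounded_linear_compose[OF bounded_linear_scaleC blinfun.bounded_linear_right])
  then show ?thesis unfolding op_scale_def by (simp add: bounded_linear_Blinfun_apply)
qed

lemma op_scale_bops [simp]: "x \<in> bops \<Longrightarrow> op_scale c x \<in> bops"
  by (simp add: bops_def scaleC_scaleC mult.commute)

lemma op_scale_real: "op_scale (of_real r) x = r *\<^sub>R x"
  by (rule blinfun_eqI) (simp add: scaleR_scaleC blinfun.scaleR_left)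

lemma
  assumes "x \<in> bops"
  shows adj_adj [simp]: "adj (adj x) = x"
    and adj_op_scale: "adj (op_scale c x) = op_scale (cnj c) (adj x)"
    and adj_scaleR: "adj (r *\<^sub>R x) = r *\<^sub>R adj x"
    and adj_minus: "adj (- x) = - adj x"
  by (rule adj_unique; simp add: assms cinner_adj_right cinner_adj_left cinner_linear
    blinfun.bilinear_simps cinner_scaleR_left cinner_scaleR_right)+

lemma
  assumes "x \<in> bops" "y \<in> bops"
  shows adj_add: "adj (x + y) = adj x + adj y"
    and adj_diff: "adj (x - y) = adj x - adj y"
    and adj_comp: "adj (x o\<^sub>L y) = adj y o\<^sub>L adj x"
  by (rule adj_unique; simp add: assms cinner_adj_right cinner_adj_left cinner_linear
    blinfun.bilinear_simps)+

lemma adj_id [simp]: "adj id_blinfun = id_blinfun"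
  by (rule adj_unique) simp

lemma adj_zero [simp]: "adj 0 = 0"
  by (rule adj_unique) simp

lemma norm_adj: assumes "x \<in> bops" shows "norm (adj x) = norm x"
proof -
  have le: "norm (adj x) \<le> norm x" if x: "x \<in> bops" for x :: "'a op"
  proof (rule norm_blinfun_bound)
    fix u
    show "norm (adj x \<cdot> u) \<le> norm x * norm u"
    proof (rule closure_norm_leI[of _ UNIV])
      fix w
      show "cmod (cinner (adj x \<cdot> u) w) \<le> norm x * norm u * norm w"
        unfolding cinner_adj_left[OF x] by (rule Cauchy_Schwarz_blinfun)
    qed auto
  qed simp
  show ?thesis using le[OF assms] le[OF adj_bops[OF assms]] assms by simp
qed

lemma comp_simps:
  "x o\<^sub>L (y + z) = (x o\<^sub>L y) + (x o\<^sub>L z)" "(x + y) o\<^sub>L z = (x o\<^sub>L z) + (y o\<^sub>L z)"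
  "x o\<^sub>L (y - z) = (x o\<^sub>L y) - (x o\<^sub>L z)" "(x - y) o\<^sub>L z = (x o\<^sub>L z) - (y o\<^sub>L z)"
  "(x o\<^sub>L y) o\<^sub>L z = x o\<^sub>L (y o\<^sub>L z)" "id_blinfun o\<^sub>L x = x" "x o\<^sub>L id_blinfun = x"
  "op_scale c x o\<^sub>L y = op_scale c (x o\<^sub>L y)" "0 o\<^sub>L x = 0" "x o\<^sub>L 0 = 0"
  "(r *\<^sub>R x) o\<^sub>L y = r *\<^sub>R (x o\<^sub>L y)" "x o\<^sub>L (r *\<^sub>R y) = r *\<^sub>R (x o\<^sub>L y)"
  by (rule blinfun_eqI; simp add: blinfun.bilinear_simps)+

lemma comp_op_scale: "x \<in> bops \<Longrightarrow> x o\<^sub>L op_scale c y = op_scale c (x o\<^sub>L y)"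
  by (rule blinfun_eqI) (simp add: bops_scaleC)

section \<open>Operators of bounded forms\<close>

lemma bop_maps_closure:
  assumes "\<And>w. w \<in> W \<Longrightarrow> T \<cdot> w \<in> W" "v \<in> closure W"
  shows "T \<cdot> v \<in> closure W"
proof -
  obtain f where f: "\<And>n. f n \<in> W" "f \<longlonglongrightarrow> v" using assms(2) unfolding closure_sequential by blast
  show ?thesis
    unfolding closure_sequential using assms(1) f
    by (intro exI[of _ "\<lambda>n. T \<cdot> f n"]) (auto intro!: blinfun.tendsto)
qed

text \<open>
  Both products map into the closure of \<open>W\<close>, so they can be compared by their inner products with vectors
  in \<open>W\<close>; there the symmetry of \<open>h\<close> reduces the claim to the invariance of \<open>B\<close>.
\<close>

lemma represents_form_commute:
  assumes W: "csubspace W" and h: "represents_form W B h" and T: "T \<in> bops"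
    and inv: "\<And>w. w \<in> W \<Longrightarrow> T \<cdot> w \<in> W" "\<And>w. w \<in> W \<Longrightarrow> adj T \<cdot> w \<in> W"
    and B: "\<And>u v. u \<in> W \<Longrightarrow> v \<in> W \<Longrightarrow> B (adj T \<cdot> u) v = B u (T \<cdot> v)"
  shows "h o\<^sub>L T = T o\<^sub>L h"
proof (rule blinfun_eqI)
  fix u
  have h': "\<And>u. h \<cdot> u \<in> closure W"
    "\<And>u v. u \<in> W \<Longrightarrow> v \<in> W \<Longrightarrow> cinner (h \<cdot> u) v = B u v"
    "\<And>u w. w \<in> W \<Longrightarrow> cinner (h \<cdot> u) w = cinner u (h \<cdot> w)"
    using h by (auto simp: represents_form_def)
  note Tc = bop_maps_closure[of W T, OF inv(1)] bop_maps_closure[of W "adj T", OF inv(2)]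
  have *: "h \<cdot> adj T \<cdot> w = adj T \<cdot> h \<cdot> w"
    if "w \<in> W" for w
    by (rule closure_cinner_eqI[OF W])
      (use that in \<open>auto simp: h' inv B cinner_adj_left T Tc\<close>)
  have "h \<cdot> T \<cdot> u = T \<cdot> h \<cdot> u"
  proof (rule closure_cinner_eqI[OF W])
    fix w assume w: "w \<in> W"
    have "cinner (h \<cdot> T \<cdot> u) w
        = cinner u (adj T \<cdot> h \<cdot> w)"
      by (simp add: h' w cinner_adj_right T)
    also have "\<dots> = cinner (h \<cdot> u) (adj T \<cdot> w)"
      by (simp add: h' w inv *)
    finally show "cinner (h \<cdot> T \<cdot> u) w
        = cinner (T \<cdot> h \<cdot> u) w"
      by (simp add: cinner_adj_right T)
  qed (auto simp: h' Tc)
  then show "(h o\<^sub>L T) \<cdot> u = (T o\<^sub>L h) \<cdot> u" by simp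
qed

lemma orthogonal_projection_exists:
  assumes W: "csubspace W"
  obtains P where "represents_form W cinner P" "\<And>w. w \<in> W \<Longrightarrow> P \<cdot> w = w"
    "\<And>u w. w \<in> closure W \<Longrightarrow> cinner (u - P \<cdot> u) w = 0"
    "\<And>u. norm (P \<cdot> u) \<le> norm u"
proof -
  obtain P where P: "represents_form W cinner P"
    by (rule represents_form_exists[OF W, of cinner 1])
      (auto simp: cinner_linear Cauchy_Schwarz_cinner intro: cinner_commute)
  then have fix_P: "P \<cdot> w = w" if "w \<in> W" for w
    using that closure_subset
    by (intro closure_cinner_eqI[OF W]) (auto simp: represents_form_def)
  moreover have "cinner (u - P \<cdot> u) w = 0" if "w \<in> W" for u w
    using P that fix_P[OF that] by (simp add: represents_form_def cinner_diff_left)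
  then have orth: "cinner (u - P \<cdot> u) w = 0" if "w \<in> closure W" for u w
    using cinner_zero_closure that by blast
  moreover have "norm (P \<cdot> u) \<le> norm u" for u
  proof (rule closure_norm_leI[of _ W])
    show "P \<cdot> u \<in> closure W" using P by (simp add: represents_form_def)
    fix w assume "w \<in> W"
    then have "cinner (P \<cdot> u) w = cinner u w"
      using P fix_P by (simp add: represents_form_def)
    then show "cmod (cinner (P \<cdot> u) w) \<le> norm u * norm w"
      by (simp add: Cauchy_Schwarz_cinner)
  qed simp
  ultimately show thesis using P that by blast
qed

lemma nonneg_Reals_limit:
  assumes "f \<longlonglongrightarrow> (l::complex)" "\<And>n. f n \<in> \<real>\<^sub>\<ge>\<^sub>0" shows "l \<in> \<real>\<^sub>\<ge>\<^sub>0"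
  using closed_sequentially[OF closed_nonneg_Reals_complex] assms by blast

text \<open>
  With \<open>P\<close> the projection onto the closure of \<open>W\<close> one has \<open>\<langle>u, h u\<rangle> = \<langle>P u, h (P u)\<rangle>\<close>, so the bounds are
  needed only on the closure of \<open>W\<close>, where they hold by continuity.
\<close>

lemma represents_form_bounds:
  assumes W: "csubspace W" and h: "represents_form W B h" and C: "C \<ge> 0"
    and B: "\<And>u. u \<in> W \<Longrightarrow> B u u \<in> \<real>\<^sub>\<ge>\<^sub>0" "\<And>u. u \<in> W \<Longrightarrow> Re (B u u) \<le> C * (norm u)\<^sup>2"
  shows "positive_op h" "positive_op (C *\<^sub>R id_blinfun - h)"
proof -
  obtain P where P: "represents_form W cinner P"
    "\<And>u w. w \<in> closure W \<Longrightarrow> cinner (u - P \<cdot> u) w = 0"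
    "\<And>u. norm (P \<cdot> u) \<le> norm u"
    using orthogonal_projection_exists[OF W] by metis
  have h': "\<And>u. h \<cdot> u \<in> closure W"
    "\<And>u v. u \<in> W \<Longrightarrow> v \<in> W \<Longrightarrow> cinner (h \<cdot> u) v = B u v"
    "\<And>u w. w \<in> W \<Longrightarrow> cinner (h \<cdot> u) w = cinner u (h \<cdot> w)"
    using h by (auto simp: represents_form_def)
  have PW: "P \<cdot> u \<in> closure W" for u using P(1) by (simp add: represents_form_def)
  have hP: "h \<cdot> u = h \<cdot> P \<cdot> u" for u
  proof (rule closure_cinner_eqI[OF W])
    fix w assume "w \<in> W"
    then have "cinner (h \<cdot> (u - P \<cdot> u)) w = 0" by (simp add: h' P(2))
    then show "cinner (h \<cdot> u) w = cinner (h \<cdot> P \<cdot> u) w"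
      by (simp add: blinfun.diff_right cinner_diff_left)
  qed (auto simp: h')
  have key: "cinner v (h \<cdot> v) \<in> \<real>\<^sub>\<ge>\<^sub>0 \<and> Re (cinner v (h \<cdot> v)) \<le> C * (norm v)\<^sup>2"
    if v: "v \<in> closure W" for v
  proof -
    obtain f where f: "\<And>n. f n \<in> W" "f \<longlonglongrightarrow> v" using v unfolding closure_sequential by blast
    have lim: "(\<lambda>n. cinner (f n) (h \<cdot> f n)) \<longlonglongrightarrow> cinner v (h \<cdot> v)"
      by (intro tendsto_cinner f blinfun.tendsto tendsto_const)
    have eq: "cinner (f n) (h \<cdot> f n) = B (f n) (f n)" for n
      using h'(2)[OF f(1) f(1), of n n] h'(3)[OF f(1), of "f n" n] by simp
    show ?thesis
    proof
      show "cinner v (h \<cdot> v) \<in> \<real>\<^sub>\<ge>\<^sub>0"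
        by (rule nonneg_Reals_limit[OF lim]) (simp add: eq B f)
      show "Re (cinner v (h \<cdot> v)) \<le> C * (norm v)\<^sup>2"
        by (rule LIMSEQ_le[OF tendsto_Re[OF lim]
              tendsto_mult[OF tendsto_const tendsto_power[OF tendsto_norm[OF f(2)]]]])
          (auto simp: eq B f)
    qed
  qed
  have eq: "cinner u (h \<cdot> u)
      = cinner (P \<cdot> u) (h \<cdot> P \<cdot> u)" for u
    using P(2)[OF h'(1), of u "P \<cdot> u"] hP[of u] by (simp add: cinner_diff_left)
  have "Re (cinner u (h \<cdot> u)) \<le> C * (norm u)\<^sup>2" for u
  proof -
    have "Re (cinner u (h \<cdot> u)) \<le> C * (norm (P \<cdot> u))\<^sup>2"
      unfolding eq[of u] using key[OF PW] by blast
    also have "\<dots> \<le> C * (norm u)\<^sup>2" by (intro mult_left_mono power_mono P C) auto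
    finally show ?thesis .
  qed
  moreover have pos: "cinner u (h \<cdot> u) \<in> \<real>\<^sub>\<ge>\<^sub>0" for u
    unfolding eq[of u] using key[OF PW] by blast
  ultimately show "positive_op h" "positive_op (C *\<^sub>R id_blinfun - h)"
    using pos by (auto simp: positive_op_def blinfun.bilinear_simps cinner_diff_right
        cinner_scaleR_right cinner_self complex_nonneg_Reals_iff)
qed

section \<open>Positive operators\<close>

lemma
  assumes "positive_op h" "h \<in> bops"
  shows positive_op_hermitian: "cinner v (h \<cdot> u) = cnj (cinner u (h \<cdot> v))"
    and positive_op_Cauchy_Schwarz: "(cmod (cinner u (h \<cdot> v)))\<^sup>2
      \<le> Re (cinner u (h \<cdot> u)) * Re (cinner v (h \<cdot> v))"
proof -
  have *: "cinner u (h \<cdot> u) + c * cinner u (h \<cdot> v)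
      + cnj c * cinner v (h \<cdot> u) + cnj c * c * cinner v (h \<cdot> v) \<in> \<real>\<^sub>\<ge>\<^sub>0" for c
  proof -
    have "cinner u (h \<cdot> u) + c * cinner u (h \<cdot> v)
      + cnj c * cinner v (h \<cdot> u) + cnj c * c * cinner v (h \<cdot> v)
      = cinner (u + c *\<^sub>C v) (h \<cdot> (u + c *\<^sub>C v))"
      by (simp add: cinner_linear blinfun.bilinear_simps bops_scaleC assms algebra_simps)
    then show ?thesis using assms by (simp add: positive_op_def)
  qed
  note q = complex_quadratic_nonneg[OF *]
  show "cinner v (h \<cdot> u) = cnj (cinner u (h \<cdot> v))"
    "(cmod (cinner u (h \<cdot> v)))\<^sup>2
      \<le> Re (cinner u (h \<cdot> u)) * Re (cinner v (h \<cdot> v))"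
    by (rule q, use assms in \<open>simp add: positive_op_def\<close>)+
qed

lemma positive_op_adj:
  assumes "positive_op h" "h \<in> bops" shows "adj h = h"
  by (rule adj_unique) (metis assms positive_op_hermitian cinner_commute)

lemma positive_contraction:
  assumes "positive_op h" "positive_op (id_blinfun - h)" "h \<in> bops"
  shows "norm h \<le> 1"
proof (rule norm_blinfun_bound)
  have le: "Re (cinner u (h \<cdot> u)) \<le> (norm u)\<^sup>2" for u
    using assms(2) by (auto simp: positive_op_def blinfun.bilinear_simps cinner_diff_right
        cinner_self complex_nonneg_Reals_iff)
  fix u
  show "norm (h \<cdot> u) \<le> 1 * norm u"
  proof (rule closure_norm_leI[of _ UNIV])
    fix w
    have "(cmod (cinner w (h \<cdot> u)))\<^sup>2 \<le> (norm w)\<^sup>2 * (norm u)\<^sup>2"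
      using positive_op_Cauchy_Schwarz[OF assms(1,3), of w u] le[of w] le[of u]
        assms(1) order_trans mult_mono
      by (smt (verit) complex_nonneg_Reals_iff positive_op_def zero_le_power2)
    then have "(cmod (cinner w (h \<cdot> u)))\<^sup>2 \<le> (norm u * norm w)\<^sup>2"
      by (simp add: power_mult_distrib mult.commute)
    then have "cmod (cinner w (h \<cdot> u)) \<le> norm u * norm w"
      by (rule power2_le_imp_le) simp
    then show "cmod (cinner (h \<cdot> u) w) \<le> 1 * norm u * norm w"
      by (metis cinner_commute complex_mod_cnj mult_1)
  qed auto
qed simp

definition op_algebra :: "'a::complex_hilbert op set \<Rightarrow> bool" where
  "op_algebra N \<longleftrightarrow> N \<subseteq> bops \<and> id_blinfun \<in> N \<and> (\<forall>x\<in>N. \<forall>y\<in>N. x + y \<in> N \<and> x o\<^sub>L y \<in> N) \<and>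
     (\<forall>c. \<forall>x\<in>N. op_scale c x \<in> N)"

lemma op_algebra_closed:
  assumes "op_algebra N"
  shows "x \<in> N \<Longrightarrow> x \<in> bops" "id_blinfun \<in> N" "x \<in> N \<Longrightarrow> y \<in> N \<Longrightarrow> x + y \<in> N"
    "x \<in> N \<Longrightarrow> y \<in> N \<Longrightarrow> x o\<^sub>L y \<in> N" "x \<in> N \<Longrightarrow> op_scale c x \<in> N" "x \<in> N \<Longrightarrow> r *\<^sub>R x \<in> N"
    "0 \<in> N" "x \<in> N \<Longrightarrow> - x \<in> N" "x \<in> N \<Longrightarrow> y \<in> N \<Longrightarrow> x - y \<in> N"
proof -
  show *: "x \<in> N \<Longrightarrow> x \<in> bops" "id_blinfun \<in> N" "x \<in> N \<Longrightarrow> y \<in> N \<Longrightarrow> x + y \<in> N"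
    "x \<in> N \<Longrightarrow> y \<in> N \<Longrightarrow> x o\<^sub>L y \<in> N" "x \<in> N \<Longrightarrow> op_scale c x \<in> N" for x y c
    using assms by (auto simp: op_algebra_def)
  show **: "x \<in> N \<Longrightarrow> r *\<^sub>R x \<in> N" for x r using *(5)[of x "of_real r"] by (simp add: op_scale_real)
  show "0 \<in> N" using **[of id_blinfun 0] * by simp
  show ***: "x \<in> N \<Longrightarrow> - x \<in> N" for x using **[of x "-1"] by simp
  show "x \<in> N \<Longrightarrow> y \<in> N \<Longrightarrow> x - y \<in> N" using *(3)[of x "- y"] *** by simp
qed

lemma op_algebra_commutant: "S \<subseteq> bops \<Longrightarrow> op_algebra (commutant S)"
proof -
  assume S: "S \<subseteq> bops"
  have "(x o\<^sub>L y) o\<^sub>L z = z o\<^sub>L (x o\<^sub>L y)" if "x o\<^sub>L z = z o\<^sub>L x" "y o\<^sub>L z = z o\<^sub>L y" for x y z :: "'a op"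
    using that by (metis comp_simps(5))
  then show ?thesis
    using S unfolding op_algebra_def commutant_def
    by (auto simp: comp_simps(1,2,6,7,8) subset_eq comp_op_scale)
qed

text \<open>
  On the spectrum of \<open>p\<close> one step is \<open>t \<mapsto> t - t\<^sup>2\<close>, which maps \<open>[0, 1]\<close> into itself; its iterates tend to \<open>0\<close>
  uniformly. Hence \<open>p\<close> is the sum of the squares of its residues, which are polynomials in \<open>p\<close> and so lie in
  every algebra that contains \<open>p\<close>.
\<close>

fun residue :: "'a::complex_hilbert op \<Rightarrow> nat \<Rightarrow> 'a op" where
  "residue p 0 = p"
| "residue p (Suc n) = residue p n - (residue p n o\<^sub>L residue p n)"

lemma residue_in_algebra: "op_algebra N \<Longrightarrow> p \<in> N \<Longrightarrow> residue p n \<in> N"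
  by (induction n) (auto simp: op_algebra_closed)

text \<open>
  Write \<open>q - q\<^sup>2 = q (1 - q) q + (1 - q) q (1 - q)\<close> and \<open>1 - (q - q\<^sup>2) = (1 - q) + q\<^sup>2\<close>.
\<close>

lemma residue_bounds:
  assumes "p \<in> bops" "positive_op p" "positive_op (id_blinfun - p)"
  shows "residue p n \<in> bops \<and> positive_op (residue p n) \<and> positive_op (id_blinfun - residue p n)"
proof (induction n)
  case (Suc n)
  define q where "q = residue p n"
  have q: "q \<in> bops" "positive_op q" "positive_op (id_blinfun - q)" using Suc by (auto simp: q_def)
  have adj: "cinner (q \<cdot> u) v = cinner u (q \<cdot> v)" for u v
    using cinner_adj_left[OF q(1)] positive_op_adj[OF q(2,1)] by metis
  have "positive_op (q - (q o\<^sub>L q))"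
    unfolding positive_op_def
  proof
    fix u
    have "cinner u ((q - (q o\<^sub>L q)) \<cdot> u)
        = cinner (q \<cdot> u) ((id_blinfun - q) \<cdot> q \<cdot> u)
        + cinner ((id_blinfun - q) \<cdot> u) (q \<cdot> (id_blinfun - q) \<cdot> u)"
      by (simp add: blinfun.bilinear_simps cinner_linear adj)
    also have "\<dots> \<in> \<real>\<^sub>\<ge>\<^sub>0" using q unfolding positive_op_def by (blast intro: nonneg_Reals_add_I)
    finally show "cinner u ((q - (q o\<^sub>L q)) \<cdot> u) \<in> \<real>\<^sub>\<ge>\<^sub>0" .
  qed
  moreover have "positive_op (id_blinfun - (q - (q o\<^sub>L q)))"
    unfolding positive_op_def
  proof
    fix u
    have "cinner u ((id_blinfun - (q - (q o\<^sub>L q))) \<cdot> u)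
        = cinner u ((id_blinfun - q) \<cdot> u) + cinner (q \<cdot> u) (q \<cdot> u)"
      by (simp add: blinfun.bilinear_simps cinner_linear adj)
    also have "\<dots> \<in> \<real>\<^sub>\<ge>\<^sub>0" using q unfolding positive_op_def by (blast intro: nonneg_Reals_add_I cinner_self_nonneg)
    finally show "cinner u ((id_blinfun - (q - (q o\<^sub>L q))) \<cdot> u) \<in> \<real>\<^sub>\<ge>\<^sub>0" .
  qed
  ultimately show ?case using q(1) by (simp add: q_def)
qed (use assms in auto)

lemma residue_sum: "p = (\<Sum>k<n. residue p k o\<^sub>L residue p k) + residue p n"
  by (induction n) (simp_all add: algebra_simps)

text \<open>
  The norms of the vectors \<open>q\<^sub>k u\<close>, with \<open>q\<^sub>k\<close> the residues, decrease in \<open>k\<close>, and their squares sum up to at most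
  \<open>\<langle>u, p u\<rangle>\<close>; so the last of them is at most the average.
\<close>

lemma residue_norm:
  assumes p: "p \<in> bops" "positive_op p" "positive_op (id_blinfun - p)"
  shows "real n * (norm (residue p n \<cdot> u))\<^sup>2 \<le> (norm u)\<^sup>2"
proof -
  note q = residue_bounds[OF p]
  have adj: "cinner (residue p k \<cdot> u) v = cinner u (residue p k \<cdot> v)" for u v k
    using cinner_adj_left[of "residue p k"] positive_op_adj[of "residue p k"] q[of k] by metis
  have "norm (residue p (Suc k) \<cdot> u) \<le> norm (residue p k \<cdot> u)" for k
  proof -
    have "residue p (Suc k) \<cdot> u
        = (id_blinfun - residue p k) \<cdot> residue p k \<cdot> u"
      by (simp add: blinfun.bilinear_simps)
    moreover have "norm (id_blinfun - residue p k) \<le> 1"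
      using q[of k] by (intro positive_contraction) auto
    ultimately show ?thesis
      using norm_blinfun[of "id_blinfun - residue p k" "residue p k \<cdot> u"]
      by (smt (verit) mult_left_le_one_le norm_ge_zero)
  qed
  then have dec: "decseq (\<lambda>k. norm (residue p k \<cdot> u))" by (simp add: decseq_Suc_iff)
  have "real n * (norm (residue p n \<cdot> u))\<^sup>2
      = (\<Sum>k<n. (norm (residue p n \<cdot> u))\<^sup>2)" by simp
  also have "\<dots> \<le> (\<Sum>k<n. (norm (residue p k \<cdot> u))\<^sup>2)"
    using dec by (intro sum_mono power_mono) (auto simp: decseq_def)
  also have "\<dots> = Re (cinner u ((\<Sum>k<n. residue p k o\<^sub>L residue p k) \<cdot> u))"
    by (simp add: blinfun.sum_left cinner_sum_right norm_sq_cinner adj)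
  also have "\<dots> = Re (cinner u (p \<cdot> u)) - Re (cinner u (residue p n \<cdot> u))"
    by (subst (2) residue_sum[of p n]) (simp add: blinfun.bilinear_simps cinner_linear)
  also have "\<dots> \<le> (norm u)\<^sup>2"
    using p(3) q[of n] by (auto simp: positive_op_def blinfun.bilinear_simps cinner_diff_right
        cinner_self complex_nonneg_Reals_iff dest!: spec[of _ u])
  finally show ?thesis .
qed

lemma residue_tendsto_0:
  assumes p: "p \<in> bops" "positive_op p" "positive_op (id_blinfun - p)"
  shows "residue p \<longlonglongrightarrow> 0"
proof (rule Lim_null_comparison)
  show "\<forall>\<^sub>F n in sequentially. norm (residue p n) \<le> sqrt (1 / real n)"
    using eventually_gt_at_top[of 0]
  proof eventually_elim
    case (elim n)
    show ?case
    proof (rule norm_blinfun_bound)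
      fix u
      have "(norm (residue p n \<cdot> u))\<^sup>2 \<le> (1 / real n) * (norm u)\<^sup>2"
        using residue_norm[OF p, of n u] elim by (simp add: field_simps)
      then have "sqrt ((norm (residue p n \<cdot> u))\<^sup>2) \<le> sqrt ((1 / real n) * (norm u)\<^sup>2)"
        by (rule real_sqrt_le_mono)
      then show "norm (residue p n \<cdot> u) \<le> sqrt (1 / real n) * norm u"
        by (simp only: real_sqrt_mult real_sqrt_abs abs_norm_cancel)
    qed simp
  qed
  show "(\<lambda>n. sqrt (1 / real n)) \<longlonglongrightarrow> 0"
    using tendsto_real_sqrt[OF lim_1_over_n] by simp
qed

lemma positive_op_limit_of_squares:
  assumes N: "op_algebra N" and p: "p \<in> N" "positive_op p"
  obtains s where "\<And>k. s k \<in> N" "\<And>k. adj (s k) = s k" "\<And>k. s k \<in> bops"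
    "(\<lambda>n. \<Sum>k<n. s k o\<^sub>L s k) \<longlonglongrightarrow> p"
proof -
  note Nc = op_algebra_closed[OF N]
  \<comment> \<open>Division by c makes p a contraction; the summand 1 keeps c positive for p = 0.\<close>
  define c where "c = norm p + 1"
  have c: "c > 0" by (simp add: c_def add_nonneg_pos)
  define q where "q = (1 / c) *\<^sub>R p"
  have q: "q \<in> N" "q \<in> bops" using p Nc by (auto simp: q_def)
  have pos: "positive_op q"
    using p(2) c by (auto simp: positive_op_def q_def blinfun.bilinear_simps cinner_scaleR_right
        complex_nonneg_Reals_iff)
  have pos1: "positive_op (id_blinfun - q)"
    unfolding positive_op_def
  proof
    fix u
    have "Re (cinner u (p \<cdot> u)) \<le> norm p * norm u * norm u"
      using order_trans[OF complex_Re_le_cmod Cauchy_Schwarz_blinfun] .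
    also have "\<dots> \<le> c * (norm u)\<^sup>2" by (simp add: c_def power2_eq_square algebra_simps)
    finally have "Re (cinner u (p \<cdot> u)) / c \<le> (norm u)\<^sup>2" using c by (simp add: field_simps)
    then show "cinner u ((id_blinfun - q) \<cdot> u) \<in> \<real>\<^sub>\<ge>\<^sub>0"
      using p(2) by (auto simp: positive_op_def q_def blinfun.bilinear_simps cinner_scaleR_right
        complex_nonneg_Reals_iff cinner_diff_right cinner_self)
  qed
  note r = residue_bounds[OF q(2) pos pos1]
  define s where "s k = sqrt c *\<^sub>R residue q k" for k
  show thesis
  proof
    show "s k \<in> N" for k using residue_in_algebra[OF N q(1)] Nc by (simp add: s_def)
    show "adj (s k) = s k" for k using r[of k] positive_op_adj[of "residue q k"] by (simp add: s_def adj_scaleR)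
    show "s k \<in> bops" for k using r[of k] by (simp add: s_def)
    have "(\<Sum>k<n. s k o\<^sub>L s k) = p - c *\<^sub>R residue q n" for n
    proof -
      have "(\<Sum>k<n. s k o\<^sub>L s k) = c *\<^sub>R (\<Sum>k<n. residue q k o\<^sub>L residue q k)"
        using c by (simp add: s_def comp_simps scaleR_sum_right)
      also have "\<dots> = c *\<^sub>R (q - residue q n)" using residue_sum[of q n] by (metis add_diff_cancel_right')
      also have "\<dots> = p - c *\<^sub>R residue q n" using c by (simp add: q_def scaleR_diff_right)
      finally show ?thesis .
    qed
    moreover have "(\<lambda>n. p - c *\<^sub>R residue q n) \<longlonglongrightarrow> p - c *\<^sub>R 0"
      by (intro tendsto_intros residue_tendsto_0 q pos pos1)
    ultimately show "(\<lambda>n. \<Sum>k<n. s k o\<^sub>L s k) \<longlonglongrightarrow> p" by simp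
  qed
qed

text \<open>
  States and the comparisons between functionals are given on squares only, while expectations
  preserve positivity of operators; this lemma mediates between the two notions.
\<close>

lemma functional_nonneg_on_positive:
  fixes f :: "'a::complex_hilbert op \<Rightarrow> complex"
  assumes N: "op_algebra N"
    and add: "\<And>x y. x \<in> N \<Longrightarrow> y \<in> N \<Longrightarrow> f (x + y) = f x + f y"
    and bound: "\<And>x. x \<in> N \<Longrightarrow> cmod (f x) \<le> C * norm x"
    and sq: "\<And>x. x \<in> N \<Longrightarrow> adj x = x \<Longrightarrow> f (x o\<^sub>L x) \<in> \<real>\<^sub>\<ge>\<^sub>0"
    and p: "p \<in> N" "positive_op p"
  shows "f p \<in> \<real>\<^sub>\<ge>\<^sub>0"
proof -
  note Nc = op_algebra_closed[OF N]
  obtain s where s: "\<And>k. s k \<in> N" "\<And>k. adj (s k) = s k" "(\<lambda>n. \<Sum>k<n. s k o\<^sub>L s k) \<longlonglongrightarrow> p"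
    using positive_op_limit_of_squares[OF N p] by metis
  define t where "t n = (\<Sum>k<n. s k o\<^sub>L s k)" for n
  have t: "t n \<in> N" for n by (induction n) (auto simp: t_def Nc s)
  have f0: "f 0 = 0" using add[of 0 0] Nc by simp
  have pos: "f (t n) \<in> \<real>\<^sub>\<ge>\<^sub>0" for n
    using t by (induction n) (auto simp: t_def f0 add s Nc sq intro!: nonneg_Reals_add_I)
  have fd: "f p - f (t n) = f (p - t n)" for n
    using add[of "p - t n" "t n"] t p Nc by simp
  have "(\<lambda>n. f p - f (t n)) \<longlonglongrightarrow> 0"
  proof (rule Lim_null_comparison)
    show "\<forall>\<^sub>F n in sequentially. norm (f p - f (t n)) \<le> C * norm (p - t n)"
      unfolding fd using bound t p Nc by simp
    have "(\<lambda>n. C * norm (p - t n)) \<longlonglongrightarrow> C * norm (p - p)"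
      using s(3) unfolding t_def[symmetric] by (intro tendsto_intros)
    then show "(\<lambda>n. C * norm (p - t n)) \<longlonglongrightarrow> 0" by simp
  qed
  from tendsto_diff[OF tendsto_const[of "f p"] this] have "(\<lambda>n. f (t n)) \<longlonglongrightarrow> f p" by simp
  then show ?thesis by (rule nonneg_Reals_limit) (rule pos)
qed

section \<open>von Neumann algebras\<close>

lemma von_neumann_op_algebra: "von_neumann_algebra M \<Longrightarrow> op_algebra M"
  unfolding von_neumann_algebra_def
  using op_algebra_commutant[of "commutant M"] by (auto simp: commutant_def)

lemmas von_neumann_closed = op_algebra_closed[OF von_neumann_op_algebra]

lemma von_neumann_adj: "von_neumann_algebra M \<Longrightarrow> x \<in> M \<Longrightarrow> adj x \<in> M"
  by (simp add: von_neumann_algebra_def)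

lemma commutant_adj:
  assumes "S \<subseteq> bops" "\<And>x. x \<in> S \<Longrightarrow> adj x \<in> S" "a \<in> commutant S" shows "adj a \<in> commutant S"
proof -
  have a: "a \<in> bops" "\<And>y. y \<in> S \<Longrightarrow> a o\<^sub>L y = y o\<^sub>L a" using assms(3) by (auto simp: commutant_def)
  have "adj a o\<^sub>L y = y o\<^sub>L adj a" if y: "y \<in> S" for y
  proof -
    have "adj (a o\<^sub>L adj y) = adj (adj y o\<^sub>L a)" using a(2)[OF assms(2)[OF y]] by simp
    then show ?thesis using assms(1) y a(1) by (simp add: adj_comp subset_eq)
  qed
  then show ?thesis using a by (simp add: commutant_def)
qed

section \<open>Square-summable sequences of vectors\<close>

text \<open>
  The sum of countably many copies of a Hilbert space. Every element of the predual becomes a single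
  vector functional on it (\<open>op_predual_iff\<close>), and so questions of normality become questions about
  vectors.
\<close>

typedef (overloaded) 'a l2 = "{f :: nat \<Rightarrow> 'a::complex_hilbert. summable (\<lambda>n. (norm (f n))\<^sup>2)}"
  morphisms l2_nth Abs_l2
  by (rule exI[of _ "\<lambda>_. 0"]) simp

lemma l2_summable: "summable (\<lambda>n. (norm (l2_nth x n))\<^sup>2)"
  using l2_nth[of x] by simp

lemma l2_nth_Abs: "summable (\<lambda>n. (norm (f n))\<^sup>2) \<Longrightarrow> l2_nth (Abs_l2 f) = f"
  by (rule Abs_l2_inverse) simp

lemma l2_eqI: "(\<And>n. l2_nth x n = l2_nth y n) \<Longrightarrow> x = y"
  by (metis ext l2_nth_inject)

lemma norm_sq_add_le: "(norm (x + y))\<^sup>2 \<le> 2 * (norm x)\<^sup>2 + 2 * (norm (y::'a::complex_hilbert))\<^sup>2"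
  using parallelogram_law[of x y] zero_le_power2[of "norm (x - y)"] by linarith

lemma summable_sq_add:
  assumes "summable (\<lambda>n. (norm (f n))\<^sup>2)" "summable (\<lambda>n. (norm (g n :: 'a::complex_hilbert))\<^sup>2)"
  shows "summable (\<lambda>n. (norm (f n + g n))\<^sup>2)"
  by (rule summable_comparison_test'[where N = 0, OF summable_add[OF summable_mult[OF assms(1), of 2]
          summable_mult[OF assms(2), of 2]]]) (simp add: norm_sq_add_le)

lemma summable_sq_scaleC:
  "summable (\<lambda>n. (norm (f n))\<^sup>2) \<Longrightarrow> summable (\<lambda>n. (norm (c *\<^sub>C f n :: 'a::complex_hilbert))\<^sup>2)"
  by (simp add: norm_scaleC power_mult_distrib summable_mult)

lemma summable_sq_diff:
  assumes "summable (\<lambda>n. (norm (f n))\<^sup>2)" "summable (\<lambda>n. (norm (g n :: 'a::complex_hilbert))\<^sup>2)"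
  shows "summable (\<lambda>n. (norm (f n - g n))\<^sup>2)"
  using summable_sq_add[of f "\<lambda>n. - g n"] assms by simp

lemma mult_le_sum_squares: "a * b \<le> a\<^sup>2 + (b::real)\<^sup>2"
proof -
  have "0 \<le> (a - b)\<^sup>2 + a\<^sup>2 + b\<^sup>2" by simp
  then show ?thesis by (simp add: power2_eq_square algebra_simps)
qed

lemma summable_norm_cinner:
  assumes "summable (\<lambda>n. (norm (f n))\<^sup>2)" "summable (\<lambda>n. (norm (g n :: 'a::complex_hilbert))\<^sup>2)"
  shows "summable (\<lambda>n. cmod (cinner (f n) (g n)))"
proof (rule summable_comparison_test'[where N = 0, OF summable_add[OF assms]])
  fix n
  have "cmod (cinner (f n) (g n)) \<le> norm (f n) * norm (g n)" by (rule Cauchy_Schwarz_cinner)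
  also have "\<dots> \<le> (norm (f n))\<^sup>2 + (norm (g n))\<^sup>2" by (rule mult_le_sum_squares)
  finally show "norm (cmod (cinner (f n) (g n))) \<le> (norm (f n))\<^sup>2 + (norm (g n))\<^sup>2" by simp
qed

lemmas summable_l2_cinner = summable_norm_cancel[OF summable_norm_cinner[OF l2_summable l2_summable]]

instantiation l2 :: (complex_hilbert) real_normed_vector
begin

definition "0 = Abs_l2 (\<lambda>_. 0)"
definition "x + y = Abs_l2 (\<lambda>n. l2_nth x n + l2_nth y n)"
definition "x - y = Abs_l2 (\<lambda>n. l2_nth x n - l2_nth y n)"
definition "- x = Abs_l2 (\<lambda>n. - l2_nth x n)"
definition "r *\<^sub>R x = Abs_l2 (\<lambda>n. r *\<^sub>R l2_nth x n)"
definition "norm x = sqrt (\<Sum>n. (norm (l2_nth x n))\<^sup>2)"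
definition "sgn x = inverse (norm x) *\<^sub>R (x :: 'a l2)"
definition "dist x y = norm (x - y :: 'a l2)"
definition [code del]:
  "(uniformity :: ('a l2 \<times> 'a l2) filter) = (INF e\<in>{0 <..}. principal {(x, y). dist x y < e})"
definition [code del]:
  "open (U :: 'a l2 set) \<longleftrightarrow> (\<forall>x\<in>U. eventually (\<lambda>(x', y). x' = x \<longrightarrow> y \<in> U) uniformity)"

lemma l2_nth_simps [simp]:
  "l2_nth 0 n = 0" "l2_nth (x + y) n = l2_nth x n + l2_nth y n"
  "l2_nth (x - y) n = l2_nth x n - l2_nth y n" "l2_nth (- x) n = - l2_nth x n"
  "l2_nth (r *\<^sub>R x) n = r *\<^sub>R l2_nth x n"
  by (simp_all add: zero_l2_def plus_l2_def minus_l2_def uminus_l2_def scaleR_l2_def l2_nth_Abs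
      summable_sq_add summable_sq_diff l2_summable summable_mult power_mult_distrib)

lemma norm_l2_sq: "(norm x)\<^sup>2 = (\<Sum>n. (norm (l2_nth x n))\<^sup>2)"
  by (simp add: norm_l2_def suminf_nonneg l2_summable)

lemma norm_l2_leI:
  assumes "\<And>n. (\<Sum>k<n. (norm (l2_nth x k))\<^sup>2) \<le> c\<^sup>2" "c \<ge> 0" shows "norm x \<le> c"
proof -
  have "(norm x)\<^sup>2 \<le> c\<^sup>2" unfolding norm_l2_sq by (intro suminf_le_const l2_summable assms)
  then show ?thesis using assms(2) by (rule power2_le_imp_le)
qed

lemma L2_set_le_norm_l2: "L2_set (\<lambda>n. norm (l2_nth x n)) {..<k} \<le> norm x"
  unfolding norm_l2_def L2_set_def by (intro real_sqrt_le_mono sum_le_suminf l2_summable) auto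

instance
proof
  fix x y :: "'a l2" and r :: real
  show "x + y + z = x + (y + z)" "x + y = y + x" "0 + x = x" "- x + x = 0" "x - y = x + - y" for z
    by (auto intro!: l2_eqI)
  show "r *\<^sub>R (x + y) = r *\<^sub>R x + r *\<^sub>R y" "(r + s) *\<^sub>R x = r *\<^sub>R x + s *\<^sub>R x"
    "r *\<^sub>R s *\<^sub>R x = (r * s) *\<^sub>R x" "1 *\<^sub>R x = x" for s
    by (auto intro!: l2_eqI simp: scaleR_add_right scaleR_add_left)
  show "(norm x = 0) = (x = 0)"
  proof
    assume "norm x = 0"
    then have "(\<Sum>n. (norm (l2_nth x n))\<^sup>2) = 0" using norm_l2_sq[of x] by simp
    then have "\<And>n. (norm (l2_nth x n))\<^sup>2 = 0" using suminf_eq_zero_iff[OF l2_summable] by auto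
    then show "x = 0" by (auto intro!: l2_eqI)
  qed (simp add: norm_l2_def)
  show "norm (x + y) \<le> norm x + norm y"
  proof (rule norm_l2_leI)
    fix n
    have "L2_set (\<lambda>n. norm (l2_nth (x + y) n)) {..<n}
        \<le> L2_set (\<lambda>k. norm (l2_nth x k) + norm (l2_nth y k)) {..<n}"
      by (intro L2_set_mono) (auto simp: norm_triangle_ineq)
    also have "\<dots> \<le> norm x + norm y"
      by (rule order_trans[OF L2_set_triangle_ineq add_mono[OF L2_set_le_norm_l2 L2_set_le_norm_l2]])
    finally have "(L2_set (\<lambda>n. norm (l2_nth (x + y) n)) {..<n})\<^sup>2 \<le> (norm x + norm y)\<^sup>2"
      by (intro power_mono L2_set_nonneg)
    then show "(\<Sum>k<n. (norm (l2_nth (x + y) k))\<^sup>2) \<le> (norm x + norm y)\<^sup>2"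
      by (simp add: L2_set_def sum_nonneg)
  qed (simp add: norm_l2_def suminf_nonneg l2_summable)
  show "norm (r *\<^sub>R x) = \<bar>r\<bar> * norm x"
    unfolding norm_l2_def
    by (simp add: power_mult_distrib suminf_mult l2_summable real_sqrt_mult)
qed (simp_all add: sgn_l2_def dist_l2_def uniformity_l2_def open_l2_def)

end

lemma norm_l2_nth_le: "norm (l2_nth x n) \<le> norm x"
proof -
  have "(norm (l2_nth x n))\<^sup>2 \<le> (norm x)\<^sup>2"
    unfolding norm_l2_sq using sum_le_suminf[OF l2_summable, of "{n}" x] by simp
  then show ?thesis by (rule power2_le_imp_le) simp
qed

lemma bounded_linear_l2_nth: "bounded_linear (\<lambda>x. l2_nth x n)"
  by (rule bounded_linear_intro[of _ 1]) (auto simp: norm_l2_nth_le)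

instance l2 :: (complex_hilbert) banach
proof
  fix X :: "nat \<Rightarrow> 'a l2"
  assume X: "Cauchy X"
  have "Cauchy (\<lambda>m. l2_nth (X m) n)" for n
    by (rule bounded_linear.Cauchy[OF bounded_linear_l2_nth X])
  then have "\<exists>l. (\<lambda>m. l2_nth (X m) n) \<longlonglongrightarrow> l" for n
    using Cauchy_convergent_iff convergent_def by blast
  then obtain L where L: "\<And>n. (\<lambda>m. l2_nth (X m) n) \<longlonglongrightarrow> L n" by metis
  \<comment> \<open>Pass to the limit in the second index, for finitely many coordinates.\<close>
  have part: "(\<Sum>k<K. (norm (l2_nth (X m) k - L k))\<^sup>2) \<le> e\<^sup>2"
    if e: "e > 0" and N: "\<And>m n. m \<ge> N \<Longrightarrow> n \<ge> N \<Longrightarrow> norm (X m - X n) < e" and m: "m \<ge> N"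
    for e N m K
  proof (rule LIMSEQ_le_const2)
    show "(\<lambda>n. \<Sum>k<K. (norm (l2_nth (X m) k - l2_nth (X n) k))\<^sup>2)
        \<longlonglongrightarrow> (\<Sum>k<K. (norm (l2_nth (X m) k - L k))\<^sup>2)"
      by (intro tendsto_intros L)
    show "\<exists>N. \<forall>n\<ge>N. (\<Sum>k<K. (norm (l2_nth (X m) k - l2_nth (X n) k))\<^sup>2) \<le> e\<^sup>2"
    proof (intro exI allI impI)
      fix n assume "n \<ge> N"
      have "(\<Sum>k<K. (norm (l2_nth (X m) k - l2_nth (X n) k))\<^sup>2) \<le> (norm (X m - X n))\<^sup>2"
        unfolding norm_l2_sq using sum_le_suminf[OF l2_summable, of "{..<K}" "X m - X n"] by simp
      also have "\<dots> \<le> e\<^sup>2" using N[OF m \<open>n \<ge> N\<close>] by (intro power_mono) auto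
      finally show "(\<Sum>k<K. (norm (l2_nth (X m) k - l2_nth (X n) k))\<^sup>2) \<le> e\<^sup>2" .
    qed
  qed
  have CN: "\<exists>N. \<forall>m\<ge>N. \<forall>n\<ge>N. norm (X m - X n) < e" if "e > 0" for e
    using metric_CauchyD[OF X that] by (simp add: dist_norm)
  have summable_d: "summable (\<lambda>k. (norm (l2_nth (X m) k - L k))\<^sup>2)"
    if "e > 0" and "\<And>m n. m \<ge> N \<Longrightarrow> n \<ge> N \<Longrightarrow> norm (X m - X n) < e" and "m \<ge> N" for e N m
    by (rule bounded_imp_summable[where B = "e\<^sup>2"])
      (use part[OF that, where K = "Suc n" for n] in \<open>auto simp: lessThan_Suc_atMost\<close>)
  obtain N1 where N1: "\<And>m n. m \<ge> N1 \<Longrightarrow> n \<ge> N1 \<Longrightarrow> norm (X m - X n) < 1" using CN[of 1] by auto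
  have "summable (\<lambda>k. (norm (l2_nth (X N1) k - (l2_nth (X N1) k - L k)))\<^sup>2)"
    by (intro summable_sq_diff l2_summable summable_d[of 1, OF _ N1]) auto
  then have nthL: "l2_nth (Abs_l2 L) = L" by (intro l2_nth_Abs) simp
  have "X \<longlonglongrightarrow> Abs_l2 L"
  proof (rule metric_LIMSEQ_I)
    fix e :: real assume e: "e > 0"
    then obtain N where N: "\<And>m n. m \<ge> N \<Longrightarrow> n \<ge> N \<Longrightarrow> norm (X m - X n) < e / 2"
      using CN[of "e / 2"] by auto
    have "norm (X m - Abs_l2 L) \<le> e / 2" if "m \<ge> N" for m
      by (rule norm_l2_leI) (use part[OF _ N that] e in \<open>auto simp: nthL\<close>)
    then show "\<exists>no. \<forall>n\<ge>no. dist (X n) (Abs_l2 L) < e"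
      unfolding dist_norm using e by (smt (verit) field_sum_of_halves)
  qed
  then show "convergent X" by (auto simp: convergent_def)
qed

instantiation l2 :: (complex_hilbert) complex_hilbert
begin

definition "c *\<^sub>C x = Abs_l2 (\<lambda>n. c *\<^sub>C l2_nth x n)"
definition "cinner x y = (\<Sum>n. cinner (l2_nth x n) (l2_nth y n))"

lemma l2_nth_scaleC [simp]: "l2_nth (c *\<^sub>C x) n = c *\<^sub>C l2_nth x n"
  by (simp add: scaleC_l2_def l2_nth_Abs summable_sq_scaleC l2_summable)

instance
proof
  fix x y z :: "'a l2" and b c :: complex and r :: real
  show "c *\<^sub>C (x + y) = c *\<^sub>C x + c *\<^sub>C y" "(b + c) *\<^sub>C x = b *\<^sub>C x + c *\<^sub>C x"
    "b *\<^sub>C c *\<^sub>C x = (b * c) *\<^sub>C x" "r *\<^sub>R x = complex_of_real r *\<^sub>C x"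
    by (auto intro!: l2_eqI simp: scaleC_add_right scaleC_add_left scaleC_scaleC scaleR_scaleC)
  show "cinner x y = cnj (cinner y x)"
  proof -
    have "cnj (cinner y x) = (\<Sum>n. cnj (cinner (l2_nth y n) (l2_nth x n)))"
      unfolding cinner_l2_def
      by (rule bounded_linear.suminf[OF bounded_linear_cnj summable_l2_cinner])
    then show ?thesis unfolding cinner_l2_def by (simp flip: cinner_commute)
  qed
  show "cinner x (y + z) = cinner x y + cinner x z"
    unfolding cinner_l2_def by (simp add: cinner_add_right suminf_add summable_l2_cinner)
  show "cinner x (c *\<^sub>C y) = c * cinner x y"
    unfolding cinner_l2_def by (simp add: cinner_scaleC_right suminf_mult summable_l2_cinner)
  show "cinner x x = complex_of_real ((norm x)\<^sup>2)"
    unfolding cinner_l2_def norm_l2_sq cinner_self by (rule suminf_of_real[symmetric, OF l2_summable])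
qed

end

lemma cinner_l2_sums:
  "(\<lambda>n. cinner (l2_nth x n) (l2_nth y n)) sums cinner x (y :: 'a::complex_hilbert l2)"
  unfolding cinner_l2_def by (rule summable_sums[OF summable_l2_cinner])

section \<open>Diagonal operators\<close>

lemma summable_sq_blinfun:
  assumes "summable (\<lambda>n. (norm (f n))\<^sup>2)"
  shows "summable (\<lambda>n. (norm (x \<cdot> f n))\<^sup>2)"
proof (rule summable_comparison_test'[where N = 0, OF summable_mult[OF assms, of "(norm x)\<^sup>2"]])
  show "norm ((norm (x \<cdot> f n))\<^sup>2) \<le> (norm x)\<^sup>2 * (norm (f n))\<^sup>2" for n
    using power_mono[OF norm_blinfun, of x "f n" 2] by (simp add: power_mult_distrib)
qed

text \<open>
  The operator \<open>x\<close> acting in each coordinate, that is, \<open>1 \<otimes> x\<close>.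
\<close>

definition amp :: "'a::complex_hilbert op \<Rightarrow> 'a l2 op" where
  "amp x = Blinfun (\<lambda>v. Abs_l2 (\<lambda>n. x \<cdot> l2_nth v n))"

lemma
  shows l2_nth_amp [simp]: "l2_nth (amp x \<cdot> v) n = x \<cdot> l2_nth v n"
    and norm_amp_le: "norm (amp x \<cdot> v) \<le> norm x * norm v"
proof -
  define F where "F v = Abs_l2 (\<lambda>n. x \<cdot> l2_nth v n)" for v
  have nth: "l2_nth (F v) = (\<lambda>n. x \<cdot> l2_nth v n)" for v
    unfolding F_def by (intro l2_nth_Abs summable_sq_blinfun l2_summable)
  have bound: "norm (F v) \<le> norm x * norm v" for v
  proof (rule norm_l2_leI)
    fix n
    have "(\<Sum>k<n. (norm (l2_nth (F v) k))\<^sup>2) \<le> (\<Sum>k<n. (norm x)\<^sup>2 * (norm (l2_nth v k))\<^sup>2)"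
      unfolding nth power_mult_distrib[symmetric] by (intro sum_mono power_mono norm_blinfun) simp
    also have "\<dots> \<le> (norm x)\<^sup>2 * (norm v)\<^sup>2"
      unfolding sum_distrib_left[symmetric] norm_l2_sq
      by (intro mult_left_mono sum_le_suminf l2_summable) auto
    finally show "(\<Sum>k<n. (norm (l2_nth (F v) k))\<^sup>2) \<le> (norm x * norm v)\<^sup>2"
      by (simp add: power_mult_distrib)
  qed simp
  have "bounded_linear F"
    by (rule bounded_linear_intro[of _ "norm x"])
      (auto intro!: l2_eqI simp: nth blinfun.bilinear_simps bound mult.commute[of _ "norm x"])
  then have app: "blinfun_apply (amp x) = F"
    unfolding amp_def F_def[symmetric] by (rule bounded_linear_Blinfun_apply)
  show "l2_nth (amp x \<cdot> v) n = x \<cdot> l2_nth v n"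
    unfolding app nth ..
  show "norm (amp x \<cdot> v) \<le> norm x * norm v" unfolding app by (rule bound)
qed

lemma amp_simps:
  "amp (x + y) = amp x + amp y" "amp (x - y) = amp x - amp y" "amp (x o\<^sub>L y) = amp x o\<^sub>L amp y"
  "amp id_blinfun = id_blinfun" "amp 0 = 0" "amp (op_scale c x) = op_scale c (amp x)"
  "amp (r *\<^sub>R x) = r *\<^sub>R amp x"
  by (rule blinfun_eqI, rule l2_eqI, simp add: blinfun.bilinear_simps)+

lemma amp_bops [simp]: "x \<in> bops \<Longrightarrow> amp x \<in> bops"
  unfolding bops_def by (auto intro!: l2_eqI)

lemma adj_amp: assumes "x \<in> bops" shows "adj (amp x) = amp (adj x)"
  by (rule adj_unique) (simp add: cinner_l2_def cinner_adj_left assms)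

lemma op_predual_iff:
  "f \<in> op_predual A \<longleftrightarrow> (\<exists>\<xi> \<eta>. \<forall>x\<in>A. f x = cinner \<xi> (amp x \<cdot> \<eta>))"
proof
  assume "f \<in> op_predual A"
  then obtain \<xi> \<eta> where *: "summable (\<lambda>n. (norm (\<xi> n))\<^sup>2)" "summable (\<lambda>n. (norm (\<eta> n))\<^sup>2)"
    "\<forall>x\<in>A. f x = (\<Sum>n. cinner (\<xi> n) (x \<cdot> \<eta> n))"
    unfolding op_predual_def by blast
  then have "\<forall>x\<in>A. f x = cinner (Abs_l2 \<xi>) (amp x \<cdot> Abs_l2 \<eta>)"
    by (simp add: cinner_l2_def l2_nth_Abs)
  then show "\<exists>\<xi> \<eta>. \<forall>x\<in>A. f x = cinner \<xi> (amp x \<cdot> \<eta>)" by blast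
next
  assume "\<exists>\<xi> \<eta>. \<forall>x\<in>A. f x = cinner \<xi> (amp x \<cdot> \<eta>)"
  then obtain \<xi> \<eta> where *: "\<forall>x\<in>A. f x = cinner \<xi> (amp x \<cdot> \<eta>)" by blast
  show "f \<in> op_predual A"
    unfolding op_predual_def using * l2_summable
    by (intro CollectI exI[of _ "l2_nth \<xi>"] exI[of _ "l2_nth \<eta>"]) (auto simp: cinner_l2_def)
qed

section \<open>Sequences of sequences\<close>

text \<open>
  The unitary that identifies sequences of square-summable sequences with square-summable sequences,
  through a bijection between pairs of naturals and naturals. It turns a series of vector
  functionals into one vector functional.
\<close>

definition flatten :: "(nat \<Rightarrow> 'a::complex_hilbert l2) \<Rightarrow> 'a l2" where
  "flatten f = Abs_l2 (\<lambda>n. case prod_decode n of (j, k) \<Rightarrow> l2_nth (f j) k)"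

lemma has_sum_prod_decode:
  "((\<lambda>n. g (prod_decode n)) has_sum S) UNIV \<longleftrightarrow> (g has_sum S) UNIV"
  by (rule has_sum_reindex_bij_betw) (rule bij_prod_decode)

lemma flatten_sq_has_sum:
  assumes "summable (\<lambda>j. (norm (f j :: 'a::complex_hilbert l2))\<^sup>2)"
  shows "(\<lambda>(j, k). (norm (l2_nth (f j) k))\<^sup>2) summable_on UNIV"
proof -
  have "(\<lambda>(j, k). (norm (l2_nth (f j) k))\<^sup>2) summable_on (UNIV \<times> UNIV)"
  proof (rule summable_on_SigmaI)
    show "((\<lambda>k. case (j, k) of (j, k) \<Rightarrow> (norm (l2_nth (f j) k))\<^sup>2) has_sum (norm (f j))\<^sup>2) UNIV" for j
      unfolding norm_l2_sq prod.case
      by (intro sums_nonneg_imp_has_sum summable_sums l2_summable) auto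
    show "(\<lambda>j. (norm (f j))\<^sup>2) summable_on UNIV"
      by (rule summable_nonneg_imp_summable_on[OF assms]) auto
  qed auto
  then show ?thesis by simp
qed

lemma l2_nth_flatten:
  assumes "summable (\<lambda>j. (norm (f j :: 'a::complex_hilbert l2))\<^sup>2)"
  shows "l2_nth (flatten f) n = (case prod_decode n of (j, k) \<Rightarrow> l2_nth (f j) k)"
proof -
  have "(\<lambda>n. (norm (case prod_decode n of (j, k) \<Rightarrow> l2_nth (f j) k))\<^sup>2) summable_on UNIV"
    using flatten_sq_has_sum[OF assms]
    unfolding summable_on_def has_sum_prod_decode[symmetric] by (simp add: case_prod_unfold)
  then show ?thesis
    unfolding flatten_def by (subst l2_nth_Abs) (auto intro: summable_on_imp_summable)
qed

lemma cinner_flatten_sums: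
  assumes f: "summable (\<lambda>j. (norm (f j :: 'a::complex_hilbert l2))\<^sup>2)"
    and g: "summable (\<lambda>j. (norm (g j))\<^sup>2)"
  shows "(\<lambda>j. cinner (f j) (g j)) sums cinner (flatten f) (flatten g)"
proof -
  let ?h = "\<lambda>(j, k). cinner (l2_nth (f j) k) (l2_nth (g j) k)"
  have "(\<lambda>p. norm (?h p)) summable_on UNIV"
  proof (rule Infinite_Sum.abs_summable_on_comparison_test')
    show "(\<lambda>p. (case p of (j, k) \<Rightarrow> (norm (l2_nth (f j) k))\<^sup>2) + (case p of (j, k) \<Rightarrow> (norm (l2_nth (g j) k))\<^sup>2))
        summable_on UNIV"
      by (intro summable_on_add flatten_sq_has_sum f g)
    fix p :: "nat \<times> nat"
    obtain j k where p: "p = (j, k)" by (cases p)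
    have "cmod (cinner (l2_nth (f j) k) (l2_nth (g j) k)) \<le> norm (l2_nth (f j) k) * norm (l2_nth (g j) k)"
      by (rule Cauchy_Schwarz_cinner)
    also have "\<dots> \<le> (norm (l2_nth (f j) k))\<^sup>2 + (norm (l2_nth (g j) k))\<^sup>2"
      by (rule mult_le_sum_squares)
    finally show "norm (?h p) \<le> (case p of (j, k) \<Rightarrow> (norm (l2_nth (f j) k))\<^sup>2)
        + (case p of (j, k) \<Rightarrow> (norm (l2_nth (g j) k))\<^sup>2)" by (simp add: p)
  qed
  then have sm: "?h summable_on UNIV" by (rule abs_summable_summable)
  then obtain S where S: "(?h has_sum S) UNIV" by (auto simp: summable_on_def)
  have "((\<lambda>n. ?h (prod_decode n)) has_sum S) UNIV" using S has_sum_prod_decode by blast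
  then have "(\<lambda>n. ?h (prod_decode n)) sums S" by (rule has_sum_imp_sums)
  moreover have "?h (prod_decode n) = cinner (l2_nth (flatten f) n) (l2_nth (flatten g) n)" for n
    by (simp add: l2_nth_flatten f g case_prod_unfold)
  ultimately have SS: "S = cinner (flatten f) (flatten g)"
    using cinner_l2_sums[of "flatten f" "flatten g"] sums_unique2 by (metis (no_types, lifting) sums_cong)
  have "((\<lambda>j. cinner (f j) (g j)) has_sum S) UNIV"
  proof (rule has_sum_SigmaD[where B = "\<lambda>_. UNIV"])
    show "(?h has_sum S) (Sigma UNIV (\<lambda>_. UNIV))" using S by simp
    show "((\<lambda>k. ?h (j, k)) has_sum cinner (f j) (g j)) UNIV" for j
      unfolding prod.case
      by (rule norm_summable_imp_has_sum[OF summable_norm_cinner[OF l2_summable l2_summable] cinner_l2_sums])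
  qed
  then show ?thesis unfolding SS by (rule has_sum_imp_sums)
qed

lemma amp_flatten:
  assumes f: "summable (\<lambda>j. (norm (f j :: 'a::complex_hilbert l2))\<^sup>2)"
  shows "amp x \<cdot> flatten f = flatten (\<lambda>j. amp x \<cdot> f j)"
  by (rule l2_eqI) (simp add: l2_nth_flatten f summable_sq_blinfun case_prod_unfold)

lemma norm_flatten:
  assumes f: "(\<lambda>j. (norm (f j :: 'a::complex_hilbert l2))\<^sup>2) sums s"
  shows "(norm (flatten f))\<^sup>2 = s"
proof -
  have "summable (\<lambda>j. (norm (f j))\<^sup>2)" using f by (rule sums_summable)
  from cinner_flatten_sums[OF this this]
  have "(\<lambda>j. complex_of_real ((norm (f j))\<^sup>2)) sums of_real ((norm (flatten f))\<^sup>2)"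
    by (simp add: cinner_self)
  then have "(\<lambda>j. (norm (f j))\<^sup>2) sums (norm (flatten f))\<^sup>2" by (simp only: sums_of_real_iff)
  then show ?thesis using f sums_unique2 by blast
qed

lemma op_predual_series:
  assumes \<xi>: "summable (\<lambda>j. (norm (\<xi> j :: 'a::complex_hilbert l2))\<^sup>2)"
    and \<eta>: "summable (\<lambda>j. (norm (\<eta> j))\<^sup>2)"
    and f: "\<And>x. x \<in> A \<Longrightarrow> (\<lambda>j. cinner (\<xi> j) (amp x \<cdot> \<eta> j)) sums f x"
  shows "f \<in> op_predual A"
  unfolding op_predual_iff
proof (intro exI ballI)
  fix x assume "x \<in> A"
  from cinner_flatten_sums[OF \<xi> summable_sq_blinfun[OF \<eta>, of "amp x"]]
  show "f x = cinner (flatten \<xi>) (amp x \<cdot> flatten \<eta>)"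
    unfolding amp_flatten[OF \<eta>] using f[OF \<open>x \<in> A\<close>] sums_unique2 by blast
qed

lemma op_predual_add:
  assumes "f \<in> op_predual A" "g \<in> op_predual A" shows "(\<lambda>x. f x + g x) \<in> op_predual A"
proof -
  obtain \<xi> \<eta> \<xi>' \<eta>' where f: "\<And>x. x \<in> A \<Longrightarrow> f x = cinner \<xi> (amp x \<cdot> \<eta>)"
    and g: "\<And>x. x \<in> A \<Longrightarrow> g x = cinner \<xi>' (amp x \<cdot> \<eta>')"
    using assms unfolding op_predual_iff by metis
  let ?c = "\<lambda>a b (j::nat). if j = 0 then a else if j = 1 then b else (0::'a l2)"
  have S: "summable (\<lambda>j. (norm (?c a b j))\<^sup>2)" for a b
    by (rule summable_finite[of "{0, 1}"]) auto
  show ?thesis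
  proof (rule op_predual_series[OF S S])
    fix x assume x: "x \<in> A"
    have "(\<lambda>j. cinner (?c \<xi> \<xi>' j) (amp x \<cdot> ?c \<eta> \<eta>' j)) sums
        (\<Sum>j\<in>{0, 1}. cinner (?c \<xi> \<xi>' j) (amp x \<cdot> ?c \<eta> \<eta>' j))"
      by (rule sums_finite) auto
    then show "(\<lambda>j. cinner (?c \<xi> \<xi>' j) (amp x \<cdot> ?c \<eta> \<eta>' j)) sums (f x + g x)"
      by (simp add: f[OF x] g[OF x])
  qed
qed

lemma op_predual_scale:
  assumes "f \<in> op_predual A" shows "(\<lambda>x. c * f x) \<in> op_predual A"
  using assms unfolding op_predual_iff
  by (metis (no_types, lifting) cinner_scaleC_left complex_cnj_cnj)

lemma op_predual_mono: "A \<subseteq> B \<Longrightarrow> f \<in> op_predual B \<Longrightarrow> f \<in> op_predual A"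
  unfolding op_predual_iff by blast

lemma op_predual_cong:
  "f \<in> op_predual A \<Longrightarrow> (\<And>x. x \<in> A \<Longrightarrow> g x = f x) \<Longrightarrow> g \<in> op_predual A"
  unfolding op_predual_iff by auto

lemma op_predual_linear:
  assumes "f \<in> op_predual A"
  shows "x \<in> A \<Longrightarrow> y \<in> A \<Longrightarrow> x + y \<in> A \<Longrightarrow> f (x + y) = f x + f y"
    "x \<in> A \<Longrightarrow> y \<in> A \<Longrightarrow> x - y \<in> A \<Longrightarrow> f (x - y) = f x - f y"
    "x \<in> A \<Longrightarrow> op_scale c x \<in> A \<Longrightarrow> f (op_scale c x) = c * f x"
  using assms unfolding op_predual_iff
  by (auto simp: amp_simps blinfun.bilinear_simps cinner_linear)

lemma op_predual_bounded:
  assumes "f \<in> op_predual A"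
  obtains C where "C \<ge> 0" "\<And>x. x \<in> A \<Longrightarrow> cmod (f x) \<le> C * norm x"
proof -
  obtain \<xi> \<eta> where f: "\<And>x. x \<in> A \<Longrightarrow> f x = cinner \<xi> (amp x \<cdot> \<eta>)"
    using assms unfolding op_predual_iff by metis
  show thesis
  proof (rule that[of "norm \<xi> * norm \<eta>"])
    fix x assume "x \<in> A"
    have "cmod (f x) \<le> norm \<xi> * norm (amp x \<cdot> \<eta>)"
      unfolding f[OF \<open>x \<in> A\<close>] by (rule Cauchy_Schwarz_cinner)
    also have "\<dots> \<le> norm \<xi> * (norm x * norm \<eta>)" by (intro mult_left_mono norm_amp_le) auto
    finally show "cmod (f x) \<le> norm \<xi> * norm \<eta> * norm x" by (simp add: mult_ac)
  qed simp
qed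

section \<open>Positive functionals and the Radon-Nikodym theorem\<close>

definition positive_functional :: "'h::complex_hilbert op set \<Rightarrow> ('h op \<Rightarrow> complex) \<Rightarrow> bool" where
  "positive_functional M g \<longleftrightarrow>
     (\<forall>x\<in>M. \<forall>y\<in>M. g (x + y) = g x + g y) \<and> (\<forall>x\<in>M. \<forall>c. g (op_scale c x) = c * g x) \<and>
     (\<forall>x\<in>M. g (adj x o\<^sub>L x) \<in> \<real>\<^sub>\<ge>\<^sub>0)"

lemma positive_functional_square:
  "positive_functional M g \<Longrightarrow> x \<in> M \<Longrightarrow> g (adj x o\<^sub>L x) \<in> \<real>\<^sub>\<ge>\<^sub>0"
  by (simp add: positive_functional_def)

lemma positive_functional_linear:
  assumes "von_neumann_algebra M" "positive_functional M g" "x \<in> M" "y \<in> M"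
  shows "g (x + y) = g x + g y" "g (op_scale c x) = c * g x" "g (x - y) = g x - g y"
proof -
  have *: "g (x + y) = g x + g y" "g (op_scale c x) = c * g x" if "x \<in> M" "y \<in> M" for x y c
    using assms(2) that by (auto simp: positive_functional_def)
  show "g (x + y) = g x + g y" "g (op_scale c x) = c * g x" using * assms by auto
  show "g (x - y) = g x - g y"
    using *(1)[of "x - y" y] assms(3,4) von_neumann_closed[OF assms(1)] by simp
qed

lemma
  assumes M: "von_neumann_algebra M" and g: "positive_functional M g" and xy: "x \<in> M" "y \<in> M"
  shows positive_functional_hermitian: "g (adj y o\<^sub>L x) = cnj (g (adj x o\<^sub>L y))"
    and positive_functional_Cauchy_Schwarz:
      "(cmod (g (adj x o\<^sub>L y)))\<^sup>2 \<le> Re (g (adj x o\<^sub>L x)) * Re (g (adj y o\<^sub>L y))"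
proof -
  note Mc = von_neumann_closed[OF M] von_neumann_adj[OF M] and lin = positive_functional_linear[OF M g]
  have *: "g (adj x o\<^sub>L x) + c * g (adj x o\<^sub>L y) + cnj c * g (adj y o\<^sub>L x)
      + cnj c * c * g (adj y o\<^sub>L y) \<in> \<real>\<^sub>\<ge>\<^sub>0" for c
  proof -
    have "adj (x + op_scale c y) o\<^sub>L (x + op_scale c y)
        = (adj x o\<^sub>L x) + op_scale c (adj x o\<^sub>L y)
          + (op_scale (cnj c) (adj y o\<^sub>L x) + op_scale (cnj c) (op_scale c (adj y o\<^sub>L y)))"
      using xy Mc by (simp add: adj_add adj_op_scale comp_simps comp_op_scale)
    then have "g (adj (x + op_scale c y) o\<^sub>L (x + op_scale c y))
        = g (adj x o\<^sub>L x) + c * g (adj x o\<^sub>L y) + cnj c * g (adj y o\<^sub>L x)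
          + cnj c * c * g (adj y o\<^sub>L y)"
      using xy Mc by (simp add: lin)
    moreover have "g (adj (x + op_scale c y) o\<^sub>L (x + op_scale c y)) \<in> \<real>\<^sub>\<ge>\<^sub>0"
      by (rule positive_functional_square[OF g]) (use xy Mc in auto)
    ultimately show ?thesis by simp
  qed
  have "g (adj y o\<^sub>L y) \<in> \<real>\<^sub>\<ge>\<^sub>0" by (rule positive_functional_square[OF g xy(2)])
  from complex_quadratic_nonneg[OF * this]
  show "g (adj y o\<^sub>L x) = cnj (g (adj x o\<^sub>L y))"
    "(cmod (g (adj x o\<^sub>L y)))\<^sup>2 \<le> Re (g (adj x o\<^sub>L x)) * Re (g (adj y o\<^sub>L y))" by auto
qed

text \<open>
  The operator \<open>h\<close> represents the form that takes \<open>x \<zeta>\<close> and \<open>y \<zeta>\<close> to \<open>g (x\<^sup>* y)\<close>. By the Cauchy-Schwarz inequality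
  for \<open>g\<close>, domination makes this form well defined and bounded, and it is invariant under \<open>M\<close>, since
  \<open>g ((y\<^sup>* x)\<^sup>* z) = g (x\<^sup>* (y z))\<close>; so \<open>h\<close> commutes with \<open>M\<close>.
\<close>

lemma Radon_Nikodym:
  fixes M :: "'h::complex_hilbert op set" and \<zeta> :: "'h l2"
  assumes M: "von_neumann_algebra M" and g: "positive_functional M g"
    and dom: "\<And>x. x \<in> M \<Longrightarrow> Re (g (adj x o\<^sub>L x)) \<le> c * (norm (amp x \<cdot> \<zeta>))\<^sup>2"
    and c: "c \<ge> 0"
  obtains h where "h \<in> commutant (amp ` M)" "positive_op h" "positive_op (c *\<^sub>R id_blinfun - h)"
    "\<And>x. x \<in> M \<Longrightarrow> g x = cinner \<zeta> (h \<cdot> amp x \<cdot> \<zeta>)"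
proof -
  note Mc = von_neumann_closed[OF M] von_neumann_adj[OF M] and lin = positive_functional_linear[OF M g]
    and CS = positive_functional_Cauchy_Schwarz[OF M g] and herm = positive_functional_hermitian[OF M g]
  define W where "W = (\<lambda>x. amp x \<cdot> \<zeta>) ` M"
  have W: "csubspace W"
    unfolding csubspace_def
  proof (intro conjI ballI allI)
    show "0 \<in> W" unfolding W_def using Mc by (intro image_eqI[of _ _ 0]) (auto simp: amp_simps)
    fix u assume "u \<in> W"
    then obtain x where x: "u = amp x \<cdot> \<zeta>" "x \<in> M" unfolding W_def by blast
    show "k *\<^sub>C u \<in> W" for k
      unfolding W_def using Mc x by (intro image_eqI[of _ _ "op_scale k x"]) (auto simp: amp_simps)
    fix v assume "v \<in> W"
    then obtain y where y: "v = amp y \<cdot> \<zeta>" "y \<in> M" unfolding W_def by blast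
    show "u + v \<in> W"
      unfolding W_def using Mc x y
      by (intro image_eqI[of _ _ "x + y"]) (auto simp: amp_simps blinfun.bilinear_simps)
  qed
  \<comment> \<open>Some element of M that takes the vector to u; the form B does not depend on the choice.\<close>
  define r where "r u = (SOME x. x \<in> M \<and> amp x \<cdot> \<zeta> = u)" for u
  have r: "r u \<in> M" "amp (r u) \<cdot> \<zeta> = u" if "u \<in> W" for u
    unfolding r_def by (rule someI2_ex; use that in \<open>auto simp: W_def\<close>)+
  define B where "B u v = g (adj (r u) o\<^sub>L r v)" for u v
  have gb: "cmod (g (adj x o\<^sub>L y)) \<le> c * norm (amp x \<cdot> \<zeta>) * norm (amp y \<cdot> \<zeta>)"
    if "x \<in> M" "y \<in> M" for x y
  proof -
    have "(cmod (g (adj x o\<^sub>L y)))\<^sup>2 \<le> Re (g (adj x o\<^sub>L x)) * Re (g (adj y o\<^sub>L y))" by (rule CS[OF that])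
    also have "\<dots> \<le> (c * (norm (amp x \<cdot> \<zeta>))\<^sup>2) * (c * (norm (amp y \<cdot> \<zeta>))\<^sup>2)"
      using g that c by (intro mult_mono dom) (auto simp: positive_functional_def complex_nonneg_Reals_iff)
    also have "\<dots> = (c * norm (amp x \<cdot> \<zeta>) * norm (amp y \<cdot> \<zeta>))\<^sup>2"
      by (simp add: power_mult_distrib power2_eq_square)
    finally show ?thesis by (rule power2_le_imp_le) (use c in auto)
  qed
  have Bg: "B (amp x \<cdot> \<zeta>) (amp y \<cdot> \<zeta>) = g (adj x o\<^sub>L y)"
    if xy: "x \<in> M" "y \<in> M" for x y
  proof -
    let ?x = "r (amp x \<cdot> \<zeta>)" and ?y = "r (amp y \<cdot> \<zeta>)"
    have rx: "?x \<in> M" "amp ?x \<cdot> \<zeta> = amp x \<cdot> \<zeta>"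
      and ry: "?y \<in> M" "amp ?y \<cdot> \<zeta> = amp y \<cdot> \<zeta>"
      using xy by (auto intro!: r simp: W_def)
    have "g (adj (?x - x) o\<^sub>L ?y) = 0" "g (adj x o\<^sub>L (?y - y)) = 0"
      using gb[of "?x - x" ?y] gb[of x "?y - y"] rx ry xy Mc
      by (auto simp: amp_simps blinfun.bilinear_simps)
    then show ?thesis
      unfolding B_def using rx ry xy Mc by (simp add: adj_diff comp_simps lin)
  qed
  obtain h where h: "represents_form W B h"
  proof (rule represents_form_exists[OF W, of B c])
    fix u v assume "u \<in> W" "v \<in> W"
    then obtain x y where xy: "x \<in> M" "y \<in> M" "u = amp x \<cdot> \<zeta>" "v = amp y \<cdot> \<zeta>"
      unfolding W_def by blast
    show "B v u = cnj (B u v)" using xy by (simp add: Bg herm[of x y])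
    show "cmod (B u v) \<le> c * norm u * norm v" using xy by (simp add: Bg gb)
    show "B u (k *\<^sub>C v) = k * B u v" for k
      using Bg[of x "op_scale k y"] xy Mc by (simp add: amp_simps Bg comp_op_scale lin)
    fix w assume "w \<in> W"
    then obtain z where z: "z \<in> M" "w = amp z \<cdot> \<zeta>" unfolding W_def by blast
    show "B u (v + w) = B u v + B u w"
      using Bg[of x "y + z"] xy z Mc
      by (simp add: amp_simps blinfun.bilinear_simps Bg comp_simps lin)
  qed (use c in auto)
  have "B u u \<in> \<real>\<^sub>\<ge>\<^sub>0 \<and> Re (B u u) \<le> c * (norm u)\<^sup>2" if "u \<in> W" for u
  proof -
    from that
    obtain x where x: "u = amp x \<cdot> \<zeta>" "x \<in> M" unfolding W_def by blast
    show ?thesis using g x dom by (simp add: Bg positive_functional_def)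
  qed
  then have pos: "positive_op h" "positive_op (c *\<^sub>R id_blinfun - h)"
    using represents_form_bounds[OF W h c] by blast+
  have "h o\<^sub>L amp y = amp y o\<^sub>L h" if y: "y \<in> M" for y
  proof (rule represents_form_commute[OF W h])
    show "amp y \<in> bops" using y Mc by simp
    have inv: "amp z \<cdot> w \<in> W" if "w \<in> W" "z \<in> M" for w z
    proof -
      obtain x where x: "w = amp x \<cdot> \<zeta>" "x \<in> M" using \<open>w \<in> W\<close> unfolding W_def by blast
      show ?thesis unfolding W_def using x that Mc
        by (intro image_eqI[of _ _ "z o\<^sub>L x"]) (auto simp: amp_simps)
    qed
    show "amp y \<cdot> w \<in> W" "adj (amp y) \<cdot> w \<in> W" if "w \<in> W" for w
      using inv[OF that] y Mc by (auto simp: adj_amp)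
    fix u v assume "u \<in> W" "v \<in> W"
    then obtain x z where xz: "x \<in> M" "z \<in> M" "u = amp x \<cdot> \<zeta>" "v = amp z \<cdot> \<zeta>"
      unfolding W_def by blast
    have "B (amp (adj y o\<^sub>L x) \<cdot> \<zeta>) v = B u (amp (y o\<^sub>L z) \<cdot> \<zeta>)"
      unfolding xz using xz y Mc by (simp add: Bg adj_comp comp_simps)
    then show "B (adj (amp y) \<cdot> u) v = B u (amp y \<cdot> v)"
      using xz y Mc by (simp add: adj_amp amp_simps)
  qed
  then have "h \<in> commutant (amp ` M)" using h by (auto simp: commutant_def represents_form_def)
  moreover have "g x = cinner \<zeta> (h \<cdot> amp x \<cdot> \<zeta>)" if x: "x \<in> M" for x
  proof -
    have z: "\<zeta> = amp id_blinfun \<cdot> \<zeta>" by (simp add: amp_simps)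
    then have "\<zeta> \<in> W" unfolding W_def using Mc(2) by blast
    moreover have "amp x \<cdot> \<zeta> \<in> W" unfolding W_def using x by blast
    ultimately have "cinner \<zeta> (h \<cdot> amp x \<cdot> \<zeta>)
        = B \<zeta> (amp x \<cdot> \<zeta>)"
      using h unfolding represents_form_def by metis
    also have "\<dots> = g x" using Bg[OF Mc(2) x] z by (simp add: comp_simps)
    finally show ?thesis by simp
  qed
  ultimately show thesis using that pos by blast
qed

section \<open>The commutant of the amplification\<close>

lemma matrix_unit_exists:
  obtains T :: "'a::complex_hilbert l2 op" where "T \<in> bops"
    "\<And>v n. l2_nth (T \<cdot> v) n = (if n = i then l2_nth v j else 0)"
proof -
  let ?f = "\<lambda>v n. if n = i then l2_nth v j else (0::'a)"
  define F where "F v = Abs_l2 (?f v)" for v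
  have nth: "l2_nth (F v) n = ?f v n" for v n
    unfolding F_def by (subst l2_nth_Abs) (auto intro!: summable_finite[of "{i}"] split: if_splits)
  obtain T where "T \<in> bops" "blinfun_apply T = F"
  proof (rule ex_bop[of F 1])
    show "norm (F v) \<le> 1 * norm v" for v
    proof (rule norm_l2_leI)
      fix n
      have "(\<Sum>k<n. (norm (l2_nth (F v) k))\<^sup>2) \<le> (norm (l2_nth v j))\<^sup>2"
        unfolding nth by (simp add: if_distrib[of "\<lambda>x. (norm x)\<^sup>2"] cong: if_cong)
      also have "\<dots> \<le> (1 * norm v)\<^sup>2" by (simp add: norm_l2_nth_le power_mono)
      finally show "(\<Sum>k<n. (norm (l2_nth (F v) k))\<^sup>2) \<le> (1 * norm v)\<^sup>2" .
    qed simp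
  qed (auto intro!: l2_eqI simp: nth)
  then show thesis using that nth by simp
qed

text \<open>
  Commuting with the matrix units forces \<open>T\<close> to be diagonal with equal entries \<open>q\<close>; commuting with the
  amplified commutant of \<open>M\<close> puts \<open>q\<close> into the bicommutant of \<open>M\<close>, which is \<open>M\<close>.
\<close>

lemma bicommutant_amp:
  assumes M: "von_neumann_algebra M" and T: "T \<in> commutant (commutant (amp ` M))"
  obtains q where "q \<in> M" "T = amp q"
proof -
  have Tb: "T \<in> bops" and Tc: "\<And>a. a \<in> commutant (amp ` M) \<Longrightarrow> T o\<^sub>L a = a o\<^sub>L T"
    using T by (auto simp: commutant_def)
  \<comment> \<open>Coordinate j of T v depends only on coordinate j of v and is computed by the corner of T at 0.\<close>
  have nth_T: "l2_nth (T \<cdot> v) j = l2_nth (T \<cdot> w) 0"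
    if w: "\<And>n. l2_nth w n = (if n = 0 then l2_nth v j else 0)" for v w j
  proof -
    obtain U :: "'a l2 op" where U: "U \<in> bops"
      "\<And>v n. l2_nth (U \<cdot> v) n = (if n = 0 then l2_nth v j else 0)"
      using matrix_unit_exists by blast
    have "U \<in> commutant (amp ` M)"
      unfolding commutant_def using U by (auto intro!: blinfun_eqI l2_eqI simp: blinfun.bilinear_simps)
    then have "(T o\<^sub>L U) \<cdot> v = (U o\<^sub>L T) \<cdot> v" using Tc by metis
    moreover have "U \<cdot> v = w" using U w by (auto intro!: l2_eqI)
    ultimately have "T \<cdot> w = U \<cdot> T \<cdot> v" by simp
    then show ?thesis by (simp add: U)
  qed
  define single where "single u = Abs_l2 (\<lambda>n. if n = 0 then u else (0::'a))" for u
  have single: "l2_nth (single u) n = (if n = 0 then u else 0)" for u n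
    unfolding single_def by (subst l2_nth_Abs) (auto intro!: summable_finite[of "{0}"] split: if_splits)
  have norm_single: "norm (single u) \<le> norm u" for u
    by (rule norm_l2_leI)
      (auto simp: single if_distrib[of "\<lambda>x. (norm x)\<^sup>2"] cong: if_cong)
  obtain q where q: "q \<in> bops" "blinfun_apply q = (\<lambda>u. l2_nth (T \<cdot> single u) 0)"
  proof (rule ex_bop[of "\<lambda>u. l2_nth (T \<cdot> single u) 0" "norm T"])
    have "single (x + y) = single x + single y" "single (c *\<^sub>C x) = c *\<^sub>C single x" for x y c
      by (auto intro!: l2_eqI simp: single)
    then show "l2_nth (T \<cdot> single (x + y)) 0
        = l2_nth (T \<cdot> single x) 0 + l2_nth (T \<cdot> single y) 0"
      "l2_nth (T \<cdot> single (c *\<^sub>C x)) 0 = c *\<^sub>C l2_nth (T \<cdot> single x) 0" for x y c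
      by (simp_all add: blinfun.bilinear_simps bops_scaleC Tb)
    fix u
    have "norm (l2_nth (T \<cdot> single u) 0) \<le> norm T * norm (single u)"
      using norm_l2_nth_le norm_blinfun order_trans by blast
    also have "\<dots> \<le> norm T * norm u" by (intro mult_left_mono norm_single) auto
    finally show "norm (l2_nth (T \<cdot> single u) 0) \<le> norm T * norm u" .
  qed
  have "T = amp q" by (intro blinfun_eqI l2_eqI) (simp add: q nth_T single)
  moreover have "q \<in> commutant (commutant M)"
    unfolding commutant_def[of "commutant M"]
  proof (intro CollectI conjI ballI q)
    fix a assume "a \<in> commutant M"
    then have a: "a \<in> bops" "\<And>x. x \<in> M \<Longrightarrow> a o\<^sub>L x = x o\<^sub>L a" by (auto simp: commutant_def)
    then have "amp a \<in> commutant (amp ` M)"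
      unfolding commutant_def by (auto simp: amp_simps(3)[symmetric])
    then have Ta: "T o\<^sub>L amp a = amp a o\<^sub>L T" by (rule Tc)
    show "q o\<^sub>L a = a o\<^sub>L q"
    proof (rule blinfun_eqI)
      fix u
      have s: "single (a \<cdot> u) = amp a \<cdot> single u"
        by (auto intro!: l2_eqI simp: single blinfun.bilinear_simps)
      have "T \<cdot> amp a \<cdot> single u
          = amp a \<cdot> T \<cdot> single u"
        using Ta by (metis blinfun_apply_blinfun_compose)
      then show "(q o\<^sub>L a) \<cdot> u = (a o\<^sub>L q) \<cdot> u" by (simp add: q s)
    qed
  qed
  ultimately show thesis using that M by (auto simp: von_neumann_algebra_def)
qed

lemma amp_commutant:
  assumes M: "von_neumann_algebra M"
  shows "op_algebra (commutant (amp ` M))" "a \<in> commutant (amp ` M) \<Longrightarrow> adj a \<in> commutant (amp ` M)"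
    "a \<in> commutant (amp ` M) \<Longrightarrow> a \<in> bops"
    "a \<in> commutant (amp ` M) \<Longrightarrow> x \<in> M \<Longrightarrow>
       a \<cdot> amp x \<cdot> v = amp x \<cdot> a \<cdot> v"
proof -
  note Mc = von_neumann_closed[OF M] von_neumann_adj[OF M]
  have sub: "amp ` M \<subseteq> bops" using Mc by auto
  show "op_algebra (commutant (amp ` M))" by (rule op_algebra_commutant[OF sub])
  show "a \<in> commutant (amp ` M) \<Longrightarrow> adj a \<in> commutant (amp ` M)"
    by (rule commutant_adj[OF sub]) (use Mc in \<open>auto simp: adj_amp\<close>)
  show "a \<in> commutant (amp ` M) \<Longrightarrow> a \<in> bops" by (simp add: commutant_def)
  show "a \<in> commutant (amp ` M) \<Longrightarrow> x \<in> M \<Longrightarrow>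
       a \<cdot> amp x \<cdot> v = amp x \<cdot> a \<cdot> v"
    unfolding commutant_def using blinfun_apply_blinfun_compose by (metis (mono_tags, lifting) image_eqI mem_Collect_eq)
qed

text \<open>
  The projection \<open>P\<close> onto the closure of the subspace commutes with the commutant, so \<open>P = amp q\<close> with
  \<open>q \<in> M\<close>. As \<open>P\<close> fixes \<open>\<Omega>\<close>, the element \<open>1 - q\<close> annihilates \<open>\<Omega>\<close> and vanishes.
\<close>

lemma separating_imp_cyclic_commutant:
  fixes \<Omega> :: "'h::complex_hilbert l2"
  assumes M: "von_neumann_algebra M" and sep: "\<And>x. x \<in> M \<Longrightarrow> amp x \<cdot> \<Omega> = 0 \<Longrightarrow> x = 0"
  shows "csubspace ((\<lambda>a. a \<cdot> \<Omega>) ` commutant (amp ` M))"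
    and "closure ((\<lambda>a. a \<cdot> \<Omega>) ` commutant (amp ` M)) = UNIV"
proof -
  note C = amp_commutant[OF M] and Cc = op_algebra_closed[OF amp_commutant(1)[OF M]]
  define W where "W = (\<lambda>a. a \<cdot> \<Omega>) ` commutant (amp ` M)"
  have W: "csubspace W"
    unfolding csubspace_def W_def
  proof (intro conjI ballI allI)
    show "0 \<in> (\<lambda>a. a \<cdot> \<Omega>) ` commutant (amp ` M)"
      using Cc by (intro image_eqI[of _ _ 0]) auto
  qed (use Cc in \<open>auto simp flip: blinfun.add_left op_scale_apply intro!: imageI\<close>)
  obtain P where P: "represents_form W cinner P" "\<And>w. w \<in> W \<Longrightarrow> P \<cdot> w = w"
    using orthogonal_projection_exists[OF W] by metis
  have "P \<in> commutant (commutant (amp ` M))"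
    unfolding commutant_def[of "commutant (amp ` M)"]
  proof (intro CollectI conjI ballI)
    show "P \<in> bops" using P by (simp add: represents_form_def)
    fix a assume a: "a \<in> commutant (amp ` M)"
    have inv: "b \<cdot> w \<in> W" if "w \<in> W" "b \<in> commutant (amp ` M)" for w b
    proof -
      obtain d where d: "d \<in> commutant (amp ` M)" "w = d \<cdot> \<Omega>"
        using \<open>w \<in> W\<close> unfolding W_def by blast
      show ?thesis unfolding W_def using d that Cc by (intro image_eqI[of _ _ "b o\<^sub>L d"]) auto
    qed
    show "P o\<^sub>L a = a o\<^sub>L P"
      by (rule represents_form_commute[OF W P(1)]) (use a C inv in \<open>auto simp: cinner_adj_left\<close>)
  qed
  then obtain q where q: "q \<in> M" "P = amp q" using bicommutant_amp[OF M] by blast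
  have "\<Omega> \<in> W" unfolding W_def using Cc by (intro image_eqI[of _ _ id_blinfun]) auto
  then have "amp (id_blinfun - q) \<cdot> \<Omega> = 0"
    using P(2) q by (simp add: amp_simps blinfun.bilinear_simps)
  then have "id_blinfun - q = 0"
    by (rule sep[rotated]) (intro von_neumann_closed[OF M] q)
  then have "P = id_blinfun" using q by (simp add: amp_simps)
  then have "u \<in> closure W" for u
    using P(1) unfolding represents_form_def by (metis blinfun_apply_id_blinfun id_apply)
  then show "csubspace ((\<lambda>a. a \<cdot> \<Omega>) ` commutant (amp ` M))"
    "closure ((\<lambda>a. a \<cdot> \<Omega>) ` commutant (amp ` M)) = UNIV"
    using W unfolding W_def by auto
qed

section \<open>Faithful normal states\<close>

locale von_neumann_state =
  fixes M :: "'h::complex_hilbert op set" and \<phi> :: "'h op \<Rightarrow> complex"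
  assumes M: "von_neumann_algebra M" and state: "faithful_normal_state M \<phi>"
begin

lemmas M_closed = von_neumann_closed[OF M] von_neumann_adj[OF M]

lemma \<phi>_predual: "\<phi> \<in> op_predual M" and \<phi>_id: "\<phi> id_blinfun = 1"
  and \<phi>_faithful: "x \<in> M \<Longrightarrow> \<phi> (adj x o\<^sub>L x) = 0 \<Longrightarrow> x = 0"
  using state by (auto simp: faithful_normal_state_def)

lemma \<phi>_positive: "positive_functional M \<phi>"
  using state M_closed op_predual_linear[of \<phi> M]
  by (auto simp: faithful_normal_state_def positive_functional_def)

lemmas \<phi>_linear = positive_functional_linear[OF M \<phi>_positive]

lemma \<phi>_square: "x \<in> M \<Longrightarrow> \<phi> (adj x o\<^sub>L x) \<in> \<real>\<^sub>\<ge>\<^sub>0"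
  using \<phi>_positive by (simp add: positive_functional_def)

text \<open>
  If \<open>\<phi> x = \<langle>\<xi>, x \<eta>\<rangle>\<close>, then polarisation gives \<open>4 \<phi> (x\<^sup>* x) = \<parallel>x (\<xi> + \<eta>)\<parallel>\<^sup>2 - \<parallel>x (\<xi> - \<eta>)\<parallel>\<^sup>2\<close>.
  The factor \<open>1\<close> in the conclusion is the constant of domination in \<open>Radon_Nikodym\<close>.
\<close>

lemma \<phi>_dominated:
  obtains \<zeta> where "\<And>x. x \<in> M \<Longrightarrow> Re (\<phi> (adj x o\<^sub>L x)) \<le> 1 * (norm (amp x \<cdot> \<zeta>))\<^sup>2"
proof -
  obtain \<xi> \<eta> where f: "\<And>x. x \<in> M \<Longrightarrow> \<phi> x = cinner \<xi> (amp x \<cdot> \<eta>)"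
    using \<phi>_predual unfolding op_predual_iff by metis
  show thesis
  proof (rule that[of "\<xi> + \<eta>"])
    fix x assume x: "x \<in> M"
    let ?a = "amp x \<cdot> \<xi>" and ?b = "amp x \<cdot> \<eta>"
    have "\<phi> (adj x o\<^sub>L x) = cinner ?a ?b"
      using x M_closed by (simp add: f amp_simps adj_amp[symmetric] cinner_adj_right)
    moreover have "4 * Re (cinner ?a ?b) = (norm (?a + ?b))\<^sup>2 - (norm (?a - ?b))\<^sup>2"
      using norm_add_sq[of ?a ?b] norm_add_sq[of ?a "- ?b"] by simp
    moreover have "amp x \<cdot> (\<xi> + \<eta>) = ?a + ?b" by (simp add: blinfun.add_right)
    ultimately show "Re (\<phi> (adj x o\<^sub>L x)) \<le> 1 * (norm (amp x \<cdot> (\<xi> + \<eta>)))\<^sup>2"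
      by (smt (verit) zero_le_power2)
  qed
qed

text \<open>
  Write \<open>\<phi> x = \<langle>\<zeta>, h (x \<zeta>)\<rangle>\<close> with \<open>0 \<le> h \<le> 1\<close> in the commutant, and take \<open>\<Omega> = h \<zeta>\<close>. For \<open>v = x \<zeta>\<close> one has
  \<open>\<parallel>x \<Omega>\<parallel>\<^sup>2 = \<parallel>h v\<parallel>\<^sup>2 \<le> \<langle>v, h v\<rangle> = \<phi> (x\<^sup>* x)\<close>. If \<open>h v = 0\<close>, then \<open>\<phi> (x\<^sup>* x) = 0\<close>, and \<open>\<phi>\<close> is faithful.
\<close>

lemma separating_vector:
  obtains \<Omega> where "\<And>x. x \<in> M \<Longrightarrow> (norm (amp x \<cdot> \<Omega>))\<^sup>2 \<le> Re (\<phi> (adj x o\<^sub>L x))"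
    "\<And>x. x \<in> M \<Longrightarrow> amp x \<cdot> \<Omega> = 0 \<Longrightarrow> x = 0"
proof -
  obtain \<zeta> where \<zeta>: "\<And>x. x \<in> M \<Longrightarrow> Re (\<phi> (adj x o\<^sub>L x)) \<le> 1 * (norm (amp x \<cdot> \<zeta>))\<^sup>2"
    using \<phi>_dominated by blast
  obtain h where h: "h \<in> commutant (amp ` M)" "positive_op h" "positive_op (1 *\<^sub>R id_blinfun - h)"
    "\<And>x. x \<in> M \<Longrightarrow> \<phi> x = cinner \<zeta> (h \<cdot> amp x \<cdot> \<zeta>)"
    using Radon_Nikodym[OF M \<phi>_positive \<zeta>] by (metis zero_le_one)
  note C = amp_commutant[OF M]
  have hb: "h \<in> bops" using h C by blast
  have n1: "norm h \<le> 1" using h hb by (intro positive_contraction) auto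
  have hv: "amp x \<cdot> h \<cdot> \<zeta> = h \<cdot> amp x \<cdot> \<zeta>"
    if "x \<in> M" for x using C(4)[OF h(1) that] by simp
  have sq: "\<phi> (adj x o\<^sub>L x) = cinner (amp x \<cdot> \<zeta>) (h \<cdot> amp x \<cdot> \<zeta>)"
    if x: "x \<in> M" for x
  proof -
    have "\<phi> (adj x o\<^sub>L x) = cinner \<zeta> (h \<cdot> amp (adj x) \<cdot> amp x \<cdot> \<zeta>)"
      using x M_closed by (simp add: h(4) amp_simps)
    also have "\<dots> = cinner \<zeta> (adj (amp x) \<cdot> h \<cdot> amp x \<cdot> \<zeta>)"
      using C(4)[OF h(1)] x M_closed by (simp add: adj_amp)
    finally show ?thesis using x M_closed by (simp add: cinner_adj_right)
  qed
  show thesis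
  proof (rule that[of "h \<cdot> \<zeta>"])
    fix x assume x: "x \<in> M"
    define v where "v = amp x \<cdot> \<zeta>"
    have "(cmod (cinner (h \<cdot> v) (h \<cdot> v)))\<^sup>2
        \<le> Re (cinner (h \<cdot> v) (h \<cdot> h \<cdot> v)) * Re (cinner v (h \<cdot> v))"
      by (rule positive_op_Cauchy_Schwarz[OF h(2) hb])
    also have "\<dots> \<le> (norm (h \<cdot> v))\<^sup>2 * Re (cinner v (h \<cdot> v))"
    proof (rule mult_right_mono)
      have "Re (cinner (h \<cdot> v) (h \<cdot> h \<cdot> v))
          \<le> norm h * norm (h \<cdot> v) * norm (h \<cdot> v)"
        using complex_Re_le_cmod Cauchy_Schwarz_blinfun order_trans by blast
      also have "\<dots> \<le> 1 * norm (h \<cdot> v) * norm (h \<cdot> v)"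
        using n1 by (intro mult_right_mono) auto
      finally show "Re (cinner (h \<cdot> v) (h \<cdot> h \<cdot> v))
          \<le> (norm (h \<cdot> v))\<^sup>2" by (simp add: power2_eq_square)
      show "0 \<le> Re (cinner v (h \<cdot> v))"
        using h(2) by (simp add: positive_op_def complex_nonneg_Reals_iff)
    qed
    finally have sq_le: "(norm (h \<cdot> v))\<^sup>2 * (norm (h \<cdot> v))\<^sup>2
        \<le> (norm (h \<cdot> v))\<^sup>2 * Re (cinner v (h \<cdot> v))"
      unfolding cinner_self norm_of_real by (simp add: power2_eq_square)
    have "(norm (h \<cdot> v))\<^sup>2 \<le> Re (cinner v (h \<cdot> v))"
    proof (cases "h \<cdot> v = 0")
      case False
      then have "0 < (norm (h \<cdot> v))\<^sup>2" by simp
      then show ?thesis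
        using sq_le by (rule mult_left_le_imp_le[rotated])
    qed (use h(2) in \<open>auto simp: positive_op_def complex_nonneg_Reals_iff\<close>)
    then show "(norm (amp x \<cdot> h \<cdot> \<zeta>))\<^sup>2 \<le> Re (\<phi> (adj x o\<^sub>L x))"
      using x by (simp add: hv sq v_def)
    assume "amp x \<cdot> h \<cdot> \<zeta> = 0"
    then have "\<phi> (adj x o\<^sub>L x) = 0" using x by (simp add: hv sq)
    then show "x = 0" by (rule \<phi>_faithful[OF x])
  qed
qed

end

section \<open>Normality of state-preserving expectations\<close>

lemma positive_op_amp: assumes "positive_op p" shows "positive_op (amp p)"
  unfolding positive_op_def
proof
  fix v
  have "(\<lambda>n. \<Sum>k<n. cinner (l2_nth v k) (l2_nth (amp p \<cdot> v) k))
      \<longlonglongrightarrow> cinner v (amp p \<cdot> v)"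
    using cinner_l2_sums unfolding sums_def .
  moreover have "(\<Sum>k<n. cinner (l2_nth v k) (l2_nth (amp p \<cdot> v) k)) \<in> \<real>\<^sub>\<ge>\<^sub>0" for n
    using assms by (induction n) (auto simp: positive_op_def intro!: nonneg_Reals_add_I)
  ultimately show "cinner v (amp p \<cdot> v) \<in> \<real>\<^sub>\<ge>\<^sub>0" by (rule nonneg_Reals_limit)
qed

lemma vn_simps [simp]:
  "oa_carrier (vn A) = A" "oa_scale (vn A) = op_scale" "oa_one (vn A) = id_blinfun"
  "oa_predual (vn A) = op_predual A"
  "a \<in> oa_pos (vn A) k \<longleftrightarrow> (\<forall>i<k. \<forall>j<k. a i j \<in> A) \<and>
     (\<forall>\<xi>. (\<Sum>i<k. \<Sum>j<k. cinner (\<xi> i) (a i j \<cdot> \<xi> j)) \<in> \<real>\<^sub>\<ge>\<^sub>0)"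
  by (auto simp: vn_def)

lemma ucp_positive:
  assumes "ucp (vn A) (vn B) F" "p \<in> A" "positive_op p" shows "positive_op (F p)"
proof -
  have "(\<lambda>i j. p) \<in> oa_pos (vn A) 1" using assms by (simp add: positive_op_def)
  moreover have "\<forall>a\<in>oa_pos (vn A) 1. (\<lambda>i j. F (a i j)) \<in> oa_pos (vn B) 1"
    using assms(1) unfolding ucp_def by blast
  ultimately have "(\<lambda>i j. F p) \<in> oa_pos (vn B) 1" by (rule bspec[rotated])
  then have *: "\<And>\<xi>. (\<Sum>i<(1::nat). \<Sum>j<(1::nat). cinner (\<xi> i) (F p \<cdot> \<xi> j)) \<in> \<real>\<^sub>\<ge>\<^sub>0" by simp
  show ?thesis unfolding positive_op_def using *[of "\<lambda>_. u" for u] by simp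
qed

lemma positive_op_square: "x \<in> bops \<Longrightarrow> positive_op (adj x o\<^sub>L x)"
  by (simp add: positive_op_def cinner_adj_right)

locale expected_subalgebra = von_neumann_state M \<phi>
  for M :: "'a::complex_hilbert op set" and \<phi> +
  fixes N :: "'a op set" and E :: "'a op \<Rightarrow> 'a op"
  assumes N: "von_neumann_algebra N" and NM: "N \<subseteq> M" and E: "preserving_expectation M \<phi> N E"
begin

lemmas N_closed = von_neumann_closed[OF N] von_neumann_adj[OF N]

lemma in_M: "x \<in> N \<Longrightarrow> x \<in> M" using NM by blast

lemma E_ucp: "ucp (vn M) (vn N) E"
  using E by (simp add: preserving_expectation_def conditional_expectation_def)

lemma
  shows E_in: "x \<in> M \<Longrightarrow> E x \<in> N"
    and E_add: "x \<in> M \<Longrightarrow> y \<in> M \<Longrightarrow> E (x + y) = E x + E y"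
    and E_scale: "x \<in> M \<Longrightarrow> E (op_scale c x) = op_scale c (E x)"
    and E_id: "E id_blinfun = id_blinfun"
    and E_fix: "x \<in> N \<Longrightarrow> E x = x"
    and \<phi>_E: "x \<in> M \<Longrightarrow> \<phi> (E x) = \<phi> x"
  using E by (auto simp: preserving_expectation_def conditional_expectation_def ucp_def linear_map_def)

lemma E_left: assumes "a \<in> N" "x \<in> M" shows "E (a o\<^sub>L x) = a o\<^sub>L E x"
proof -
  have "E (a o\<^sub>L x o\<^sub>L id_blinfun) = a o\<^sub>L E x o\<^sub>L id_blinfun"
    using E assms N_closed(2) by (simp add: preserving_expectation_def conditional_expectation_def)
  then show ?thesis by (simp add: comp_simps)
qed

lemma E_diff: "x \<in> M \<Longrightarrow> y \<in> M \<Longrightarrow> E (x - y) = E x - E y"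
  using E_add[of "x - y" y] M_closed by simp

lemma E_positive: "p \<in> M \<Longrightarrow> positive_op p \<Longrightarrow> positive_op (E p)"
  by (rule ucp_positive[OF E_ucp])

text \<open>
  For \<open>u = a \<Omega>\<close> with \<open>a\<close> in the commutant, \<open>\<parallel>y u\<parallel>\<^sup>2 \<le> \<parallel>a\<parallel>\<^sup>2 \<phi> (y\<^sup>* y)\<close>. Since \<open>E\<close> preserves \<open>\<phi>\<close>, this dominates the
  functional on \<open>M\<close> by a multiple of \<open>\<langle>\<zeta>, x \<zeta>\<rangle>\<close>, and \<open>Radon_Nikodym\<close> applies. Expanding the resulting operator into
  squares \<open>s\<^sub>k\<^sup>2\<close> gives the sum of the functionals \<open>\<langle>s\<^sub>k \<zeta>, x (s\<^sub>k \<zeta>)\<rangle>\<close>; the norm of \<open>\<psi>\<close> is read off at \<open>x = 1\<close>.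
\<close>

lemma expected_vector_functional:
  fixes \<Omega> \<zeta> :: "'a l2"
  assumes \<Omega>: "\<And>x. x \<in> M \<Longrightarrow> (norm (amp x \<cdot> \<Omega>))\<^sup>2 \<le> Re (\<phi> (adj x o\<^sub>L x))"
    and \<zeta>: "\<And>x. x \<in> M \<Longrightarrow> Re (\<phi> (adj x o\<^sub>L x)) \<le> 1 * (norm (amp x \<cdot> \<zeta>))\<^sup>2"
    and a: "a \<in> commutant (amp ` M)"
  defines "u \<equiv> a \<cdot> \<Omega>"
  obtains \<psi> where "norm \<psi> = norm u"
    "\<And>x. x \<in> M \<Longrightarrow> cinner u (amp (E x) \<cdot> u) = cinner \<psi> (amp x \<cdot> \<psi>)"
proof -
  note C = amp_commutant[OF M]
  define c where "c = (norm a)\<^sup>2"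
  have c: "c \<ge> 0" by (simp add: c_def)
  define g where "g x = cinner u (amp (E x) \<cdot> u)" for x
  \<comment> \<open>The domination on squares in N extends to all positive elements of N, such as the image of a square under E.\<close>
  have dom_N: "of_real c * \<phi> p - cinner u (amp p \<cdot> u) \<in> \<real>\<^sub>\<ge>\<^sub>0"
    if p: "p \<in> N" "positive_op p" for p
  proof -
    let ?f = "\<lambda>y. of_real c * \<phi> y + (- 1) * cinner u (amp y \<cdot> u)"
    have "(\<lambda>y. cinner u (amp y \<cdot> u)) \<in> op_predual N" unfolding op_predual_iff by blast
    then have f: "?f \<in> op_predual N"
      by (intro op_predual_add op_predual_scale op_predual_mono[OF NM \<phi>_predual])
    obtain K where K: "\<And>x. x \<in> N \<Longrightarrow> cmod (?f x) \<le> K * norm x" using op_predual_bounded[OF f] by metis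
    have "?f p \<in> \<real>\<^sub>\<ge>\<^sub>0"
    proof (rule functional_nonneg_on_positive[OF von_neumann_op_algebra[OF N] _ K _ p])
      show "?f (x + y) = ?f x + ?f y" if "x \<in> N" "y \<in> N" for x y
        using op_predual_linear(1)[OF f that] N_closed that by blast
      fix x assume x: "x \<in> N" "adj x = x"
      have xM: "x \<in> M" using x in_M by blast
      have "cinner u (amp (x o\<^sub>L x) \<cdot> u) = of_real ((norm (amp x \<cdot> u))\<^sup>2)"
        using x N_closed(1)[OF x(1)] cinner_adj_left[of "amp x" u "amp x \<cdot> u"]
        by (simp only: cinner_self[symmetric]) (simp add: amp_simps adj_amp)
      moreover have "(norm (amp x \<cdot> u))\<^sup>2 \<le> c * Re (\<phi> (x o\<^sub>L x))"
      proof -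
        have "norm (amp x \<cdot> u) = norm (a \<cdot> amp x \<cdot> \<Omega>)"
          unfolding u_def using C(4)[OF a xM] by simp
        also have "\<dots> \<le> norm a * norm (amp x \<cdot> \<Omega>)" by (rule norm_blinfun)
        finally have "(norm (amp x \<cdot> u))\<^sup>2 \<le> (norm a * norm (amp x \<cdot> \<Omega>))\<^sup>2"
          by (intro power_mono) auto
        also have "\<dots> \<le> c * Re (\<phi> (x o\<^sub>L x))"
          unfolding power_mult_distrib c_def using \<Omega>[OF xM] x by (intro mult_left_mono) auto
        finally show ?thesis .
      qed
      ultimately show "?f (x o\<^sub>L x) \<in> \<real>\<^sub>\<ge>\<^sub>0"
        using \<phi>_square[OF xM] x by (simp add: complex_nonneg_Reals_iff)
    qed
    then show ?thesis by simp
  qed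
  have g_pos: "positive_functional M g"
    unfolding positive_functional_def
  proof (intro conjI ballI allI)
    fix x assume x: "x \<in> M"
    show "g (x + y) = g x + g y" if "y \<in> M" for y
      using x that by (simp add: g_def E_add amp_simps blinfun.bilinear_simps cinner_linear)
    show "g (op_scale k x) = k * g x" for k
      using x by (simp add: g_def E_scale amp_simps cinner_linear)
    have "positive_op (E (adj x o\<^sub>L x))" using x M_closed by (intro E_positive positive_op_square) auto
    then show "g (adj x o\<^sub>L x) \<in> \<real>\<^sub>\<ge>\<^sub>0" unfolding g_def using positive_op_amp by (auto simp: positive_op_def)
  qed
  have g_dom: "Re (g (adj x o\<^sub>L x)) \<le> c * (norm (amp x \<cdot> \<zeta>))\<^sup>2" if x: "x \<in> M" for x
  proof -
    have xx: "adj x o\<^sub>L x \<in> M" "x \<in> bops" using x M_closed by auto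
    have "Re (g (adj x o\<^sub>L x)) \<le> c * Re (\<phi> (E (adj x o\<^sub>L x)))"
      using dom_N[OF E_in[OF xx(1)] E_positive[OF xx(1) positive_op_square[OF xx(2)]]]
      by (simp add: g_def complex_nonneg_Reals_iff)
    also have "\<dots> \<le> c * (norm (amp x \<cdot> \<zeta>))\<^sup>2"
      using \<zeta>[OF x] c by (simp add: \<phi>_E[OF xx(1)] mult_left_mono)
    finally show ?thesis .
  qed
  obtain h where h: "h \<in> commutant (amp ` M)" "positive_op h"
    "\<And>x. x \<in> M \<Longrightarrow> g x = cinner \<zeta> (h \<cdot> amp x \<cdot> \<zeta>)"
    using Radon_Nikodym[OF M g_pos g_dom c] by metis
  obtain s where s: "\<And>k. s k \<in> commutant (amp ` M)" "\<And>k. adj (s k) = s k" "\<And>k. s k \<in> bops"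
    "(\<lambda>n. \<Sum>k<n. s k o\<^sub>L s k) \<longlonglongrightarrow> h"
    by (rule positive_op_limit_of_squares[OF C(1) h(1,2)], rule that)
  define \<zeta>' where "\<zeta>' k = s k \<cdot> \<zeta>" for k
  have sums: "(\<lambda>k. cinner (\<zeta>' k) (amp x \<cdot> \<zeta>' k)) sums g x" if x: "x \<in> M" for x
  proof -
    have "(\<lambda>n. cinner \<zeta> ((\<Sum>k<n. s k o\<^sub>L s k) \<cdot> amp x \<cdot> \<zeta>)) \<longlonglongrightarrow> g x"
      unfolding h(3)[OF x] by (intro tendsto_cinner blinfun.tendsto tendsto_const s(4))
    moreover have "cinner \<zeta> ((\<Sum>k<n. s k o\<^sub>L s k) \<cdot> amp x \<cdot> \<zeta>)
        = (\<Sum>k<n. cinner (\<zeta>' k) (amp x \<cdot> \<zeta>' k))" for n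
      unfolding blinfun.sum_left cinner_sum_right \<zeta>'_def
      using cinner_adj_left[OF s(3)] s(2) C(4)[OF s(1) x] by (intro sum.cong) auto
    ultimately show ?thesis by (simp add: sums_def)
  qed
  have "(\<lambda>k. complex_of_real ((norm (\<zeta>' k))\<^sup>2)) sums of_real ((norm u)\<^sup>2)"
    using sums[OF M_closed(2)] by (simp add: g_def E_id amp_simps cinner_self)
  then have nsums: "(\<lambda>k. (norm (\<zeta>' k))\<^sup>2) sums (norm u)\<^sup>2" by (simp only: sums_of_real_iff)
  note sm = sums_summable[OF nsums]
  show thesis
  proof
    have "(norm (flatten \<zeta>'))\<^sup>2 = (norm u)\<^sup>2" by (rule norm_flatten[OF nsums])
    then show "norm (flatten \<zeta>') = norm u" by simp
    fix x assume x: "x \<in> M"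
    show "cinner u (amp (E x) \<cdot> u) = cinner (flatten \<zeta>') (amp x \<cdot> flatten \<zeta>')"
      using sums_unique2[OF sums[OF x]] cinner_flatten_sums[OF sm summable_sq_blinfun[OF sm, of "amp x"]]
      unfolding amp_flatten[OF sm] g_def by blast
  qed
qed

text \<open>
  Let \<open>r\<^sub>n\<close> tend to \<open>\<eta>\<close> within the dense subspace of the preceding lemma. A limit of functionals of
  the form \<open>\<langle>\<psi>, x \<psi>\<rangle>\<close> need not come with a limit of the vectors \<open>\<psi>\<close>. Instead, each difference of
  consecutive functionals \<open>\<langle>r\<^sub>n, E x r\<^sub>n\<rangle>\<close> is written as \<open>(\<langle>p, E x p\<rangle> - \<langle>m, E x m\<rangle>) / 4\<close> with
  \<open>p, m = 2\<^sup>-\<^sup>n s \<plusminus> 2\<^sup>n d\<close>, where \<open>s\<close> and \<open>d\<close> are the sum and the difference of consecutive \<open>r\<^sub>n\<close>. The weights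
  balance the bounded \<open>s\<close> against the small \<open>d\<close>, so that the squared norms of \<open>p\<close> and \<open>m\<close> are
  summable. The preceding lemma replaces \<open>p\<close> and \<open>m\<close> by vectors of the same norm, and the two series of vector
  functionals on \<open>M\<close> can be flattened.
\<close>

lemma expected_vector_functional_normal:
  fixes \<eta> :: "'a l2"
  shows "(\<lambda>x. cinner \<eta> (amp (E x) \<cdot> \<eta>)) \<in> op_predual M"
proof -
  obtain \<zeta> where \<zeta>: "\<And>x. x \<in> M \<Longrightarrow> Re (\<phi> (adj x o\<^sub>L x)) \<le> 1 * (norm (amp x \<cdot> \<zeta>))\<^sup>2"
    using \<phi>_dominated by blast
  obtain \<Omega> where \<Omega>: "\<And>x. x \<in> M \<Longrightarrow> (norm (amp x \<cdot> \<Omega>))\<^sup>2 \<le> Re (\<phi> (adj x o\<^sub>L x))"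
    "\<And>x. x \<in> M \<Longrightarrow> amp x \<cdot> \<Omega> = 0 \<Longrightarrow> x = 0"
    using separating_vector by blast
  define D where "D = (\<lambda>a. a \<cdot> \<Omega>) ` commutant (amp ` M)"
  have D: "csubspace D" "closure D = UNIV"
    using separating_imp_cyclic_commutant[OF M \<Omega>(2)] by (auto simp: D_def)
  have "\<exists>\<psi>. u \<in> D \<longrightarrow> norm \<psi> = norm u \<and>
    (\<forall>x\<in>M. cinner u (amp (E x) \<cdot> u) = cinner \<psi> (amp x \<cdot> \<psi>))" for u
  proof (cases "u \<in> D")
    case True
    then obtain a where a: "a \<in> commutant (amp ` M)" "u = a \<cdot> \<Omega>" unfolding D_def by blast
    show ?thesis unfolding a(2) by (rule expected_vector_functional[OF \<Omega>(1) \<zeta> a(1)]) auto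
  qed simp
  then obtain \<psi> where \<psi>: "\<And>u. u \<in> D \<Longrightarrow> norm (\<psi> u) = norm u"
    "\<And>u x. u \<in> D \<Longrightarrow> x \<in> M \<Longrightarrow>
       cinner u (amp (E x) \<cdot> u) = cinner (\<psi> u) (amp x \<cdot> \<psi> u)"
    by metis
  have "\<exists>d\<in>D. dist d \<eta> < (1/4) ^ n" for n :: nat
    using D(2) closure_approachable[of \<eta> D] by simp
  then obtain r where r: "\<And>n. r n \<in> D" "\<And>n. dist (r n) \<eta> < (1/4) ^ n" by metis
  define s where "s n = r (Suc n) + r n" for n
  define d where "d n = r (Suc n) - r n" for n
  define S where "S = 2 * norm \<eta> + 2"
  have dist_r: "norm (r n - \<eta>) \<le> (1/4) ^ n" for n using r(2)[of n] by (simp add: dist_norm)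
  have norm_s: "norm (s n) \<le> S" for n
  proof -
    have "norm (r n - \<eta>) \<le> 1" "norm (r (Suc n) - \<eta>) \<le> 1"
      using dist_r power_le_one[of "1/4::real"] by (meson order_trans zero_le_divide_1_iff zero_le_numeral divide_le_eq_1_pos zero_less_numeral one_le_numeral)+
    moreover have "s n = (r (Suc n) - \<eta>) + (r n - \<eta>) + 2 *\<^sub>R \<eta>" by (simp add: s_def scaleR_2)
    ultimately show ?thesis
      unfolding S_def using norm_triangle_ineq[of "(r (Suc n) - \<eta>) + (r n - \<eta>)" "2 *\<^sub>R \<eta>"]
        norm_triangle_ineq[of "r (Suc n) - \<eta>" "r n - \<eta>"] by simp
  qed
  have norm_d: "norm (d n) \<le> 2 * (1/4) ^ n" for n
  proof -
    have "d n = (r (Suc n) - \<eta>) - (r n - \<eta>)" by (simp add: d_def)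
    then have "norm (d n) \<le> norm (r (Suc n) - \<eta>) + norm (r n - \<eta>)" by (simp only: norm_triangle_ineq4)
    also have "\<dots> \<le> (1/4) ^ Suc n + (1/4) ^ n" by (intro add_mono dist_r)
    also have "\<dots> \<le> 2 * (1/4) ^ n" by simp
    finally show ?thesis .
  qed
  \<comment> \<open>The rate (1/4)^n of the approximation pays for the weight 2^n, whose square is 4^n.\<close>
  have summable_pm: "summable (\<lambda>n. (norm (((1/2) ^ n) *\<^sub>R s n + (e * 2 ^ n) *\<^sub>R d n))\<^sup>2)" if e: "\<bar>e\<bar> = 1" for e
  proof (rule summable_comparison_test'[where N = 0])
    show "summable (\<lambda>n. (2 * S\<^sup>2 + 8) * (1/4::real) ^ n)" by (intro summable_mult summable_geometric) simp
    fix n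
    have "(norm (((1/2) ^ n) *\<^sub>R s n + (e * 2 ^ n) *\<^sub>R d n))\<^sup>2
        \<le> 2 * (norm (((1/2) ^ n) *\<^sub>R s n))\<^sup>2 + 2 * (norm ((e * 2 ^ n) *\<^sub>R d n))\<^sup>2"
      by (rule norm_sq_add_le)
    also have "\<dots> = 2 * ((1/4) ^ n * (norm (s n))\<^sup>2) + 2 * (4 ^ n * (norm (d n))\<^sup>2)"
      using e by (simp add: power_mult_distrib abs_mult power_mult[symmetric] mult.commute[of _ 2])
        (simp add: power_mult power2_eq_square)
    also have "\<dots> \<le> 2 * ((1/4) ^ n * S\<^sup>2) + 2 * (4 ^ n * (2 * (1/4) ^ n)\<^sup>2)"
      by (intro add_mono mult_left_mono power_mono norm_s norm_d) auto
    also have "\<dots> = (2 * S\<^sup>2 + 8) * (1/4) ^ n"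
      by (simp add: power_mult_distrib power_divide power2_eq_square field_simps)
    finally show "norm ((norm (((1/2) ^ n) *\<^sub>R s n + (e * 2 ^ n) *\<^sub>R d n))\<^sup>2) \<le> (2 * S\<^sup>2 + 8) * (1/4) ^ n"
      by simp
  qed
  define p where "p n = ((1/2) ^ n) *\<^sub>R s n + (1 * 2 ^ n) *\<^sub>R d n" for n
  define m where "m n = ((1/2) ^ n) *\<^sub>R s n + (-1 * 2 ^ n) *\<^sub>R d n" for n
  have pm: "p n \<in> D" "m n \<in> D" for n
    unfolding p_def m_def s_def d_def by (intro csubspaceD[OF D(1)] r)+
  have sp: "summable (\<lambda>n. (norm (\<psi> (p n)))\<^sup>2)" and sm: "summable (\<lambda>n. (norm (\<psi> (m n)))\<^sup>2)"
    using summable_pm[of 1] summable_pm[of "-1"] by (simp_all only: \<psi> pm) (simp_all add: p_def m_def)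
  let ?w = "\<lambda>v x. cinner v (amp x \<cdot> v)"
  let ?F = "?w (flatten (\<lambda>n. \<psi> (p n)))" and ?G = "?w (flatten (\<lambda>n. \<psi> (m n)))"
  have "(\<lambda>x. ?w (\<psi> (r 0)) x + ((1/4) * ?F x + (-1/4) * ?G x)) \<in> op_predual M"
    by (intro op_predual_add op_predual_scale) (auto simp: op_predual_iff)
  moreover have "?w \<eta> (E x) = ?w (\<psi> (r 0)) x + ((1/4) * ?F x + (-1/4) * ?G x)" if x: "x \<in> M" for x
  proof -
    have "(\<lambda>n. ?w (\<psi> (p n)) x) sums ?F x" "(\<lambda>n. ?w (\<psi> (m n)) x) sums ?G x"
      using cinner_flatten_sums[OF sp summable_sq_blinfun[OF sp, of "amp x"]]
        cinner_flatten_sums[OF sm summable_sq_blinfun[OF sm, of "amp x"]]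
      by (simp_all add: amp_flatten[OF sp] amp_flatten[OF sm])
    then have "(\<lambda>n. (1/4) * ?w (p n) (E x) + (-1/4) * ?w (m n) (E x)) sums ((1/4) * ?F x + (-1/4) * ?G x)"
      using x pm by (intro sums_add sums_mult) (simp_all add: \<psi>)
    moreover have "(1/4) * ?w (p n) (E x) + (-1/4) * ?w (m n) (E x) = ?w (r (Suc n)) (E x) - ?w (r n) (E x)" for n
    proof -
      have "cinner (t *\<^sub>R a + (1 * t') *\<^sub>R b) (T \<cdot> (t *\<^sub>R a + (1 * t') *\<^sub>R b))
        - cinner (t *\<^sub>R a + (-1 * t') *\<^sub>R b) (T \<cdot> (t *\<^sub>R a + (-1 * t') *\<^sub>R b))
        = 2 * of_real (t * t') * (cinner a (T \<cdot> b) + cinner b (T \<cdot> a))"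
        for t t' :: real and a b :: "'a l2" and T
        by (simp add: blinfun.bilinear_simps cinner_linear cinner_scaleR_left cinner_scaleR_right algebra_simps)
      from this[of "(1/2) ^ n" "s n" "2 ^ n" "d n" "amp (E x)"]
      have "?w (p n) (E x) - ?w (m n) (E x)
          = 2 * (cinner (s n) (amp (E x) \<cdot> d n) + cinner (d n) (amp (E x) \<cdot> s n))"
        by (simp add: p_def m_def power_mult_distrib[symmetric])
      also have "\<dots> = 4 * (?w (r (Suc n)) (E x) - ?w (r n) (E x))"
        by (simp add: s_def d_def blinfun.bilinear_simps cinner_linear algebra_simps)
      finally show ?thesis by (simp add: field_simps)
    qed
    moreover have "(\<lambda>n. ?w (r (Suc n)) (E x) - ?w (r n) (E x)) sums (?w \<eta> (E x) - ?w (r 0) (E x))"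
    proof (rule telescope_sums)
      have "r \<longlonglongrightarrow> \<eta>"
      proof (rule Lim_transform_bound[OF _ LIMSEQ_power_zero, THEN LIM_zero_cancel])
        show "\<forall>\<^sub>F n in sequentially. norm (r n - \<eta>) \<le> norm ((1/4::real) ^ n)" using dist_r by simp
      qed simp
      then show "(\<lambda>n. ?w (r n) (E x)) \<longlonglongrightarrow> ?w \<eta> (E x)"
        by (intro tendsto_cinner blinfun.tendsto tendsto_const)
    qed
    ultimately have "(1/4) * ?F x + (-1/4) * ?G x = ?w \<eta> (E x) - ?w (r 0) (E x)"
      using sums_unique2 by (simp only:) blast
    then show ?thesis using \<psi>(2)[OF r(1) x] by simp
  qed
  ultimately show ?thesis by (rule op_predual_cong)
qed

text \<open>
  Polarisation over the fourth roots of unity reduces to vector functionals.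
\<close>

theorem expectation_normal: assumes f: "f \<in> op_predual N" shows "(\<lambda>x. f (E x)) \<in> op_predual M"
proof -
  obtain \<alpha> \<beta> where f: "\<And>x. x \<in> N \<Longrightarrow> f x = cinner \<alpha> (amp x \<cdot> \<beta>)"
    using assms unfolding op_predual_iff by metis
  let ?w = "\<lambda>c x. cinner (\<alpha> + c *\<^sub>C \<beta>) (amp (E x) \<cdot> (\<alpha> + c *\<^sub>C \<beta>))"
  have "(\<lambda>x. (1/4) * ?w 1 x + ((-1/4) * ?w (-1) x + ((-\<i>/4) * ?w \<i> x + (\<i>/4) * ?w (-\<i>) x))) \<in> op_predual M"
    by (intro op_predual_add op_predual_scale expected_vector_functional_normal)
  then show ?thesis
  proof (rule op_predual_cong)
    fix x assume x: "x \<in> M"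
    then have "amp (E x) \<in> bops" using E_in N_closed(1) amp_bops by blast
    then show "f (E x) = (1/4) * ?w 1 x + ((-1/4) * ?w (-1) x + ((-\<i>/4) * ?w \<i> x + (\<i>/4) * ?w (-\<i>) x))"
      unfolding f[OF E_in[OF x]]
      by (simp add: blinfun.bilinear_simps bops_scaleC cinner_linear algebra_simps)
  qed
qed

end

section \<open>Complete contractivity\<close>

definition matrix_bounded :: "nat \<Rightarrow> (nat \<Rightarrow> nat \<Rightarrow> 'h::complex_hilbert op) \<Rightarrow> real \<Rightarrow> bool" where
  "matrix_bounded n a c \<longleftrightarrow>
     (\<forall>\<xi>. (\<Sum>i<n. (norm (\<Sum>j<n. a i j \<cdot> \<xi> j))\<^sup>2) \<le> c\<^sup>2 * (\<Sum>j<n. (norm (\<xi> j))\<^sup>2))"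

lemma op_matrix_norm_bdd:
  fixes a :: "nat \<Rightarrow> nat \<Rightarrow> 'h::complex_hilbert op"
  shows "bdd_above {sqrt (\<Sum>i<n. (norm (\<Sum>j<n. a i j \<cdot> \<xi> j))\<^sup>2) | \<xi>.
     (\<Sum>j<n. (norm (\<xi> j))\<^sup>2) \<le> (1::real)}"
proof (rule bdd_aboveI, clarify)
  fix \<xi> :: "nat \<Rightarrow> 'h" assume \<xi>: "(\<Sum>j<n. (norm (\<xi> j))\<^sup>2) \<le> 1"
  have n1: "norm (\<xi> j) \<le> 1" if "j < n" for j
  proof -
    have "(norm (\<xi> j))\<^sup>2 \<le> (\<Sum>j<n. (norm (\<xi> j))\<^sup>2)" using that by (intro member_le_sum) auto
    then show ?thesis using \<xi> by (simp add: power2_le_imp_le[of _ 1])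
  qed
  show "sqrt (\<Sum>i<n. (norm (\<Sum>j<n. a i j \<cdot> \<xi> j))\<^sup>2)
      \<le> sqrt (\<Sum>i<n. (\<Sum>j<n. norm (a i j))\<^sup>2)"
  proof (intro real_sqrt_le_mono sum_mono power_mono)
    fix i
    show "norm (\<Sum>j<n. a i j \<cdot> \<xi> j) \<le> (\<Sum>j<n. norm (a i j))"
    proof (rule sum_norm_le)
      fix j assume "j \<in> {..<n}"
      then have "norm (a i j) * norm (\<xi> j) \<le> norm (a i j) * 1" by (intro mult_left_mono n1) auto
      then show "norm (a i j \<cdot> \<xi> j) \<le> norm (a i j)"
        using norm_blinfun[of "a i j" "\<xi> j"] by linarith
    qed
  qed auto
qed

lemma op_matrix_norm_nonneg: "0 \<le> op_matrix_norm n a"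
proof -
  have "0 \<in> {sqrt (\<Sum>i<n. (norm (\<Sum>j<n. a i j \<cdot> \<xi> j))\<^sup>2) | \<xi>.
     (\<Sum>j<n. (norm (\<xi> j))\<^sup>2) \<le> (1::real)}"
    by (rule CollectI, rule exI[of _ "\<lambda>_. 0"]) simp
  then show ?thesis unfolding op_matrix_norm_def by (rule cSup_upper) (rule op_matrix_norm_bdd)
qed

lemma op_matrix_norm_leI:
  assumes "matrix_bounded n a c" "c \<ge> 0" shows "op_matrix_norm n a \<le> c"
  unfolding op_matrix_norm_def
proof (rule cSup_least)
  show "{sqrt (\<Sum>i<n. (norm (\<Sum>j<n. a i j \<cdot> \<xi> j))\<^sup>2) | \<xi>.
     (\<Sum>j<n. (norm (\<xi> j))\<^sup>2) \<le> (1::real)} \<noteq> {}" by (auto intro!: exI[of _ "\<lambda>_. 0"])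
  fix r assume "r \<in> {sqrt (\<Sum>i<n. (norm (\<Sum>j<n. a i j \<cdot> \<xi> j))\<^sup>2) | \<xi>.
     (\<Sum>j<n. (norm (\<xi> j))\<^sup>2) \<le> (1::real)}"
  then obtain \<xi> where r: "r = sqrt (\<Sum>i<n. (norm (\<Sum>j<n. a i j \<cdot> \<xi> j))\<^sup>2)"
    and \<xi>: "(\<Sum>j<n. (norm (\<xi> j))\<^sup>2) \<le> 1" by blast
  have "(\<Sum>i<n. (norm (\<Sum>j<n. a i j \<cdot> \<xi> j))\<^sup>2) \<le> c\<^sup>2 * (\<Sum>j<n. (norm (\<xi> j))\<^sup>2)"
    using assms(1) unfolding matrix_bounded_def by blast
  also have "\<dots> \<le> c\<^sup>2" using \<xi> mult_left_mono[of _ 1 "c\<^sup>2"] by simp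
  finally show "r \<le> c" unfolding r using assms(2) by (intro real_le_lsqrt) auto
qed

lemma op_matrix_norm_bound:
  assumes "op_matrix_norm n a \<le> c" shows "matrix_bounded n a c"
  unfolding matrix_bounded_def
proof
  fix \<xi> :: "nat \<Rightarrow> 'a"
  define s where "s = (\<Sum>j<n. (norm (\<xi> j))\<^sup>2)"
  have s: "s \<ge> 0" by (simp add: s_def sum_nonneg)
  define L where "L \<xi> = (\<Sum>i<n. (norm (\<Sum>j<n. a i j \<cdot> \<xi> j))\<^sup>2)" for \<xi>
  show "L \<xi> \<le> c\<^sup>2 * s"
  proof (cases "s = 0")
    case True
    then have "\<xi> j = 0" if "j < n" for j
      using that sum_nonneg_eq_0_iff[of "{..<n}" "\<lambda>j. (norm (\<xi> j))\<^sup>2"] by (auto simp: s_def)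
    then show ?thesis by (simp add: L_def True)
  next
    case False
    let ?\<xi> = "\<lambda>j. (1 / sqrt s) *\<^sub>R \<xi> j"
    have "(\<Sum>j<n. (norm (?\<xi> j))\<^sup>2) = s / s"
      unfolding s_def sum_divide_distrib
      using s by (intro sum.cong) (auto simp: power_mult_distrib power_divide s_def)
    then have "(\<Sum>j<n. (norm (?\<xi> j))\<^sup>2) \<le> 1" using False by simp
    then have "sqrt (L ?\<xi>) \<le> op_matrix_norm n a"
      unfolding op_matrix_norm_def L_def
      by (intro cSup_upper op_matrix_norm_bdd CollectI exI[of _ ?\<xi>]) simp
    then have sq: "sqrt (L ?\<xi>) \<le> c" using assms by simp
    have "L ?\<xi> \<ge> 0" by (simp add: L_def sum_nonneg)
    then have "L ?\<xi> \<le> c\<^sup>2" using sq by (metis real_sqrt_ge_zero real_sqrt_pow2 power_mono)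
    moreover have "L ?\<xi> = L \<xi> / s"
      unfolding L_def sum_divide_distrib using s
      by (intro sum.cong) (auto simp: blinfun.scaleR_right power_mult_distrib power_divide
          simp flip: scaleR_sum_right)
    ultimately show ?thesis using s False by (simp add: field_simps)
  qed
qed

lemma sum_lessThan_double: "(\<Sum>i<n + (n::nat). f i) = (\<Sum>i<n. f i) + (\<Sum>i<n. f (n + i) :: 'a::comm_monoid_add)"
proof -
  have "(\<Sum>i<n + k. f i) = (\<Sum>i<n. f i) + (\<Sum>i<k. f (n + i))" for k :: nat
    by (induction k) (auto simp: add.assoc)
  then show ?thesis .
qed

text \<open>
  The block matrix with diagonal blocks \<open>d\<close> times the identity, upper right block \<open>a\<close> and lower left
  block \<open>b\<close>.
\<close>

definition dilation :: "nat \<Rightarrow> (nat \<Rightarrow> nat \<Rightarrow> 'a) \<Rightarrow> (nat \<Rightarrow> nat \<Rightarrow> 'a) \<Rightarrow> 'a \<Rightarrow> 'a \<Rightarrow> nat \<Rightarrow> nat \<Rightarrow> 'a" where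
  "dilation n a b d z i j =
     (if i < n then if j < n then if i = j then d else z else a i (j - n)
      else if j < n then b (i - n) j else if i = j then d else z)"

lemma dilation_form:
  fixes a b :: "nat \<Rightarrow> nat \<Rightarrow> 'h::complex_hilbert op"
  shows "(\<Sum>i<n + n. \<Sum>j<n + n. cinner (\<xi> i) (dilation n a b (c *\<^sub>R id_blinfun) 0 i j \<cdot> \<xi> j))
    = of_real c * (\<Sum>i<n. of_real ((norm (\<xi> i))\<^sup>2))
      + (\<Sum>i<n. \<Sum>j<n. cinner (\<xi> i) (a i j \<cdot> \<xi> (n + j)))
      + (\<Sum>i<n. \<Sum>j<n. cinner (\<xi> (n + i)) (b i j \<cdot> \<xi> j))
      + of_real c * (\<Sum>i<n. of_real ((norm (\<xi> (n + i)))\<^sup>2))"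
proof -
  have diag: "(\<Sum>j<n. cinner (\<xi> (m + i)) ((if i = j then c *\<^sub>R id_blinfun else 0) \<cdot> \<xi> (m + j)))
      = of_real c * of_real ((norm (\<xi> (m + i)))\<^sup>2)" if "i < n" for i m
  proof -
    have "cinner (\<xi> (m + i)) ((if i = j then c *\<^sub>R id_blinfun else 0) \<cdot> \<xi> (m + j))
        = (if j = i then of_real c * of_real ((norm (\<xi> (m + i)))\<^sup>2) else 0)" for j
      by (auto simp: blinfun.scaleR_left cinner_scaleR_right cinner_self)
    then show ?thesis using that by simp
  qed
  show ?thesis
    unfolding sum_lessThan_double sum.distrib
    using diag[of _ 0] diag[of _ n]
    by (simp add: dilation_def sum_distrib_left cong: if_cong)
qed

lemma ucp_vn_simps:
  assumes "ucp (vn A) (vn B) F" "op_algebra A"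
  shows "x \<in> A \<Longrightarrow> F x \<in> B" "x \<in> A \<Longrightarrow> y \<in> A \<Longrightarrow> F (x + y) = F x + F y"
    "x \<in> A \<Longrightarrow> F (op_scale c x) = op_scale c (F x)" "F id_blinfun = id_blinfun"
    "x \<in> A \<Longrightarrow> F (r *\<^sub>R x) = r *\<^sub>R F x" "F 0 = 0"
proof -
  show *: "x \<in> A \<Longrightarrow> F x \<in> B" "x \<in> A \<Longrightarrow> y \<in> A \<Longrightarrow> F (x + y) = F x + F y"
    "x \<in> A \<Longrightarrow> F (op_scale c x) = op_scale c (F x)" "F id_blinfun = id_blinfun" for x y c
    using assms(1) by (auto simp: ucp_def linear_map_def)
  show r: "x \<in> A \<Longrightarrow> F (r *\<^sub>R x) = r *\<^sub>R F x" for x r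
    using *(3)[of x "of_real r"] by (simp add: op_scale_real)
  show "F 0 = 0" using r[of id_blinfun 0] op_algebra_closed(2)[OF assms(2)] by simp
qed

text \<open>
  If \<open>a\<close> has norm at most \<open>c\<close>, its dilation with diagonal \<open>c\<close> and lower block the adjoint of \<open>a\<close> is positive, so
  the image of the dilation under \<open>F\<close> is positive. Evaluating the latter at the block vectors \<open>(y, z \<xi>)\<close> with
  \<open>y = F(a) \<xi>\<close> and \<open>z\<close> an arbitrary complex number, \<open>complex_quadratic_nonneg\<close> yields
  \<open>\<parallel>y\<parallel>\<^sup>4 \<le> c\<^sup>2 \<parallel>y\<parallel>\<^sup>2 \<parallel>\<xi>\<parallel>\<^sup>2\<close>.
\<close>

lemma ucp_matrix_bounded:
  fixes A B :: "'h::complex_hilbert op set"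
  assumes F: "ucp (vn A) (vn B) F" and A: "von_neumann_algebra A" and B: "B \<subseteq> bops"
    and a: "\<And>i j. i < n \<Longrightarrow> j < n \<Longrightarrow> a i j \<in> A" and bound: "matrix_bounded n a c" and c: "c > 0"
  shows "matrix_bounded n (\<lambda>i j. F (a i j)) c"
  unfolding matrix_bounded_def
proof
  note Ac = von_neumann_closed[OF A] von_neumann_adj[OF A] and Fs = ucp_vn_simps[OF F von_neumann_op_algebra[OF A]]
  let ?b = "\<lambda>i j. adj (a j i)"
  define D where "D = dilation n a ?b (c *\<^sub>R id_blinfun) 0"
  have D_pos: "D \<in> oa_pos (vn A) (n + n)"
    unfolding vn_simps
  proof (intro conjI allI impI)
    show "D i j \<in> A" if "i < n + n" "j < n + n" for i j
      using that a Ac by (auto simp: D_def dilation_def)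
    fix \<xi> :: "nat \<Rightarrow> 'h"
    define y where "y i = (\<Sum>j<n. a i j \<cdot> \<xi> (n + j))" for i
    define S where "S = (\<Sum>i<n. cinner (\<xi> i) (y i))"
    have S: "(\<Sum>i<n. \<Sum>j<n. cinner (\<xi> i) (a i j \<cdot> \<xi> (n + j))) = S"
      by (simp add: S_def y_def cinner_sum_right)
    have T: "(\<Sum>i<n. \<Sum>j<n. cinner (\<xi> (n + i)) (?b i j \<cdot> \<xi> j)) = cnj S"
    proof -
      have "(\<Sum>i<n. \<Sum>j<n. cinner (\<xi> (n + i)) (?b i j \<cdot> \<xi> j))
          = (\<Sum>i<n. \<Sum>j<n. cnj (cinner (\<xi> j) (a j i \<cdot> \<xi> (n + i))))"
        using a Ac by (intro sum.cong refl) (auto simp: cinner_adj_right intro: cinner_commute)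
      also have "\<dots> = cnj S" unfolding S[symmetric] by (subst sum.swap) (simp add: cnj_sum)
      finally show ?thesis .
    qed
    let ?P = "\<Sum>i<n. (norm (\<xi> i))\<^sup>2" and ?Q = "\<Sum>i<n. (norm (\<xi> (n + i)))\<^sup>2"
    have "2 * cmod S \<le> c * ?P + c * ?Q"
    proof -
      have "2 * cmod S \<le> 2 * (\<Sum>i<n. norm (\<xi> i) * norm (y i))"
        unfolding S_def by (intro mult_left_mono sum_norm_le Cauchy_Schwarz_cinner) auto
      also have "\<dots> \<le> (\<Sum>i<n. c * (norm (\<xi> i))\<^sup>2 + (norm (y i))\<^sup>2 / c)"
        unfolding sum_distrib_left
      proof (intro sum_mono)
        fix i
        have "0 \<le> (c * norm (\<xi> i) - norm (y i))\<^sup>2 / c" using c by simp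
        also have "\<dots> = c * (norm (\<xi> i))\<^sup>2 + (norm (y i))\<^sup>2 / c - 2 * (norm (\<xi> i) * norm (y i))"
          using c by (simp add: power2_eq_square field_simps)
        finally show "2 * (norm (\<xi> i) * norm (y i)) \<le> c * (norm (\<xi> i))\<^sup>2 + (norm (y i))\<^sup>2 / c" by simp
      qed
      also have "\<dots> = c * ?P + (\<Sum>i<n. (norm (y i))\<^sup>2) / c"
        by (simp add: sum.distrib sum_distrib_left sum_divide_distrib)
      also have "(\<Sum>i<n. (norm (y i))\<^sup>2) / c \<le> c\<^sup>2 * ?Q / c"
        using bound[unfolded matrix_bounded_def, rule_format, of "\<lambda>j. \<xi> (n + j)"] c
        unfolding y_def by (intro divide_right_mono) auto
      also have "c\<^sup>2 * ?Q / c = c * ?Q" using c by (simp add: power2_eq_square)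
      finally show ?thesis by simp
    qed
    then have "0 \<le> c * ?P + 2 * Re S + c * ?Q" using abs_Re_le_cmod[of S] by linarith
    then show "(\<Sum>i<n + n. \<Sum>j<n + n. cinner (\<xi> i) (D i j \<cdot> \<xi> j)) \<in> \<real>\<^sub>\<ge>\<^sub>0"
      unfolding D_def dilation_form S T
      by (simp add: complex_nonneg_Reals_iff flip: of_real_sum of_real_power of_real_mult)
  qed
  fix \<xi> :: "nat \<Rightarrow> 'h"
  let ?b' = "\<lambda>i j. F (adj (a j i))" and ?a' = "\<lambda>i j. F (a i j)"
  have "\<forall>d\<in>oa_pos (vn A) (n + n). (\<lambda>i j. F (d i j)) \<in> oa_pos (vn B) (n + n)"
    using F unfolding ucp_def by blast
  from bspec[OF this D_pos] have "(\<lambda>i j. F (D i j)) \<in> oa_pos (vn B) (n + n)" .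
  moreover have "F (D i j) = dilation n ?a' ?b' (c *\<^sub>R id_blinfun) 0 i j" for i j
    using Ac by (simp add: D_def dilation_def Fs)
  ultimately have pos: "(\<Sum>i<n + n. \<Sum>j<n + n. cinner (v i)
      (dilation n ?a' ?b' (c *\<^sub>R id_blinfun) 0 i j \<cdot> v j)) \<in> \<real>\<^sub>\<ge>\<^sub>0" for v
    by simp
  define y where "y i = (\<Sum>j<n. ?a' i j \<cdot> \<xi> j)" for i
  let ?P = "\<Sum>i<n. (norm (y i))\<^sup>2" and ?Q = "\<Sum>i<n. (norm (\<xi> i))\<^sup>2"
  let ?T = "\<Sum>i<n. \<Sum>j<n. cinner (\<xi> i) (?b' i j \<cdot> y j)"
  have F_bops: "F (a i j) \<in> bops" if "i < n" "j < n" for i j using that a Fs B by blast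
  have "(cmod (of_real ?P))\<^sup>2 \<le> Re (of_real (c * ?P)) * Re (of_real (c * ?Q))"
  proof (rule complex_quadratic_nonneg(2))
    fix z
    let ?v = "\<lambda>i. if i < n then y i else z *\<^sub>C \<xi> (i - n)"
    have 1: "(\<Sum>i<n. \<Sum>j<n. cinner (?v i) (?a' i j \<cdot> ?v (n + j))) = z * of_real ?P"
    proof -
      have "(\<Sum>i<n. \<Sum>j<n. cinner (?v i) (?a' i j \<cdot> ?v (n + j)))
          = (\<Sum>i<n. \<Sum>j<n. z * cinner (y i) (?a' i j \<cdot> \<xi> j))"
        by (intro sum.cong refl) (simp add: bops_scaleC F_bops cinner_linear)
      also have "\<dots> = z * (\<Sum>i<n. cinner (y i) (y i))"
        by (simp add: sum_distrib_left cinner_sum_right y_def)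
      finally show ?thesis by (simp add: cinner_self)
    qed
    have 2: "(\<Sum>i<n. \<Sum>j<n. cinner (?v (n + i)) (?b' i j \<cdot> ?v j)) = cnj z * ?T"
      unfolding sum_distrib_left by (intro sum.cong refl) (simp add: cinner_linear)
    have 3: "(\<Sum>i<n. complex_of_real ((norm (?v (n + i)))\<^sup>2)) = cnj z * z * of_real ?Q"
      unfolding of_real_sum sum_distrib_left
      by (intro sum.cong refl)
        (simp add: norm_scaleC power_mult_distrib complex_norm_square mult_ac del: of_real_power)
    have 4: "(\<Sum>i<n. complex_of_real ((norm (?v i))\<^sup>2)) = of_real ?P" by simp
    have "of_real (c * ?P) + z * of_real ?P + cnj z * ?T + cnj z * z * of_real (c * ?Q) =
      (\<Sum>i<n + n. \<Sum>j<n + n. cinner (?v i) (dilation n ?a' ?b' (c *\<^sub>R id_blinfun) 0 i j \<cdot> ?v j))"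
      unfolding dilation_form 1 2 3 4 by (simp add: mult_ac)
    then show "of_real (c * ?P) + z * of_real ?P + cnj z * ?T + cnj z * z * of_real (c * ?Q) \<in> \<real>\<^sub>\<ge>\<^sub>0"
      using pos by simp
  next
    have "0 \<le> c * ?Q" using c by (simp add: sum_nonneg)
    then show "complex_of_real (c * ?Q) \<in> \<real>\<^sub>\<ge>\<^sub>0" by (simp add: complex_nonneg_Reals_iff del: of_real_mult)
  qed
  then have "?P * ?P \<le> ?P * (c\<^sup>2 * ?Q)" by (simp only: norm_of_real power2_abs Re_complex_of_real) (simp add: power2_eq_square mult_ac)
  moreover have "?P \<ge> 0" "c\<^sup>2 * ?Q \<ge> 0" by (simp_all add: sum_nonneg)
  ultimately have "?P \<le> c\<^sup>2 * ?Q" by (metis mult_le_cancel_left_pos order_le_less)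
  then show "(\<Sum>i<n. (norm (\<Sum>j<n. ?a' i j \<cdot> \<xi> j))\<^sup>2) \<le> c\<^sup>2 * ?Q" by (simp add: y_def)
qed

lemma ucp_op_matrix_norm_le:
  fixes A B :: "'h::complex_hilbert op set"
  assumes "ucp (vn A) (vn B) F" "von_neumann_algebra A" "B \<subseteq> bops"
    and "\<And>i j. i < n \<Longrightarrow> j < n \<Longrightarrow> a i j \<in> A"
  shows "op_matrix_norm n (\<lambda>i j. F (a i j)) \<le> op_matrix_norm n a"
proof (rule dense_ge)
  fix c assume c: "op_matrix_norm n a < c"
  then have c0: "c > 0" using op_matrix_norm_nonneg[of n a] by linarith
  have "matrix_bounded n (\<lambda>i j. F (a i j)) c"
    by (rule ucp_matrix_bounded[OF assms op_matrix_norm_bound c0]) (use c in auto)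
  then show "op_matrix_norm n (\<lambda>i j. F (a i j)) \<le> c"
    by (rule op_matrix_norm_leI) (use c0 in simp)
qed

lemma ucp_contractive:
  fixes A B :: "'h::complex_hilbert op set"
  assumes "ucp (vn A) (vn B) F" "von_neumann_algebra A" "B \<subseteq> bops" "x \<in> A"
  shows "norm (F x) \<le> norm x"
proof (rule dense_ge)
  fix c assume c: "norm x < c"
  then have c0: "c > 0" using norm_ge_zero[of x] by linarith
  have "(norm (x \<cdot> u))\<^sup>2 \<le> c\<^sup>2 * (norm u)\<^sup>2" for u
  proof -
    have "norm (x \<cdot> u) \<le> c * norm u"
      using norm_blinfun[of x u] c mult_right_mono[of "norm x" c "norm u"] by simp
    then have "(norm (x \<cdot> u))\<^sup>2 \<le> (c * norm u)\<^sup>2" by (intro power_mono) auto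
    then show ?thesis by (simp add: power_mult_distrib)
  qed
  then have "matrix_bounded 1 (\<lambda>_ _. x) c" by (simp add: matrix_bounded_def)
  then have "matrix_bounded 1 (\<lambda>_ _. F x) c"
    by (rule ucp_matrix_bounded[OF assms(1-3) assms(4) _ c0])
  then have sq: "(norm (F x \<cdot> u))\<^sup>2 \<le> (c * norm u)\<^sup>2" for u
    unfolding matrix_bounded_def by (auto simp: power_mult_distrib dest!: spec[of _ "\<lambda>_. u"])
  show "norm (F x) \<le> c"
    by (rule norm_blinfun_bound) (use c0 sq in \<open>auto intro: power2_le_imp_le\<close>)
qed

section \<open>Composition of normal maps\<close>

lemma sigma_weakly_continuousI:
  assumes "F \<in> oa_carrier A \<rightarrow> oa_carrier B"
    and "\<And>f. f \<in> oa_predual B \<Longrightarrow> (\<lambda>x. f (F x)) \<in> oa_predual A"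
  shows "sigma_weakly_continuous A B F"
proof -
  have top: "topspace (sigma_weak_topology A) = oa_carrier A"
    unfolding sigma_weak_topology_def topspace_pullback_topology by auto
  have ev: "continuous_map (sigma_weak_topology A) euclidean g" if g: "g \<in> oa_predual A" for g
  proof -
    have "continuous_map (product_topology (\<lambda>_. euclidean) (oa_predual A)) euclidean (\<lambda>h. h g)"
      by (rule continuous_map_product_projection[OF g])
    from continuous_map_pullback[OF this, of "oa_carrier A" "\<lambda>x. \<lambda>f\<in>oa_predual A. f x"]
    show ?thesis unfolding sigma_weak_topology_def by (simp add: o_def g)
  qed
  show ?thesis
    unfolding sigma_weakly_continuous_def sigma_weak_topology_def[of B]
  proof (rule continuous_map_pullback')
    show "topspace (sigma_weak_topology A) \<subseteq> F -` oa_carrier B" using assms(1) top by auto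
    show "continuous_map (sigma_weak_topology A) (product_topology (\<lambda>_. euclidean) (oa_predual B))
        ((\<lambda>x. \<lambda>f\<in>oa_predual B. f x) \<circ> F)"
      unfolding continuous_map_componentwise
      by (auto simp: o_def intro!: ev assms(2))
  qed
qed

lemma linear_map_comp: "linear_map A B F \<Longrightarrow> linear_map B C G \<Longrightarrow> linear_map A C (\<lambda>x. G (F x))"
  by (auto simp: linear_map_def Pi_iff)

lemma sigma_weakly_continuous_comp:
  "sigma_weakly_continuous A B F \<Longrightarrow> sigma_weakly_continuous B C G \<Longrightarrow>
     sigma_weakly_continuous A C (\<lambda>x. G (F x))"
  using continuous_map_compose by (fastforce simp: sigma_weakly_continuous_def o_def)

lemma ucp_comp: "ucp A B F \<Longrightarrow> ucp B C G \<Longrightarrow> ucp A C (\<lambda>x. G (F x))"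
  unfolding ucp_def using linear_map_comp[of A B F C G] by auto

lemma normal_ucp_comp:
  "normal_ucp A B F \<Longrightarrow> normal_ucp B C G \<Longrightarrow> normal_ucp A C (\<lambda>x. G (F x))"
  unfolding normal_ucp_def using ucp_comp sigma_weakly_continuous_comp by blast

lemma normal_ucp_inclusion: "N \<subseteq> M \<Longrightarrow> normal_ucp (vn N) (vn M) (\<lambda>x. x)"
  unfolding normal_ucp_def
  by (intro conjI sigma_weakly_continuousI)
    (auto simp: ucp_def linear_map_def intro: op_predual_mono)

lemma ucp_cong:
  assumes "ucp (vn A) (vn B) F" "op_algebra A" "\<And>x. x \<in> A \<Longrightarrow> G x = F x"
  shows "ucp (vn A) (vn B) G"
proof -
  note Ac = op_algebra_closed[OF assms(2)]
  have lin: "linear_map (vn A) (vn B) G"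
    using assms(1) Ac by (auto simp: ucp_def linear_map_def assms(3))
  have "(\<lambda>i j. G (a i j)) \<in> oa_pos (vn B) k" if a: "a \<in> oa_pos (vn A) k" for a k
  proof -
    have "\<forall>a\<in>oa_pos (vn A) k. (\<lambda>i j. F (a i j)) \<in> oa_pos (vn B) k" using assms(1) unfolding ucp_def by blast
    from bspec[OF this a] have "(\<lambda>i j. F (a i j)) \<in> oa_pos (vn B) k" .
    moreover have "G (a i j) = F (a i j)" if "i < k" "j < k" for i j using a that assms(3) by simp
    moreover from this have "(\<Sum>i<k. \<Sum>j<k. cinner (\<xi> i) (G (a i j) \<cdot> \<xi> j))
        = (\<Sum>i<k. \<Sum>j<k. cinner (\<xi> i) (F (a i j) \<cdot> \<xi> j))" for \<xi>
      by (intro sum.cong refl) auto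
    ultimately show ?thesis by simp
  qed
  then show ?thesis using lin assms by (simp add: ucp_def Ac del: vn_simps(5))
qed

context expected_subalgebra begin

lemma E_normal_ucp: "normal_ucp (vn M) (vn N) E"
  unfolding normal_ucp_def
  by (intro conjI E_ucp sigma_weakly_continuousI) (auto simp: E_in expectation_normal)

lemma E_norm_le: "x \<in> M \<Longrightarrow> norm (E x) \<le> norm x"
  by (rule ucp_contractive[OF E_ucp M]) (use N_closed in auto)

end

section \<open>The topology on subalgebras\<close>

text \<open>
  On bounded sets of operators, smallness on finitely many vectors of the Hilbert space controls each
  vector of its amplification, because all but finitely many coordinates contribute little.
\<close>

lemma amp_small:
  fixes \<eta> :: "'a::complex_hilbert l2"
  assumes "e > 0"
  obtains \<Xi> \<delta> where "finite \<Xi>" "\<delta> > 0"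
    "\<And>y. norm y \<le> 2 \<Longrightarrow> (\<And>\<xi>. \<xi> \<in> \<Xi> \<Longrightarrow> norm (y \<cdot> \<xi>) < \<delta>) \<Longrightarrow> norm (amp y \<cdot> \<eta>) < e"
proof -
  note sm = l2_summable[of \<eta>]
  obtain K where K: "norm (\<Sum>n. (norm (l2_nth \<eta> (n + K)))\<^sup>2) < e\<^sup>2 / 8"
    using suminf_exist_split[OF _ sm, of "e\<^sup>2 / 8"] assms by (auto simp: add.commute)
  \<comment> \<open>K coordinates contribute at most e^2/4 together, and the remaining ones less than e^2/2.\<close>
  define \<delta> where "\<delta> = e / (2 * sqrt (real K + 1))"
  show thesis
  proof (rule that[of "l2_nth \<eta> ` {..<K}" \<delta>])
    show "\<delta> > 0" using assms by (simp add: \<delta>_def)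
    fix y :: "'a op"
    assume y: "norm y \<le> 2" and small: "\<And>\<xi>. \<xi> \<in> l2_nth \<eta> ` {..<K} \<Longrightarrow> norm (y \<cdot> \<xi>) < \<delta>"
    have sy: "summable (\<lambda>n. (norm (y \<cdot> l2_nth \<eta> n))\<^sup>2)" by (rule summable_sq_blinfun[OF sm])
    have head: "(\<Sum>n<K. (norm (y \<cdot> l2_nth \<eta> n))\<^sup>2) \<le> e\<^sup>2 / 4"
    proof -
      have "(\<Sum>n<K. (norm (y \<cdot> l2_nth \<eta> n))\<^sup>2) \<le> (\<Sum>n<K. \<delta>\<^sup>2)"
        using small by (intro sum_mono power_mono) (auto intro: less_imp_le)
      also have "\<dots> = (real K / (real K + 1)) * (e\<^sup>2 / 4)" by (simp add: \<delta>_def power_divide power_mult_distrib)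
      also have "\<dots> \<le> 1 * (e\<^sup>2 / 4)" by (intro mult_right_mono) auto
      finally show ?thesis by simp
    qed
    have tail: "(\<Sum>n. (norm (y \<cdot> l2_nth \<eta> (n + K)))\<^sup>2) < e\<^sup>2 / 2"
    proof -
      have "(\<Sum>n. (norm (y \<cdot> l2_nth \<eta> (n + K)))\<^sup>2) \<le> (\<Sum>n. 4 * (norm (l2_nth \<eta> (n + K)))\<^sup>2)"
      proof (rule suminf_le)
        fix n
        have "norm (y \<cdot> l2_nth \<eta> (n + K)) \<le> 2 * norm (l2_nth \<eta> (n + K))"
          using norm_blinfun mult_right_mono[OF y norm_ge_zero] by (rule order_trans)
        from power_mono[OF this, of 2]
        show "(norm (y \<cdot> l2_nth \<eta> (n + K)))\<^sup>2 \<le> 4 * (norm (l2_nth \<eta> (n + K)))\<^sup>2"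
          by (simp add: power_mult_distrib)
      qed (use sy sm in \<open>auto intro!: summable_mult simp: summable_iff_shift[where f = "\<lambda>n. (norm (y \<cdot> l2_nth \<eta> n))\<^sup>2"] summable_iff_shift[where f = "\<lambda>n. (norm (l2_nth \<eta> n))\<^sup>2"]\<close>)
      also have "\<dots> = 4 * (\<Sum>n. (norm (l2_nth \<eta> (n + K)))\<^sup>2)"
        using sm by (intro suminf_mult) (simp add: summable_iff_shift[where f = "\<lambda>n. (norm (l2_nth \<eta> n))\<^sup>2"])
      also have "\<dots> < e\<^sup>2 / 2" using K by simp
      finally show ?thesis .
    qed
    have "(norm (amp y \<cdot> \<eta>))\<^sup>2 < e\<^sup>2"
      unfolding norm_l2_sq l2_nth_amp using suminf_split_initial_segment[OF sy, of K] head tail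
        zero_less_power[OF assms, of 2] by linarith
    then show "norm (amp y \<cdot> \<eta>) < e" by (rule power2_less_imp_less) (use assms in simp)
  qed auto
qed

context von_neumann_state begin

text \<open>
  Normal functionals are continuous for the strong topology on bounded sets. The bounded left factor
  \<open>w\<close> allows \<open>w = y\<^sup>*\<close>, for the two-norm, besides \<open>w = 1\<close>.
\<close>

lemma predual_small:
  assumes g: "g \<in> op_predual M" and e: "e > 0"
  obtains \<Xi> \<delta> where "finite \<Xi>" "\<delta> > 0"
    "\<And>w y :: 'h op. w o\<^sub>L y \<in> M \<Longrightarrow> norm w \<le> 2 \<Longrightarrow> norm y \<le> 2 \<Longrightarrow>
      (\<And>\<xi>. \<xi> \<in> \<Xi> \<Longrightarrow> norm (y \<cdot> \<xi>) < \<delta>) \<Longrightarrow> cmod (g (w o\<^sub>L y)) < e"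
proof -
  obtain \<xi> \<eta> where f: "\<And>x. x \<in> M \<Longrightarrow> g x = cinner \<xi> (amp x \<cdot> \<eta>)"
    using g unfolding op_predual_iff by metis
  have pos: "2 * norm \<xi> + 1 > 0" using norm_ge_zero[of \<xi>] by linarith
  obtain \<Xi> \<delta> where D: "finite \<Xi>" "\<delta> > 0"
    "\<And>y. norm y \<le> 2 \<Longrightarrow> (\<And>\<xi>. \<xi> \<in> \<Xi> \<Longrightarrow> norm (y \<cdot> \<xi>) < \<delta>) \<Longrightarrow>
      norm (amp y \<cdot> \<eta>) < e / (2 * norm \<xi> + 1)"
    using amp_small[of "e / (2 * norm \<xi> + 1)" \<eta>] e pos by (metis divide_pos_pos)
  show thesis
  proof (rule that[OF D(1,2)])
    fix w y :: "'h op" assume wy: "w o\<^sub>L y \<in> M" "norm w \<le> 2" "norm y \<le> 2"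
      and small: "\<And>\<xi>. \<xi> \<in> \<Xi> \<Longrightarrow> norm (y \<cdot> \<xi>) < \<delta>"
    have lt: "norm (amp y \<cdot> \<eta>) < e / (2 * norm \<xi> + 1)" using D(3) wy small by blast
    have "cmod (g (w o\<^sub>L y)) \<le> norm \<xi> * norm (amp w \<cdot> amp y \<cdot> \<eta>)"
      using Cauchy_Schwarz_cinner by (simp add: f wy amp_simps)
    also have "\<dots> \<le> norm \<xi> * (2 * norm (amp y \<cdot> \<eta>))"
      using wy by (intro mult_left_mono order_trans[OF norm_amp_le] mult_right_mono) auto
    also have "\<dots> \<le> (2 * norm \<xi> + 1) * norm (amp y \<cdot> \<eta>)" by (simp add: algebra_simps)
    also have "\<dots> < (2 * norm \<xi> + 1) * (e / (2 * norm \<xi> + 1))"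
      using lt pos by (rule mult_strict_left_mono)
    also have "\<dots> = e" using pos by simp
    finally show "cmod (g (w o\<^sub>L y)) < e" .
  qed
qed

text \<open>
  The operator \<open>cond_exp\<close> is given by a definite description, so the point is uniqueness. If \<open>E\<close> and \<open>F\<close> are two
  expectations and \<open>y = F x - E x\<close>, then \<open>\<phi> (y\<^sup>* (F x)) = \<phi> (y\<^sup>* x) = \<phi> (y\<^sup>* (E x))\<close> by the module
  property, whence \<open>\<phi> (y\<^sup>* y) = 0\<close>.
\<close>

lemma cond_exp_expected:
  assumes N: "N \<in> expected_subalgebras M \<phi>"
  shows "expected_subalgebra M \<phi> N (cond_exp M \<phi> N)"
proof -
  obtain E where E: "von_neumann_algebra N" "N \<subseteq> M" "preserving_expectation M \<phi> N E"
    using N unfolding expected_subalgebras_def by blast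
  interpret E: expected_subalgebra M \<phi> N E by unfold_locales (use E in auto)
  have E': "preserving_expectation M \<phi> N (restrict E M)"
    unfolding preserving_expectation_def conditional_expectation_def
  proof (intro conjI ballI)
    show "ucp (vn M) (vn N) (restrict E M)"
      by (rule ucp_cong[OF E.E_ucp von_neumann_op_algebra[OF M]]) simp
    fix a b x assume "a \<in> N" "b \<in> N" "x \<in> M"
    moreover from this have "a o\<^sub>L x o\<^sub>L b \<in> M" using E.in_M M_closed(4) by blast
    ultimately show "restrict E M (a o\<^sub>L x o\<^sub>L b) = a o\<^sub>L restrict E M x o\<^sub>L b"
      using E(3) by (auto simp: preserving_expectation_def conditional_expectation_def)
  qed (use E.E_fix E.in_M E.\<phi>_E in auto)
  have "\<exists>!E. E \<in> extensional M \<and> preserving_expectation M \<phi> N E"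
  proof (rule ex1I[of _ "restrict E M"])
    fix F assume F: "F \<in> extensional M \<and> preserving_expectation M \<phi> N F"
    interpret F: expected_subalgebra M \<phi> N F by unfold_locales (use E F in auto)
    have "F x = E x" if x: "x \<in> M" for x
    proof -
      let ?y = "F x - E x"
      have y: "?y \<in> N" "adj ?y \<in> N" using E.E_in F.E_in x E.N_closed by auto
      have "\<phi> (adj ?y o\<^sub>L F x) = \<phi> (adj ?y o\<^sub>L x)" "\<phi> (adj ?y o\<^sub>L E x) = \<phi> (adj ?y o\<^sub>L x)"
        using F.\<phi>_E[of "adj ?y o\<^sub>L x"] E.\<phi>_E[of "adj ?y o\<^sub>L x"] F.E_left[OF y(2) x] E.E_left[OF y(2) x]
          M_closed E.in_M[OF y(2)] x by auto
      then have "\<phi> (adj ?y o\<^sub>L ?y) = 0"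
        using \<phi>_linear(3)[of "adj ?y o\<^sub>L F x" "adj ?y o\<^sub>L E x"] M_closed E.in_M y E.E_in[OF x] F.E_in[OF x]
        by (simp add: comp_simps)
      then have "?y = 0" by (rule \<phi>_faithful[OF E.in_M[OF y(1)]])
      then show ?thesis by simp
    qed
    then show "F = restrict E M" using F by (auto intro!: extensionalityI[of _ M])
  qed (use E' in auto)
  from theI'[OF this] have "preserving_expectation M \<phi> N (cond_exp M \<phi> N)"
    unfolding cond_exp_def by blast
  then show ?thesis using E by unfold_locales auto
qed

text \<open>
  Membership of \<open>N\<close> in the closure of the subalgebras satisfying \<open>P\<close>, in terms of basic neighbourhoods of
  the topology of pointwise strong convergence of the expectations.
\<close>

definition adherent :: "('h op set \<Rightarrow> bool) \<Rightarrow> 'h op set \<Rightarrow> bool" where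
  "adherent P N \<longleftrightarrow>
     (\<forall>X \<Xi>. \<forall>\<delta>>0. finite X \<and> X \<subseteq> M \<and> finite \<Xi> \<longrightarrow>
        (\<exists>N'\<in>expected_subalgebras M \<phi>. P N' \<and>
           (\<forall>x\<in>X. \<forall>\<xi>\<in>\<Xi>. norm ((cond_exp M \<phi> N' x - cond_exp M \<phi> N x) \<cdot> \<xi>) < \<delta>)))"

lemma adherentE:
  assumes "adherent P N" "finite X" "X \<subseteq> M" "finite \<Xi>" "\<delta> > 0"
  obtains N' where "N' \<in> expected_subalgebras M \<phi>" "P N'"
    "\<And>x \<xi>. x \<in> X \<Longrightarrow> \<xi> \<in> \<Xi> \<Longrightarrow> norm ((cond_exp M \<phi> N' x - cond_exp M \<phi> N x) \<cdot> \<xi>) < \<delta>"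
  using assms unfolding adherent_def by meson

lemma closedin_expectation_topologyI:
  assumes "\<And>N. N \<in> expected_subalgebras M \<phi> \<Longrightarrow> adherent P N \<Longrightarrow> P N"
  shows "closedin (expectation_topology M \<phi>) {N \<in> expected_subalgebras M \<phi>. P N}"
proof -
  let ?ES = "expected_subalgebras M \<phi>" and ?T = "expectation_topology M \<phi>"
  let ?r = "\<lambda>N. \<lambda>x\<in>M. cond_exp M \<phi> N x"
  have top: "topspace ?T = ?ES"
    unfolding expectation_topology_def topspace_pullback_topology
    by (auto simp: strong_operator_topology_topspace)
  have "openin ?T (?ES - {N \<in> ?ES. P N})"
    unfolding openin_subopen[of _ "?ES - {N \<in> ?ES. P N}"]
  proof
    fix N assume "N \<in> ?ES - {N \<in> ?ES. P N}"
    then have N: "N \<in> ?ES" "\<not> P N" by auto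
    from assms[OF N(1)] N(2) have "\<not> adherent P N" by blast
    then obtain X \<Xi> \<delta> where X: "finite X" "X \<subseteq> M" "finite \<Xi>" "\<delta> > 0"
      and no: "\<not> (\<exists>N'\<in>?ES. P N' \<and>
        (\<forall>x\<in>X. \<forall>\<xi>\<in>\<Xi>. norm ((cond_exp M \<phi> N' x - cond_exp M \<phi> N x) \<cdot> \<xi>) < \<delta>))"
      unfolding adherent_def not_all not_imp by (elim exE conjE) (rule that)
    define V where "V x = {T. \<forall>\<xi>\<in>\<Xi>. T \<cdot> \<xi> \<in> ball (cond_exp M \<phi> N x \<cdot> \<xi>) \<delta>}" for x
    have V: "openin strong_operator_topology (V x)" for x
      unfolding V_def using strong_operator_topology_basis[of \<Xi> "\<lambda>\<xi>. ball (cond_exp M \<phi> N x \<cdot> \<xi>) \<delta>" "\<lambda>\<xi>. \<xi>"] X(3)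
      by simp
    define W where "W = Pi\<^sub>E M (\<lambda>x. if x \<in> X then V x else UNIV)"
    have W: "openin (product_topology (\<lambda>_. strong_operator_topology) M) W"
      unfolding W_def
    proof (rule product_topology_basis)
      show "openin strong_operator_topology (if x \<in> X then V x else UNIV)" for x
        using V openin_topspace[of "strong_operator_topology :: 'h op topology"]
        by (simp add: strong_operator_topology_topspace)
      show "finite {x. (if x \<in> X then V x else UNIV) \<noteq> topspace strong_operator_topology}"
        by (rule finite_subset[OF _ X(1)]) (auto simp: strong_operator_topology_topspace split: if_splits)
    qed
    have open_U: "openin ?T (?r -` W \<inter> ?ES)"
      unfolding expectation_topology_def openin_pullback_topology using W by blast
    have iff: "N' \<in> ?r -` W \<longleftrightarrow>
        (\<forall>x\<in>X. \<forall>\<xi>\<in>\<Xi>. norm ((cond_exp M \<phi> N' x - cond_exp M \<phi> N x) \<cdot> \<xi>) < \<delta>)" for N'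
      using X(2) by (auto simp: W_def V_def PiE_iff dist_norm norm_minus_commute blinfun.diff_left split: if_splits)
    show "\<exists>U. openin ?T U \<and> N \<in> U \<and> U \<subseteq> ?ES - {N \<in> ?ES. P N}"
    proof (intro exI conjI)
      show "N \<in> ?r -` W \<inter> ?ES" using iff[of N] N(1) X(4) by auto
      show "?r -` W \<inter> ?ES \<subseteq> ?ES - {N \<in> ?ES. P N}" using iff no by blast
    qed (rule open_U)
  qed
  then show ?thesis unfolding closedin_def top by auto
qed

end

section \<open>The two-norm\<close>

context von_neumann_state begin

lemma norm2_sq: "x \<in> M \<Longrightarrow> (norm2 \<phi> x)\<^sup>2 = Re (\<phi> (adj x o\<^sub>L x))"
  using \<phi>_square[of x] by (simp add: norm2_def complex_nonneg_Reals_iff)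

lemma norm2_nonneg: "x \<in> M \<Longrightarrow> 0 \<le> norm2 \<phi> x"
  using \<phi>_square[of x] by (simp add: norm2_def complex_nonneg_Reals_iff)

lemma norm2_zero [simp]: "norm2 \<phi> 0 = 0"
  using \<phi>_linear(1)[OF M_closed(7) M_closed(7)] by (simp add: norm2_def comp_simps)

lemma norm2_triangle:
  assumes xy: "x \<in> M" "y \<in> M" shows "norm2 \<phi> (x + y) \<le> norm2 \<phi> x + norm2 \<phi> y"
proof (rule power2_le_imp_le)
  have "\<phi> (adj (x + y) o\<^sub>L (x + y)) = \<phi> (adj x o\<^sub>L x) + \<phi> (adj x o\<^sub>L y) + (\<phi> (adj y o\<^sub>L x) + \<phi> (adj y o\<^sub>L y))"
    using xy M_closed by (simp add: adj_add comp_simps \<phi>_linear)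
  then have "(norm2 \<phi> (x + y))\<^sup>2 = (norm2 \<phi> x)\<^sup>2 + 2 * Re (\<phi> (adj x o\<^sub>L y)) + (norm2 \<phi> y)\<^sup>2"
    using xy M_closed positive_functional_hermitian[OF M \<phi>_positive xy] by (simp add: norm2_sq)
  moreover have "(cmod (\<phi> (adj x o\<^sub>L y)))\<^sup>2 \<le> (norm2 \<phi> x * norm2 \<phi> y)\<^sup>2"
    using positive_functional_Cauchy_Schwarz[OF M \<phi>_positive xy] xy by (simp add: norm2_sq power_mult_distrib)
  then have "cmod (\<phi> (adj x o\<^sub>L y)) \<le> norm2 \<phi> x * norm2 \<phi> y"
    by (rule power2_le_imp_le) (simp add: norm2_nonneg xy)
  then have "Re (\<phi> (adj x o\<^sub>L y)) \<le> norm2 \<phi> x * norm2 \<phi> y"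
    using complex_Re_le_cmod order_trans by blast
  ultimately show "(norm2 \<phi> (x + y))\<^sup>2 \<le> (norm2 \<phi> x + norm2 \<phi> y)\<^sup>2"
    by (simp add: power2_sum)
qed (simp add: norm2_nonneg xy)

lemma norm2_minus: "x \<in> M \<Longrightarrow> norm2 \<phi> (- x) = norm2 \<phi> x"
proof -
  assume "x \<in> M"
  then have "adj (- x) o\<^sub>L - x = adj x o\<^sub>L x"
    using M_closed(1) by (auto simp: adj_minus blinfun.bilinear_simps intro!: blinfun_eqI)
  then show ?thesis by (simp add: norm2_def)
qed

lemma norm2_commute: "x \<in> M \<Longrightarrow> y \<in> M \<Longrightarrow> norm2 \<phi> (x - y) = norm2 \<phi> (y - x)"
  using norm2_minus[of "x - y"] M_closed by simp

lemma norm2_diff_triangle: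
  "x \<in> M \<Longrightarrow> y \<in> M \<Longrightarrow> z \<in> M \<Longrightarrow> norm2 \<phi> (x - z) \<le> norm2 \<phi> (x - y) + norm2 \<phi> (y - z)"
  using norm2_triangle[of "x - y" "y - z"] M_closed by simp

text \<open>
  On bounded sets the two-norm is continuous for the strong topology, since \<open>\<phi> (y\<^sup>* y)\<close> is the value of a
  normal functional at a product with bounded left factor.
\<close>

lemma norm2_small:
  assumes e: "e > 0"
  obtains \<Xi> \<delta> where "finite \<Xi>" "\<delta> > 0"
    "\<And>y :: 'h op. y \<in> M \<Longrightarrow> norm y \<le> 2 \<Longrightarrow>
      (\<And>\<xi>. \<xi> \<in> \<Xi> \<Longrightarrow> norm (y \<cdot> \<xi>) < \<delta>) \<Longrightarrow> norm2 \<phi> y < e"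
proof -
  obtain \<Xi> \<delta> where D: "finite \<Xi>" "\<delta> > 0"
    "\<And>w y :: 'h op. w o\<^sub>L y \<in> M \<Longrightarrow> norm w \<le> 2 \<Longrightarrow> norm y \<le> 2 \<Longrightarrow>
      (\<And>\<xi>. \<xi> \<in> \<Xi> \<Longrightarrow> norm (y \<cdot> \<xi>) < \<delta>) \<Longrightarrow> cmod (\<phi> (w o\<^sub>L y)) < e\<^sup>2"
    by (rule predual_small[OF \<phi>_predual, of "e\<^sup>2"]) (use e in auto)
  show thesis
  proof (rule that[OF D(1,2)])
    fix y :: "'h op" assume y: "y \<in> M" "norm y \<le> 2" "\<And>\<xi>. \<xi> \<in> \<Xi> \<Longrightarrow> norm (y \<cdot> \<xi>) < \<delta>"
    have "cmod (\<phi> (adj y o\<^sub>L y)) < e\<^sup>2" by (rule D(3)) (use y M_closed in \<open>auto simp: norm_adj\<close>)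
    then have "(norm2 \<phi> y)\<^sup>2 < e\<^sup>2"
      unfolding norm2_sq[OF y(1)] using complex_Re_le_cmod order_le_less_trans by blast
    then show "norm2 \<phi> y < e" by (rule power2_less_imp_less) (use e in simp)
  qed
qed

end

text \<open>
  By the module property \<open>\<phi> ((E x)\<^sup>* (E x)) = \<phi> ((E x)\<^sup>* x)\<close>, and the Cauchy-Schwarz inequality applies.
\<close>

lemma (in expected_subalgebra) E_norm2_le:
  assumes x: "x \<in> M" shows "norm2 \<phi> (E x) \<le> norm2 \<phi> x"
proof -
  have Ex: "E x \<in> N" "E x \<in> M" "adj (E x) \<in> N" "adj (E x) \<in> M" using E_in[OF x] in_M N_closed by auto
  let ?r = "Re (\<phi> (adj (E x) o\<^sub>L E x))" and ?s = "Re (\<phi> (adj x o\<^sub>L x))"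
  have "\<phi> (adj (E x) o\<^sub>L E x) = \<phi> (adj (E x) o\<^sub>L x)"
    using \<phi>_E[of "adj (E x) o\<^sub>L x"] E_left[OF Ex(3) x] M_closed Ex x by simp
  then have "(cmod (\<phi> (adj (E x) o\<^sub>L E x)))\<^sup>2 \<le> ?r * ?s"
    using positive_functional_Cauchy_Schwarz[OF M \<phi>_positive Ex(2) x] by simp
  moreover have "?r \<le> cmod (\<phi> (adj (E x) o\<^sub>L E x))" by (rule complex_Re_le_cmod)
  moreover have r: "0 \<le> ?r" "0 \<le> ?s" using \<phi>_square Ex x by (auto simp: complex_nonneg_Reals_iff)
  ultimately have "?r\<^sup>2 \<le> ?r * ?s" by (meson order_trans power_mono)
  then have "?r \<le> ?s" using r unfolding power2_eq_square by (metis mult_le_cancel_left_pos order_le_less)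
  then show ?thesis unfolding norm2_def by (rule real_sqrt_le_mono)
qed

section \<open>The GNS space\<close>

context von_neumann_state begin

definition seq_dist :: "(nat \<Rightarrow> 'h op) \<Rightarrow> (nat \<Rightarrow> 'h op) \<Rightarrow> real" where
  "seq_dist s t = lim (\<lambda>n. norm2 \<phi> (s n - t n))"

abbreviation gns_class :: "'h op set \<Rightarrow> (nat \<Rightarrow> 'h op) \<Rightarrow> (nat \<Rightarrow> 'h op) set" where
  "gns_class N s \<equiv> gns_rel N \<phi> `` {s}"

context
  fixes N :: "'h op set"
  assumes N: "N \<subseteq> M"
begin

lemma gns_cauchy_in: "s \<in> gns_cauchy N \<phi> \<Longrightarrow> s n \<in> N" "s \<in> gns_cauchy N \<phi> \<Longrightarrow> s n \<in> M"
  using N by (auto simp: gns_cauchy_def)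

lemma gns_cauchyD:
  "s \<in> gns_cauchy N \<phi> \<Longrightarrow> e > 0 \<Longrightarrow> \<exists>K. \<forall>m\<ge>K. \<forall>n\<ge>K. norm2 \<phi> (s m - s n) < e"
  by (simp add: gns_cauchy_def)

lemma seq_dist_tendsto:
  assumes s: "s \<in> gns_cauchy N \<phi>" and t: "t \<in> gns_cauchy N \<phi>"
  shows "(\<lambda>n. norm2 \<phi> (s n - t n)) \<longlonglongrightarrow> seq_dist s t"
proof -
  note in_M = gns_cauchy_in(2)[OF s] gns_cauchy_in(2)[OF t] M_closed
  have "Cauchy (\<lambda>n. norm2 \<phi> (s n - t n))"
  proof (rule metric_CauchyI)
    fix e :: real assume "e > 0"
    then have e: "e / 2 > 0" by simp
    obtain K where K: "\<And>m n. m \<ge> K \<Longrightarrow> n \<ge> K \<Longrightarrow> norm2 \<phi> (s m - s n) < e / 2"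
      using gns_cauchyD[OF s e] by blast
    obtain L where L: "\<And>m n. m \<ge> L \<Longrightarrow> n \<ge> L \<Longrightarrow> norm2 \<phi> (t m - t n) < e / 2"
      using gns_cauchyD[OF t e] by blast
    have half: "norm2 \<phi> (s m - t m) < norm2 \<phi> (s n - t n) + e" if "m \<ge> max K L" "n \<ge> max K L" for m n
    proof -
      have "norm2 \<phi> (s m - t m) \<le> norm2 \<phi> (s m - s n) + norm2 \<phi> (s n - t m)"
        by (rule norm2_diff_triangle) (use in_M in auto)
      also have "norm2 \<phi> (s n - t m) \<le> norm2 \<phi> (s n - t n) + norm2 \<phi> (t n - t m)"
        by (rule norm2_diff_triangle) (use in_M in auto)
      finally show ?thesis using K[of m n] L[of n m] that by simp
    qed
    show "\<exists>M. \<forall>m\<ge>M. \<forall>n\<ge>M. dist (norm2 \<phi> (s m - t m)) (norm2 \<phi> (s n - t n)) < e"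
    proof (intro exI[of _ "max K L"] allI impI)
      fix m n assume mn: "m \<ge> max K L" "n \<ge> max K L"
      show "dist (norm2 \<phi> (s m - t m)) (norm2 \<phi> (s n - t n)) < e"
        using half[OF mn] half[OF mn(2,1)] unfolding dist_real_def by linarith
    qed
  qed
  then show ?thesis
    unfolding seq_dist_def using Cauchy_convergent convergent_LIMSEQ_iff by blast
qed

lemma seq_dist_metric:
  assumes s: "s \<in> gns_cauchy N \<phi>" and t: "t \<in> gns_cauchy N \<phi>" and u: "u \<in> gns_cauchy N \<phi>"
  shows "0 \<le> seq_dist s t" "seq_dist s t = seq_dist t s" "seq_dist s s = 0"
    "seq_dist s u \<le> seq_dist s t + seq_dist t u"
proof -
  note in_M = gns_cauchy_in(2)[OF s] gns_cauchy_in(2)[OF t] gns_cauchy_in(2)[OF u] M_closed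
  show "0 \<le> seq_dist s t"
    by (rule LIMSEQ_le_const[OF seq_dist_tendsto[OF s t]]) (use in_M norm2_nonneg in auto)
  show "seq_dist s t = seq_dist t s"
    unfolding seq_dist_def using norm2_commute in_M by simp
  show "seq_dist s s = 0" by (simp add: seq_dist_def)
  show "seq_dist s u \<le> seq_dist s t + seq_dist t u"
    by (rule LIMSEQ_le[OF seq_dist_tendsto[OF s u] tendsto_add[OF seq_dist_tendsto[OF s t] seq_dist_tendsto[OF t u]]])
      (intro exI allI impI norm2_diff_triangle in_M)
qed

lemma gns_rel_iff:
  "(s, t) \<in> gns_rel N \<phi> \<longleftrightarrow> s \<in> gns_cauchy N \<phi> \<and> t \<in> gns_cauchy N \<phi> \<and> seq_dist s t = 0"
  unfolding gns_rel_def using seq_dist_tendsto LIMSEQ_unique by fastforce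

lemma equiv_gns_rel: "equiv (gns_cauchy N \<phi>) (gns_rel N \<phi>)"
proof (rule equivI)
  show "gns_rel N \<phi> \<subseteq> gns_cauchy N \<phi> \<times> gns_cauchy N \<phi>" by (auto simp: gns_rel_iff)
  show "refl_on (gns_cauchy N \<phi>) (gns_rel N \<phi>)"
    by (auto simp: refl_on_def gns_rel_iff seq_dist_metric(3))
  show "sym (gns_rel N \<phi>)" by (auto simp: sym_def gns_rel_iff seq_dist_metric(2))
  show "trans (gns_rel N \<phi>)"
  proof (rule transI)
    fix s t u assume "(s, t) \<in> gns_rel N \<phi>" "(t, u) \<in> gns_rel N \<phi>"
    then show "(s, u) \<in> gns_rel N \<phi>"
      using seq_dist_metric(4)[of s t u] seq_dist_metric(1)[of s u u] by (auto simp: gns_rel_iff)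
  qed
qed

lemma gns_class_in_L2: "s \<in> gns_cauchy N \<phi> \<Longrightarrow> gns_class N s \<in> L2 N \<phi>"
  unfolding L2_def by (rule quotientI)

lemma L2_cases:
  assumes "a \<in> L2 N \<phi>" obtains s where "s \<in> gns_cauchy N \<phi>" "a = gns_class N s"
  using assms unfolding L2_def by (rule quotientE) (rule that)

lemma L2_dist_class:
  assumes s: "s \<in> gns_cauchy N \<phi>" and t: "t \<in> gns_cauchy N \<phi>"
  shows "L2_dist N \<phi> (gns_class N s) (gns_class N t) = seq_dist s t"
proof -
  have "(THE d. \<exists>s'\<in>gns_class N s. \<exists>t'\<in>gns_class N t. (\<lambda>n. norm2 \<phi> (s' n - t' n)) \<longlonglongrightarrow> d) = seq_dist s t"
  proof (rule the_equality)
    show "\<exists>s'\<in>gns_class N s. \<exists>t'\<in>gns_class N t. (\<lambda>n. norm2 \<phi> (s' n - t' n)) \<longlonglongrightarrow> seq_dist s t"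
    proof (rule bexI[of _ s], rule bexI[of _ t])
      show "s \<in> gns_class N s" "t \<in> gns_class N t" using s t by (auto simp: gns_rel_iff seq_dist_metric(3))
    qed (rule seq_dist_tendsto[OF s t])
    fix d assume "\<exists>s'\<in>gns_class N s. \<exists>t'\<in>gns_class N t. (\<lambda>n. norm2 \<phi> (s' n - t' n)) \<longlonglongrightarrow> d"
    then obtain s' t' where st: "s' \<in> gns_cauchy N \<phi>" "t' \<in> gns_cauchy N \<phi>" "seq_dist s s' = 0" "seq_dist t t' = 0"
      "(\<lambda>n. norm2 \<phi> (s' n - t' n)) \<longlonglongrightarrow> d" by (auto simp: gns_rel_iff)
    then have "d = seq_dist s' t'" using seq_dist_tendsto LIMSEQ_unique by blast
    also have "\<dots> = seq_dist s t"
      using seq_dist_metric(4)[OF s st(1) t] seq_dist_metric(4)[OF st(1,2) t]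
        seq_dist_metric(4)[OF st(1) s st(2)] seq_dist_metric(4)[OF s t st(2)]
        seq_dist_metric(2)[OF s st(1) t] seq_dist_metric(2)[OF t st(2) t] st(3,4) by linarith
    finally show "d = seq_dist s t" .
  qed
  then show ?thesis unfolding L2_dist_def using gns_class_in_L2 s t by simp
qed

lemma gns_class_eq_iff:
  assumes "s \<in> gns_cauchy N \<phi>" "t \<in> gns_cauchy N \<phi>"
  shows "gns_class N s = gns_class N t \<longleftrightarrow> seq_dist s t = 0"
  using eq_equiv_class_iff[OF equiv_gns_rel assms] assms by (simp add: gns_rel_iff)

lemma Metric_space_L2: "Metric_space (L2 N \<phi>) (L2_dist N \<phi>)"
proof
  fix a b c
  show "0 \<le> L2_dist N \<phi> a b"
  proof (cases "a \<in> L2 N \<phi> \<and> b \<in> L2 N \<phi>")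
    case True
    then show ?thesis by (auto elim!: L2_cases simp: L2_dist_class seq_dist_metric(1))
  qed (auto simp: L2_dist_def)
  show "L2_dist N \<phi> a b = L2_dist N \<phi> b a"
  proof (cases "a \<in> L2 N \<phi> \<and> b \<in> L2 N \<phi>")
    case True
    then show ?thesis by (auto elim!: L2_cases simp: L2_dist_class seq_dist_metric(2))
  qed (auto simp: L2_dist_def)
  show "L2_dist N \<phi> a b = 0 \<longleftrightarrow> a = b" if ab: "a \<in> L2 N \<phi>" "b \<in> L2 N \<phi>"
  proof -
    obtain s where s: "s \<in> gns_cauchy N \<phi>" "a = gns_class N s" using ab(1) by (rule L2_cases)
    obtain t where t: "t \<in> gns_cauchy N \<phi>" "b = gns_class N t" using ab(2) by (rule L2_cases)
    show ?thesis unfolding s(2) t(2) L2_dist_class[OF s(1) t(1)] gns_class_eq_iff[OF s(1) t(1)] ..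
  qed
  show "L2_dist N \<phi> a c \<le> L2_dist N \<phi> a b + L2_dist N \<phi> b c"
    if "a \<in> L2 N \<phi>" "b \<in> L2 N \<phi>" "c \<in> L2 N \<phi>"
    using that by (auto elim!: L2_cases simp: L2_dist_class intro: seq_dist_metric(4))
qed

lemma topspace_L2: "topspace (L2_topology N \<phi>) = L2 N \<phi>"
  unfolding L2_topology_def by (rule Metric_space.topspace_mtopology[OF Metric_space_L2])

lemma const_gns_cauchy: "x \<in> N \<Longrightarrow> (\<lambda>_. x) \<in> gns_cauchy N \<phi>"
  by (auto simp: gns_cauchy_def)

end

text \<open>
  The map of GNS spaces that takes the class of a sequence \<open>s\<close> to the class of \<open>F \<circ> s\<close>, defined through a
  representative.
\<close>

definition gns_map ::
    "'h op set \<Rightarrow> ('h op \<Rightarrow> 'h op) \<Rightarrow> (nat \<Rightarrow> 'h op) set \<Rightarrow> (nat \<Rightarrow> 'h op) set" where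
  "gns_map N F a = gns_class N (\<lambda>n. F ((SOME s. s \<in> a) n))"

definition two_norm_contraction :: "'h op set \<Rightarrow> 'h op set \<Rightarrow> ('h op \<Rightarrow> 'h op) \<Rightarrow> bool" where
  "two_norm_contraction N N' F \<longleftrightarrow> (\<forall>x\<in>N. F x \<in> N') \<and> (\<forall>x\<in>N. \<forall>y\<in>N. F (x - y) = F x - F y) \<and>
     (\<forall>x\<in>N. norm2 \<phi> (F x) \<le> norm2 \<phi> x)"

context
  fixes N N' F
  assumes N: "von_neumann_algebra N" "N \<subseteq> M" and N': "N' \<subseteq> M" and F: "two_norm_contraction N N' F"
begin

lemma gns_map_cauchy:
  assumes "s \<in> gns_cauchy N \<phi>" shows "(\<lambda>n. F (s n)) \<in> gns_cauchy N' \<phi>"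
proof -
  note s = gns_cauchy_in(1)[OF N(2) assms]
  have le: "norm2 \<phi> (F (s m) - F (s n)) \<le> norm2 \<phi> (s m - s n)" for m n
    using F s[of m] s[of n] von_neumann_closed(9)[OF N(1)] unfolding two_norm_contraction_def by metis
  show ?thesis
    unfolding gns_cauchy_def
  proof (intro CollectI conjI allI impI)
    show "range (\<lambda>n. F (s n)) \<subseteq> N'" using F s by (auto simp: two_norm_contraction_def)
    fix e :: real assume "e > 0"
    then obtain K where "\<forall>m\<ge>K. \<forall>n\<ge>K. norm2 \<phi> (s m - s n) < e"
      using gns_cauchyD[OF N(2) assms] by blast
    then show "\<exists>K. \<forall>m\<ge>K. \<forall>n\<ge>K. norm2 \<phi> (F (s m) - F (s n)) < e"
      by (intro exI[of _ K] allI impI) (rule order_le_less_trans[OF le], simp)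
  qed
qed

lemma gns_map_dist:
  assumes s: "s \<in> gns_cauchy N \<phi>" and t: "t \<in> gns_cauchy N \<phi>"
  shows "seq_dist (\<lambda>n. F (s n)) (\<lambda>n. F (t n)) \<le> seq_dist s t"
proof (rule LIMSEQ_le[OF seq_dist_tendsto[OF N' gns_map_cauchy[OF s] gns_map_cauchy[OF t]]
      seq_dist_tendsto[OF N(2) s t]])
  have "norm2 \<phi> (F (s n) - F (t n)) \<le> norm2 \<phi> (s n - t n)" for n
    using F gns_cauchy_in(1)[OF N(2) s, of n] gns_cauchy_in(1)[OF N(2) t, of n]
      von_neumann_closed(9)[OF N(1)] unfolding two_norm_contraction_def by metis
  then show "\<exists>K. \<forall>n\<ge>K. norm2 \<phi> (F (s n) - F (t n)) \<le> norm2 \<phi> (s n - t n)" by blast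
qed

lemma gns_map_class:
  assumes s: "s \<in> gns_cauchy N \<phi>" shows "gns_map N' F (gns_class N s) = gns_class N' (\<lambda>n. F (s n))"
proof -
  define t where "t = (SOME t. t \<in> gns_class N s)"
  have "s \<in> gns_class N s" using s N(2) by (simp add: gns_rel_iff seq_dist_metric(3))
  then have "t \<in> gns_class N s" unfolding t_def by (rule someI[of "\<lambda>t. t \<in> gns_class N s"])
  then have t: "t \<in> gns_cauchy N \<phi>" "seq_dist s t = 0" using N(2) by (auto simp: gns_rel_iff)
  have "seq_dist (\<lambda>n. F (s n)) (\<lambda>n. F (t n)) = 0"
    using gns_map_dist[OF s t(1)] t(2) seq_dist_metric(1)[OF N' gns_map_cauchy[OF s] gns_map_cauchy[OF t(1)] gns_map_cauchy[OF s]]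
    by simp
  then show ?thesis
    unfolding gns_map_def t_def[symmetric]
    using gns_class_eq_iff[OF N' gns_map_cauchy[OF s] gns_map_cauchy[OF t(1)]] by simp
qed

lemma gns_map_L2: "a \<in> L2 N \<phi> \<Longrightarrow> gns_map N' F a \<in> L2 N' \<phi>"
  using gns_map_class gns_class_in_L2[OF N'] gns_map_cauchy by (metis L2_cases[OF N(2)])

lemma gns_map_dist_le:
  assumes "a \<in> L2 N \<phi>" "b \<in> L2 N \<phi>"
  shows "L2_dist N' \<phi> (gns_map N' F a) (gns_map N' F b) \<le> L2_dist N \<phi> a b"
proof -
  obtain s t where st: "s \<in> gns_cauchy N \<phi>" "a = gns_class N s" "t \<in> gns_cauchy N \<phi>" "b = gns_class N t"
    using assms by (metis L2_cases[OF N(2)])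
  then show ?thesis
    using gns_map_dist by (simp add: gns_map_class L2_dist_class[OF N'] L2_dist_class[OF N(2)] gns_map_cauchy)
qed

lemma gns_map_vec: "x \<in> N \<Longrightarrow> gns_map N' F (gns_vec N \<phi> x) = gns_vec N' \<phi> (F x)"
  unfolding gns_vec_def using gns_map_class const_gns_cauchy[OF N(2)] by simp

lemma gns_map_continuous: "continuous_map (L2_topology N \<phi>) (L2_topology N' \<phi>) (gns_map N' F)"
  unfolding L2_topology_def
  Metric_space.metric_continuous_map[OF Metric_space_L2[OF N(2)] Metric_space_L2[OF N']]
proof (intro conjI ballI allI impI)
  show "gns_map N' F ` L2 N \<phi> \<subseteq> L2 N' \<phi>" using gns_map_L2 by blast
  fix a e assume "a \<in> L2 N \<phi>" "(e::real) > 0"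
  then show "\<exists>\<delta>>0. \<forall>x. x \<in> L2 N \<phi> \<and> L2_dist N \<phi> a x < \<delta> \<longrightarrow> L2_dist N' \<phi> (gns_map N' F a) (gns_map N' F x) < e"
    using gns_map_dist_le order_le_less_trans by (intro exI[of _ e]) blast
qed

end

text \<open>
  The extension is the composition of the maps of GNS spaces induced by \<open>F\<close>, \<open>\<Phi>\<close> and \<open>E\<close>. The first one
  maps the unit ball into the unit ball and the last one is continuous, so the image of the unit ball lies in
  a continuous image of a compact set.
\<close>

lemma compact_extension_transfer:
  assumes N: "von_neumann_algebra N" "N \<subseteq> M" and N': "von_neumann_algebra N'" "N' \<subseteq> M"
    and F: "two_norm_contraction N N' F" and E: "two_norm_contraction N' N E"
    and \<Phi>: "\<And>x. x \<in> N' \<Longrightarrow> \<Phi> x \<in> N'"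
    and T: "gns_extension N' \<phi> \<Phi> T" "L2_compact N' \<phi> T"
  obtains T' where "gns_extension N \<phi> (\<lambda>x. E (\<Phi> (F x))) T'" "L2_compact N \<phi> T'"
proof -
  let ?F = "gns_map N' F" and ?E = "gns_map N E"
  let ?T = "?E \<circ> (T \<circ> ?F)"
  note cF = gns_map_continuous[OF N N'(2) F] and cE = gns_map_continuous[OF N' N(2) E]
  have cT: "continuous_map (L2_topology N' \<phi>) (L2_topology N' \<phi>) T"
    and vT: "\<And>x. x \<in> N' \<Longrightarrow> T (gns_vec N' \<phi> x) = gns_vec N' \<phi> (\<Phi> x)"
    using T(1) by (auto simp: gns_extension_def)
  have FN: "F x \<in> N'" if "x \<in> N" for x using F that by (simp add: two_norm_contraction_def)
  have "gns_extension N \<phi> (\<lambda>x. E (\<Phi> (F x))) ?T"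
    unfolding gns_extension_def
    using continuous_map_compose[OF continuous_map_compose[OF cF cT] cE]
    by (auto simp: gns_map_vec[OF N N'(2) F] gns_map_vec[OF N' N(2) E] vT FN \<Phi>)
  moreover have "L2_compact N \<phi> ?T"
  proof -
    let ?B = "\<lambda>N. {a \<in> L2 N \<phi>. L2_dist N \<phi> a (gns_vec N \<phi> 0) \<le> 1}"
    let ?K = "L2_topology N' \<phi> closure_of (T ` ?B N')"
    have F0: "F 0 = 0"
    proof -
      have "F (0 - 0) = F 0 - F 0" using F von_neumann_closed(7)[OF N(1)] unfolding two_norm_contraction_def by blast
      then show ?thesis by simp
    qed
    have vec0: "gns_vec N \<phi> 0 \<in> L2 N \<phi>"
      unfolding gns_vec_def using gns_class_in_L2[OF N(2)] const_gns_cauchy[OF N(2)] von_neumann_closed(7)[OF N(1)] by blast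
    have FB: "?F a \<in> ?B N'" if "a \<in> ?B N" for a
    proof -
      have a: "a \<in> L2 N \<phi>" "L2_dist N \<phi> a (gns_vec N \<phi> 0) \<le> 1" using that by auto
      have "L2_dist N' \<phi> (?F a) (?F (gns_vec N \<phi> 0)) \<le> 1"
        using gns_map_dist_le[OF N N'(2) F a(1) vec0] a(2) by linarith
      then show ?thesis
        using gns_map_L2[OF N N'(2) F a(1)] gns_map_vec[OF N N'(2) F von_neumann_closed(7)[OF N(1)]] F0 by simp
    qed
    have TB: "T ` ?B N' \<subseteq> topspace (L2_topology N' \<phi>)"
      using continuous_map_image_subset_topspace[OF cT] unfolding topspace_L2[OF N'(2)] by blast
    have sub: "?T ` ?B N \<subseteq> ?E ` ?K"
      using FB closure_of_subset[OF TB] by (auto simp del: mem_Collect_eq)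
    have comp: "compactin (L2_topology N \<phi>) (?E ` ?K)"
      by (rule image_compactin[OF _ cE]) (use T(2) in \<open>simp add: L2_compact_def\<close>)
    have "Hausdorff_space (L2_topology N \<phi>)"
      unfolding L2_topology_def by (rule Metric_space.Hausdorff_space_mtopology[OF Metric_space_L2[OF N(2)]])
    then have "closedin (L2_topology N \<phi>) (?E ` ?K)" using comp by (rule compactin_imp_closedin)
    then have "L2_topology N \<phi> closure_of (?T ` ?B N) \<subseteq> ?E ` ?K" using sub by (simp add: closure_of_minimal)
    then show ?thesis
      unfolding L2_compact_def by (rule closed_compactin[OF comp _ closedin_closure_of])
  qed
  ultimately show thesis by (rule that)
qed

end

section \<open>Amenability and the Haagerup property\<close>

context expected_subalgebra begin

lemma E_contraction: "K \<subseteq> M \<Longrightarrow> two_norm_contraction K N E"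
  using E_in E_diff E_norm2_le by (auto simp: two_norm_contraction_def subset_eq)

lemma E_restrict_normal_ucp: "K \<subseteq> M \<Longrightarrow> normal_ucp (vn K) (vn N) E"
  using normal_ucp_comp[OF normal_ucp_inclusion E_normal_ucp] .

lemma E_image_ball: "X \<subseteq> K \<inter> cball 0 1 \<Longrightarrow> K \<subseteq> M \<Longrightarrow> E ` X \<subseteq> N \<inter> cball 0 1"
  using E_in E_norm_le order_trans by (fastforce simp: subset_eq)

lemma E_close:
  assumes "x \<in> M" "norm x \<le> 1" shows "E x - x \<in> M" "norm (E x - x) \<le> 2"
  using E_in[OF assms(1)] in_M M_closed assms E_norm_le[OF assms(1)] norm_triangle_ineq4[of "E x" x] by auto

end

context von_neumann_state begin

text \<open>
  The functional \<open>g = \<eta> \<circ> E\<close> is normal on \<open>M\<close>. It serves twice: as the functional for which \<open>N'\<close> is tested, and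
  to choose the neighbourhood in which \<open>g (F x - x)\<close> is small. The two errors add up to
  \<open>\<eta> (E (\<Psi> (\<Phi> (F x))) - x)\<close>.
\<close>

lemma closedin_amenable: "closedin (expectation_topology M \<phi>) {N \<in> expected_subalgebras M \<phi>. amenable N}"
proof (rule closedin_expectation_topologyI)
  fix N assume N: "N \<in> expected_subalgebras M \<phi>"
    and adherent: "adherent amenable N"
  let ?E = "cond_exp M \<phi> N"
  interpret E: expected_subalgebra M \<phi> N ?E by (rule cond_exp_expected[OF N])
  show "amenable N"
    unfolding amenable_def
  proof (intro ballI allI impI)
    fix \<eta> and e :: real and X
    assume \<eta>: "\<eta> \<in> op_predual N" and e: "e > 0" and X: "finite X \<and> X \<subseteq> N \<inter> cball 0 1"
    define g where "g x = \<eta> (?E x)" for x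
    have g: "g \<in> op_predual M" unfolding g_def by (rule E.expectation_normal[OF \<eta>])
    obtain \<Xi> \<delta> where D: "finite \<Xi>" "\<delta> > 0"
      "\<And>w y :: 'h op. w o\<^sub>L y \<in> M \<Longrightarrow> norm w \<le> 2 \<Longrightarrow> norm y \<le> 2 \<Longrightarrow>
        (\<And>\<xi>. \<xi> \<in> \<Xi> \<Longrightarrow> norm (y \<cdot> \<xi>) < \<delta>) \<Longrightarrow> cmod (g (w o\<^sub>L y)) < e / 2"
      by (rule predual_small[OF g, of "e / 2"]) (use e in auto)
    have XM: "X \<subseteq> M" using X E.NM by auto
    obtain N' where N': "N' \<in> expected_subalgebras M \<phi>" "amenable N'"
      and close: "\<And>x \<xi>. x \<in> X \<Longrightarrow> \<xi> \<in> \<Xi> \<Longrightarrow> norm ((cond_exp M \<phi> N' x - ?E x) \<cdot> \<xi>) < \<delta>"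
      using adherentE[OF adherent _ XM D(1,2)] X by blast
    let ?F = "cond_exp M \<phi> N'"
    interpret F: expected_subalgebra M \<phi> N' ?F by (rule cond_exp_expected[OF N'(1)])
    have FX: "finite (?F ` X) \<and> ?F ` X \<subseteq> N' \<inter> cball 0 1"
      using F.E_image_ball[of X N] X E.NM by blast
    have "g \<in> op_predual N'" by (rule op_predual_mono[OF F.NM g])
    then obtain n \<Phi> \<Psi> where n: "n \<ge> 1" and \<Phi>: "normal_ucp (vn N') (matrix_alg n) \<Phi>"
      and \<Psi>: "normal_ucp (matrix_alg n) (vn N') \<Psi>"
      and est: "\<And>x. x \<in> ?F ` X \<Longrightarrow> cmod (g (\<Psi> (\<Phi> x) - x)) < e / 2"
      using N'(2) FX e unfolding amenable_def by (meson half_gt_zero)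
    have \<Psi>\<Phi>: "\<Psi> (\<Phi> y) \<in> N'" if "y \<in> N'" for y
      using \<Phi> \<Psi> that by (auto simp: normal_ucp_def ucp_def linear_map_def Pi_iff)
    show "\<exists>n\<ge>1. \<exists>\<Phi> \<Psi>. normal_ucp (vn N) (matrix_alg n) \<Phi> \<and> normal_ucp (matrix_alg n) (vn N) \<Psi> \<and>
        (\<forall>x\<in>X. cmod (\<eta> (\<Psi> (\<Phi> x) - x)) < e)"
    proof (intro exI conjI ballI)
      show "1 \<le> n" by (rule n)
      show "normal_ucp (vn N) (matrix_alg n) (\<lambda>x. \<Phi> (?F x))"
        by (rule normal_ucp_comp[OF F.E_restrict_normal_ucp[OF E.NM] \<Phi>])
      show "normal_ucp (matrix_alg n) (vn N) (\<lambda>x. ?E (\<Psi> x))"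
        by (rule normal_ucp_comp[OF \<Psi> E.E_restrict_normal_ucp[OF F.NM]])
      fix x assume x: "x \<in> X"
      have xN: "x \<in> N" "norm x \<le> 1" using X x by auto
      have xM: "x \<in> M" using xN E.in_M by blast
      have y: "\<Psi> (\<Phi> (?F x)) \<in> M" "?F x \<in> M" using \<Psi>\<Phi> F.E_in xM F.in_M by auto
      have "id_blinfun o\<^sub>L (?F x - x) = ?F x - x" by (simp add: comp_simps)
      moreover have "norm (id_blinfun :: 'h op) \<le> 2"
        by (rule norm_blinfun_bound) auto
      ultimately have "cmod (g (?F x - x)) < e / 2"
        using D(3)[of id_blinfun "?F x - x"] F.E_close[OF xM xN(2)] close[OF x] E.E_fix[OF xN(1)] by simp
      moreover have "cmod (g (\<Psi> (\<Phi> (?F x)) - ?F x)) < e / 2" using est x by blast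
      moreover have "\<eta> (?E (\<Psi> (\<Phi> (?F x))) - x) = g (\<Psi> (\<Phi> (?F x)) - ?F x) + g (?F x - x)"
      proof -
        have "?E (\<Psi> (\<Phi> (?F x))) - x = ?E (\<Psi> (\<Phi> (?F x)) - x)"
          using y xM by (simp add: E.E_diff E.E_fix xN)
        also have "\<eta> \<dots> = g (\<Psi> (\<Phi> (?F x)) - ?F x + (?F x - x))" by (simp add: g_def)
        also have "\<dots> = g (\<Psi> (\<Phi> (?F x)) - ?F x) + g (?F x - x)"
          by (rule op_predual_linear(1)[OF g]) (use y xM M_closed in auto)
        finally show ?thesis .
      qed
      ultimately show "cmod (\<eta> (?E (\<Psi> (\<Phi> (?F x))) - x)) < e"
        using norm_triangle_ineq[of "g (\<Psi> (\<Phi> (?F x)) - ?F x)" "g (?F x - x)"] by simp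
    qed
  qed
qed

text \<open>
  The estimate shared by the Haagerup property and the completely bounded approximation: for \<open>N'\<close>
  close to \<open>N\<close>, a map that moves \<open>F x\<close> by less than \<open>e / 2\<close> gives, after composition with \<open>F\<close> and \<open>E\<close>, a map that
  moves \<open>x\<close> by less than \<open>e\<close>.
\<close>

lemma norm2_approximation:
  assumes N: "N \<in> expected_subalgebras M \<phi>" and e: "e > 0" and X: "finite X" "X \<subseteq> N \<inter> cball 0 1"
    and adherent: "adherent P N"
  obtains N' where "N' \<in> expected_subalgebras M \<phi>" "P N'"
    "cond_exp M \<phi> N' ` X \<subseteq> N' \<inter> cball 0 1"
    "\<And>\<Phi> x. x \<in> X \<Longrightarrow> \<Phi> (cond_exp M \<phi> N' x) \<in> N' \<Longrightarrow>
       norm2 \<phi> (\<Phi> (cond_exp M \<phi> N' x) - cond_exp M \<phi> N' x) < e / 2 \<Longrightarrow>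
       norm2 \<phi> (cond_exp M \<phi> N (\<Phi> (cond_exp M \<phi> N' x)) - x) < e"
proof -
  let ?E = "cond_exp M \<phi> N"
  interpret E: expected_subalgebra M \<phi> N ?E by (rule cond_exp_expected[OF N])
  obtain \<Xi> \<delta> where D: "finite \<Xi>" "\<delta> > 0"
    "\<And>y :: 'h op. y \<in> M \<Longrightarrow> norm y \<le> 2 \<Longrightarrow>
        (\<And>\<xi>. \<xi> \<in> \<Xi> \<Longrightarrow> norm (y \<cdot> \<xi>) < \<delta>) \<Longrightarrow> norm2 \<phi> y < e / 2"
    by (rule norm2_small[of "e / 2"]) (use e in auto)
  have XM: "X \<subseteq> M" using X E.NM by auto
  obtain N' where N': "N' \<in> expected_subalgebras M \<phi>" "P N'"
    and close: "\<And>x \<xi>. x \<in> X \<Longrightarrow> \<xi> \<in> \<Xi> \<Longrightarrow> norm ((cond_exp M \<phi> N' x - ?E x) \<cdot> \<xi>) < \<delta>"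
    using adherentE[OF adherent X(1) XM D(1,2)] by blast
  let ?F = "cond_exp M \<phi> N'"
  interpret F: expected_subalgebra M \<phi> N' ?F by (rule cond_exp_expected[OF N'(1)])
  show thesis
  proof (rule that[OF N'])
    show "?F ` X \<subseteq> N' \<inter> cball 0 1" by (rule F.E_image_ball[OF X(2) E.NM])
    fix \<Phi> x assume x: "x \<in> X" and \<Phi>: "\<Phi> (?F x) \<in> N'" and est: "norm2 \<phi> (\<Phi> (?F x) - ?F x) < e / 2"
    have xN: "x \<in> N" "norm x \<le> 1" using X x by auto
    have xM: "x \<in> M" using xN E.in_M by blast
    have y: "\<Phi> (?F x) \<in> M" "?F x \<in> M" using \<Phi> F.E_in xM F.in_M by auto
    have small: "norm2 \<phi> (?F x - x) < e / 2"
      using D(3)[of "?F x - x"] F.E_close[OF xM xN(2)] close[OF x] E.E_fix[OF xN(1)] by simp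
    have "?E (\<Phi> (?F x)) - x = ?E (\<Phi> (?F x) - x)" using y xM by (simp add: E.E_diff E.E_fix xN)
    then have "norm2 \<phi> (?E (\<Phi> (?F x)) - x) \<le> norm2 \<phi> (\<Phi> (?F x) - x)"
      using E.E_norm2_le y xM M_closed by simp
    also have "\<dots> \<le> norm2 \<phi> (\<Phi> (?F x) - ?F x) + norm2 \<phi> (?F x - x)"
      by (rule norm2_diff_triangle[OF y xM])
    finally show "norm2 \<phi> (?E (\<Phi> (?F x)) - x) < e" using est small by simp
  qed
qed

lemma closedin_haagerup:
  "closedin (expectation_topology M \<phi>) {N \<in> expected_subalgebras M \<phi>. haagerup_property N \<phi>}"
proof (rule closedin_expectation_topologyI)
  fix N assume N: "N \<in> expected_subalgebras M \<phi>"
    and adherent: "adherent (\<lambda>N. haagerup_property N \<phi>) N"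
  let ?E = "cond_exp M \<phi> N"
  interpret E: expected_subalgebra M \<phi> N ?E by (rule cond_exp_expected[OF N])
  show "haagerup_property N \<phi>"
    unfolding haagerup_property_def
  proof (intro allI impI)
    fix e :: real and X assume e: "e > 0" and X: "finite X \<and> X \<subseteq> N \<inter> cball 0 1"
    obtain N' where N': "N' \<in> expected_subalgebras M \<phi>" "haagerup_property N' \<phi>"
      "cond_exp M \<phi> N' ` X \<subseteq> N' \<inter> cball 0 1"
      "\<And>\<Phi> x. x \<in> X \<Longrightarrow> \<Phi> (cond_exp M \<phi> N' x) \<in> N' \<Longrightarrow>
         norm2 \<phi> (\<Phi> (cond_exp M \<phi> N' x) - cond_exp M \<phi> N' x) < e / 2 \<Longrightarrow>
         norm2 \<phi> (?E (\<Phi> (cond_exp M \<phi> N' x)) - x) < e"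
      by (rule norm2_approximation[OF N e _ _ adherent, of X]) (use X in auto)
    let ?F = "cond_exp M \<phi> N'"
    interpret F: expected_subalgebra M \<phi> N' ?F by (rule cond_exp_expected[OF N'(1)])
    have "finite (?F ` X) \<and> ?F ` X \<subseteq> N' \<inter> cball 0 1" using N'(3) X by blast
    then obtain \<Phi> T where \<Phi>: "normal_ucp (vn N') (vn N') \<Phi>"
      and dec: "\<And>x. x \<in> N' \<Longrightarrow> positive_op x \<Longrightarrow> \<phi> x - \<phi> (\<Phi> x) \<in> \<real>\<^sub>\<ge>\<^sub>0"
      and T: "gns_extension N' \<phi> \<Phi> T" "L2_compact N' \<phi> T"
      and est: "\<And>x. x \<in> ?F ` X \<Longrightarrow> norm2 \<phi> (\<Phi> x - x) < e / 2"
      using N'(2) e unfolding haagerup_property_def by (meson half_gt_zero)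
    have \<Phi>N: "\<Phi> y \<in> N'" if "y \<in> N'" for y
      using \<Phi> that by (auto simp: normal_ucp_def ucp_def linear_map_def)
    obtain T' where T': "gns_extension N \<phi> (\<lambda>x. ?E (\<Phi> (?F x))) T'" "L2_compact N \<phi> T'"
      using compact_extension_transfer[OF E.N E.NM F.N F.NM F.E_contraction[OF E.NM] E.E_contraction[OF F.NM] \<Phi>N T]
      by blast
    show "\<exists>\<Phi>. normal_ucp (vn N) (vn N) \<Phi> \<and> (\<forall>x\<in>N. positive_op x \<longrightarrow> \<phi> x - \<phi> (\<Phi> x) \<in> \<real>\<^sub>\<ge>\<^sub>0) \<and>
       (\<exists>T. gns_extension N \<phi> \<Phi> T \<and> L2_compact N \<phi> T) \<and> (\<forall>x\<in>X. norm2 \<phi> (\<Phi> x - x) < e)"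
    proof (intro exI conjI ballI impI)
      show "gns_extension N \<phi> (\<lambda>x. ?E (\<Phi> (?F x))) T'" "L2_compact N \<phi> T'" by (fact T')+
      show "normal_ucp (vn N) (vn N) (\<lambda>x. ?E (\<Phi> (?F x)))"
        by (rule normal_ucp_comp[OF normal_ucp_comp[OF F.E_restrict_normal_ucp[OF E.NM] \<Phi>]
              E.E_restrict_normal_ucp[OF F.NM]])
      fix x assume "x \<in> N" "positive_op x"
      then have x: "x \<in> M" "positive_op x" using E.in_M by auto
      have "\<phi> (?E (\<Phi> (?F x))) = \<phi> (\<Phi> (?F x))" by (intro E.\<phi>_E F.in_M \<Phi>N F.E_in x)
      moreover have "\<phi> (?F x) = \<phi> x" by (rule F.\<phi>_E[OF x(1)])
      ultimately show "\<phi> x - \<phi> (?E (\<Phi> (?F x))) \<in> \<real>\<^sub>\<ge>\<^sub>0"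
        using dec[OF F.E_in[OF x(1)] F.E_positive[OF x]] by simp
    next
      fix x assume x: "x \<in> X"
      then have "x \<in> M" using X E.in_M by blast
      then show "norm2 \<phi> (?E (\<Phi> (?F x)) - x) < e"
        using N'(4)[OF x, of \<Phi>] \<Phi>N F.E_in est x by blast
    qed
  qed
qed

section \<open>The Cowling-Haagerup constant\<close>

definition cb_approximable :: "'h op set \<Rightarrow> real \<Rightarrow> bool" where
  "cb_approximable A C \<longleftrightarrow> (\<forall>e>0. \<forall>X. finite X \<and> X \<noteq> {} \<and> X \<subseteq> A \<inter> cball 0 1 \<longrightarrow>
        (\<exists>\<Phi>. linear_map (vn A) (vn A) \<Phi> \<and> sigma_weakly_continuous (vn A) (vn A) \<Phi> \<and>
           finite_rank A \<Phi> \<and> (\<forall>x\<in>X. norm2 \<phi> (\<Phi> x - x) < e) \<and>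
           cb_norm A \<Phi> \<le> ennreal C))"

lemma cb_approximable_mono: "cb_approximable A C \<Longrightarrow> C \<le> C' \<Longrightarrow> cb_approximable A C'"
  unfolding cb_approximable_def by (meson ennreal_leI order_trans)

lemma Lambda_cb_eq: "Lambda_cb A \<phi> = Inf {ennreal C | C. C > 0 \<and> cb_approximable A C}"
  by (simp add: Lambda_cb_def cb_approximable_def)

text \<open>
  The infimum in the definition need not be attained, so only bounds larger than \<open>C\<close> are available for
  the approximating maps.
\<close>

lemma Lambda_cb_le_iff:
  assumes "C \<ge> 0" shows "Lambda_cb A \<phi> \<le> ennreal C \<longleftrightarrow> (\<forall>C'>C. cb_approximable A C')"
proof
  assume le: "Lambda_cb A \<phi> \<le> ennreal C"
  show "\<forall>C'>C. cb_approximable A C'"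
  proof (intro allI impI)
    fix C' assume "C' > C"
    then have "Lambda_cb A \<phi> < ennreal C'" using le assms by (simp add: ennreal_lessI le_less_trans)
    then obtain D where "D > 0" "cb_approximable A D" "ennreal D < ennreal C'"
      unfolding Lambda_cb_eq Inf_less_iff by blast
    then show "cb_approximable A C'"
      using cb_approximable_mono ennreal_less_iff by (meson less_imp_le)
  qed
next
  assume *: "\<forall>C'>C. cb_approximable A C'"
  show "Lambda_cb A \<phi> \<le> ennreal C"
  proof (rule ennreal_le_epsilon)
    fix e :: real assume e: "e > 0"
    then have "ennreal (C + e) \<in> {ennreal C | C. C > 0 \<and> cb_approximable A C}"
      using * assms by (intro CollectI exI[of _ "C + e"]) simp
    then have "Lambda_cb A \<phi> \<le> ennreal (C + e)" unfolding Lambda_cb_eq by (rule Inf_lower)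
    then show "Lambda_cb A \<phi> \<le> ennreal C + ennreal e" using assms e by simp
  qed
qed

text \<open>
  The finite set spanning the range of \<open>\<Phi>\<close> may consist of operators outside \<open>M\<close>, about which \<open>E\<close> says nothing.
  It is therefore exchanged for a real basis chosen among the values of \<open>\<Phi>\<close>.
\<close>

lemma finite_rank_transfer:
  assumes rank: "finite_rank A \<Phi>" and A: "von_neumann_algebra A"
    and F: "\<And>x. x \<in> N \<Longrightarrow> F x \<in> A" and \<Phi>: "\<And>x. x \<in> A \<Longrightarrow> \<Phi> x \<in> A"
    and E: "ucp (vn M) (vn N) E" and AM: "A \<subseteq> M"
  shows "finite_rank N (\<lambda>x. E (\<Phi> (F x)))"
proof -
  obtain B where B: "finite B" "\<And>x. x \<in> A \<Longrightarrow> \<exists>c. \<Phi> x = (\<Sum>b\<in>B. op_scale (c b) b)"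
    using rank unfolding finite_rank_def by blast
  \<comment> \<open>Complex combinations of B are real combinations of B and its multiples by the imaginary unit.\<close>
  let ?B = "B \<union> op_scale \<i> ` B"
  have in_span: "\<Phi> x \<in> span ?B" if x: "x \<in> A" for x
  proof -
    obtain c where c: "\<Phi> x = (\<Sum>b\<in>B. op_scale (c b) b)" using B(2)[OF x] by blast
    have "op_scale (c b) b \<in> span ?B" if "b \<in> B" for b
    proof -
      have "op_scale (c b) b = Re (c b) *\<^sub>R b + Im (c b) *\<^sub>R op_scale \<i> b"
      proof (rule blinfun_eqI)
        fix u
        have "c b *\<^sub>C b \<cdot> u
            = (of_real (Re (c b)) + of_real (Im (c b)) * \<i>) *\<^sub>C b \<cdot> u"
          by (subst (1) complex_eq) (simp add: mult.commute)
        then show "op_scale (c b) b \<cdot> u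
            = (Re (c b) *\<^sub>R b + Im (c b) *\<^sub>R op_scale \<i> b) \<cdot> u"
          by (simp add: blinfun.bilinear_simps scaleR_scaleC scaleC_scaleC scaleC_add_left)
      qed
      then show ?thesis using that by (simp only:) (intro span_add span_scale span_base; simp)
    qed
    then show ?thesis unfolding c by (intro span_sum)
  qed
  obtain B' where B': "B' \<subseteq> \<Phi> ` A" "independent B'" "\<Phi> ` A \<subseteq> span B'"
    using maximal_independent_subset by blast
  have "B' \<subseteq> span ?B" using B'(1) in_span by blast
  then have fin: "finite B'" using independent_span_bound[of ?B B'] B(1) B'(2) by blast
  note Es = ucp_vn_simps[OF E von_neumann_op_algebra[OF M]]
  have B'M: "B' \<subseteq> M" using B'(1) \<Phi> AM by blast
  have "E v \<in> span (E ` B') \<and> v \<in> M" if "v \<in> span B'" for v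
    using that
  proof (induction rule: span_induct_alt)
    case base
    then show ?case using Es M_closed by (simp add: span_zero)
  next
    case (step c x y)
    then have "x \<in> M" "E x \<in> E ` B'" using B'M by auto
    then show ?case
      using step M_closed by (auto simp: Es intro!: span_add span_scale intro: span_base)
  qed
  then have "E (\<Phi> (F x)) \<in> span (E ` B')" if "x \<in> N" for x using that F B'(3) by blast
  then have ex: "\<exists>u. E (\<Phi> (F x)) = (\<Sum>b\<in>E ` B'. u b *\<^sub>R b)" if "x \<in> N" for x
    using that span_finite[of "E ` B'"] fin by auto
  have "\<exists>c. E (\<Phi> (F x)) = (\<Sum>b\<in>E ` B'. op_scale (c b) b)" if x: "x \<in> N" for x
  proof -
    obtain u where "E (\<Phi> (F x)) = (\<Sum>b\<in>E ` B'. u b *\<^sub>R b)" using ex[OF x] by blast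
    then show ?thesis by (intro exI[of _ "\<lambda>b. of_real (u b)"]) (simp add: op_scale_real)
  qed
  then show ?thesis unfolding finite_rank_def using fin by (intro exI[of _ "E ` B'"]) auto
qed

lemma cb_norm_transfer:
  assumes N: "von_neumann_algebra N" "N \<subseteq> M" and N': "von_neumann_algebra N'" "N' \<subseteq> M"
    and F: "ucp (vn M) (vn N') F" and E: "ucp (vn M) (vn N) E" and \<Phi>: "\<And>x. x \<in> N' \<Longrightarrow> \<Phi> x \<in> N'"
  shows "cb_norm N (\<lambda>x. E (\<Phi> (F x))) \<le> cb_norm N' \<Phi>"
  unfolding cb_norm_def[of N]
proof (intro SUP_least)
  fix n :: nat and a
  assume n: "n \<in> {1..}" and a: "a \<in> {a. (\<forall>i<n. \<forall>j<n. a i j \<in> N) \<and> op_matrix_norm n a \<le> 1}"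
  have aM: "a i j \<in> M" if "i < n" "j < n" for i j using a that N(2) by blast
  have Fa: "F (a i j) \<in> N'" if "i < n" "j < n" for i j
    using aM[OF that] ucp_vn_simps(1)[OF F von_neumann_op_algebra[OF M]] by blast
  have "op_matrix_norm n (\<lambda>i j. F (a i j)) \<le> op_matrix_norm n a"
    by (rule ucp_op_matrix_norm_le[OF F M]) (use von_neumann_closed(1)[OF N'(1)] aM in auto)
  then have adm: "(\<lambda>i j. F (a i j)) \<in> {a. (\<forall>i<n. \<forall>j<n. a i j \<in> N') \<and> op_matrix_norm n a \<le> 1}"
    using a Fa by auto
  have "op_matrix_norm n (\<lambda>i j. E (\<Phi> (F (a i j)))) \<le> op_matrix_norm n (\<lambda>i j. \<Phi> (F (a i j)))"
    by (rule ucp_op_matrix_norm_le[OF E M]) (use von_neumann_closed(1)[OF N(1)] Fa \<Phi> N'(2) in auto)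
  then have "ennreal (op_matrix_norm n (\<lambda>i j. E (\<Phi> (F (a i j)))))
      \<le> ennreal (op_matrix_norm n (\<lambda>i j. \<Phi> (F (a i j))))" by (rule ennreal_leI)
  also have "\<dots> \<le> cb_norm N' \<Phi>"
    unfolding cb_norm_def by (rule SUP_upper2[OF n]) (rule SUP_upper2[OF adm], simp)
  finally show "ennreal (op_matrix_norm n (\<lambda>i j. E (\<Phi> (F (a i j))))) \<le> cb_norm N' \<Phi>" .
qed

lemma closedin_Lambda_cb:
  assumes C: "C \<ge> 0"
  shows "closedin (expectation_topology M \<phi>) {N \<in> expected_subalgebras M \<phi>. Lambda_cb N \<phi> \<le> ennreal C}"
proof (rule closedin_expectation_topologyI)
  fix N assume N: "N \<in> expected_subalgebras M \<phi>"
    and adherent: "adherent (\<lambda>N. Lambda_cb N \<phi> \<le> ennreal C) N"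
  let ?E = "cond_exp M \<phi> N"
  interpret E: expected_subalgebra M \<phi> N ?E by (rule cond_exp_expected[OF N])
  have "cb_approximable N C'" if C': "C' > C" for C'
    unfolding cb_approximable_def
  proof (intro allI impI)
    fix e :: real and X assume e: "e > 0" and X: "finite X \<and> X \<noteq> {} \<and> X \<subseteq> N \<inter> cball 0 1"
    obtain N' where N': "N' \<in> expected_subalgebras M \<phi>" "Lambda_cb N' \<phi> \<le> ennreal C"
      "cond_exp M \<phi> N' ` X \<subseteq> N' \<inter> cball 0 1"
      "\<And>\<Phi> x. x \<in> X \<Longrightarrow> \<Phi> (cond_exp M \<phi> N' x) \<in> N' \<Longrightarrow>
         norm2 \<phi> (\<Phi> (cond_exp M \<phi> N' x) - cond_exp M \<phi> N' x) < e / 2 \<Longrightarrow>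
         norm2 \<phi> (?E (\<Phi> (cond_exp M \<phi> N' x)) - x) < e"
      by (rule norm2_approximation[OF N e _ _ adherent, of X]) (use X in auto)
    let ?F = "cond_exp M \<phi> N'"
    interpret F: expected_subalgebra M \<phi> N' ?F by (rule cond_exp_expected[OF N'(1)])
    have "finite (?F ` X) \<and> ?F ` X \<noteq> {} \<and> ?F ` X \<subseteq> N' \<inter> cball 0 1" using N'(3) X by blast
    moreover have "cb_approximable N' C'" using N'(2) C' Lambda_cb_le_iff[OF C] by blast
    ultimately obtain \<Phi> where \<Phi>: "linear_map (vn N') (vn N') \<Phi>" "sigma_weakly_continuous (vn N') (vn N') \<Phi>"
      "finite_rank N' \<Phi>" "\<And>x. x \<in> ?F ` X \<Longrightarrow> norm2 \<phi> (\<Phi> x - x) < e / 2" "cb_norm N' \<Phi> \<le> ennreal C'"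
      using e unfolding cb_approximable_def by (meson half_gt_zero)
    have \<Phi>N: "\<Phi> y \<in> N'" if "y \<in> N'" for y using \<Phi>(1) that by (auto simp: linear_map_def)
    have Fn: "linear_map (vn N) (vn N') ?F" "sigma_weakly_continuous (vn N) (vn N') ?F"
      and En: "linear_map (vn N') (vn N) ?E" "sigma_weakly_continuous (vn N') (vn N) ?E"
      using F.E_restrict_normal_ucp[OF E.NM] E.E_restrict_normal_ucp[OF F.NM]
      by (auto simp: normal_ucp_def ucp_def)
    show "\<exists>\<Phi>. linear_map (vn N) (vn N) \<Phi> \<and> sigma_weakly_continuous (vn N) (vn N) \<Phi> \<and>
           finite_rank N \<Phi> \<and> (\<forall>x\<in>X. norm2 \<phi> (\<Phi> x - x) < e) \<and> cb_norm N \<Phi> \<le> ennreal C'"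
    proof (intro exI conjI ballI)
      show "linear_map (vn N) (vn N) (\<lambda>x. ?E (\<Phi> (?F x)))"
        by (rule linear_map_comp[OF linear_map_comp[OF Fn(1) \<Phi>(1)] En(1)])
      show "sigma_weakly_continuous (vn N) (vn N) (\<lambda>x. ?E (\<Phi> (?F x)))"
        by (rule sigma_weakly_continuous_comp[OF sigma_weakly_continuous_comp[OF Fn(2) \<Phi>(2)] En(2)])
      show "finite_rank N (\<lambda>x. ?E (\<Phi> (?F x)))"
        by (rule finite_rank_transfer[OF \<Phi>(3) F.N _ \<Phi>N E.E_ucp F.NM]) (use F.E_in E.in_M in auto)
      show "cb_norm N (\<lambda>x. ?E (\<Phi> (?F x))) \<le> ennreal C'"
        using cb_norm_transfer[OF E.N E.NM F.N F.NM F.E_ucp E.E_ucp \<Phi>N] \<Phi>(5) by (rule order_trans)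
      fix x assume x: "x \<in> X"
      then have "x \<in> M" using X E.in_M by blast
      then show "norm2 \<phi> (?E (\<Phi> (?F x)) - x) < e"
        using N'(4)[OF x, of \<Phi>] \<Phi>N F.E_in \<Phi>(4) x by blast
    qed
  qed
  then show "Lambda_cb N \<phi> \<le> ennreal C" using Lambda_cb_le_iff[OF C] by blast
qed

end

theorem theorem1p3:
  fixes M :: "('h::complex_hilbert \<Rightarrow>\<^sub>L 'h) set"
    and \<phi> :: "('h \<Rightarrow>\<^sub>L 'h) \<Rightarrow> complex"
  assumes "von_neumann_algebra M"
    and "separable_predual M"
    and "faithful_normal_state M \<phi>"
  shows "closedin (expectation_topology M \<phi>) {N \<in> expected_subalgebras M \<phi>. amenable N} \<and>
    closedin (expectation_topology M \<phi>) {N \<in> expected_subalgebras M \<phi>. haagerup_property N \<phi>} \<and>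
    (\<forall>C::real. C \<ge> 0 \<longrightarrow>
      closedin (expectation_topology M \<phi>)
        {N \<in> expected_subalgebras M \<phi>. Lambda_cb N \<phi> \<le> ennreal C})"
proof -
  interpret von_neumann_state M \<phi> using assms by unfold_locales
  show ?thesis using closedin_amenable closedin_haagerup closedin_Lambda_cb by blast
qed

end
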